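(* Let $d,k\in\mathbb{N}$, let $r>\frac{d+2k+1}{2}$, and let $f\in\mathcal{H}^r(\mathbb{S}^d)$. (1) There exists a constant $C>0$, depending only on $d,k,r$ and $f$, such that for every integer $n\ge 2$ and every set of points $\{\theta_j^*\}_{j=1}^n\subset\mathbb{S}^d$ whose antipodal separation distance satisfies $\underline{h}>0$, $$\inf_{f_n\in L_n^k}\|f-f_n\|_{\mathcal{L}^2(\mathbb{S}^d)}\ \ge\ C\,n^{-\frac12}\,\underline{h}^{\,k+\frac12}\,\|f\|_{\mathcal{L}^2(\mathbb{S}^d)} .$$ (2) In particular, for every $C_0>0$ there exists a constant $C'>0$, depending only on $d,k,r,f$ and $C_0$ (and not on $n$), such that for every $n\ge 2$ and every $\{\theta_j^*\}_{j=1}^n\subset\mathbb{S}^d$ that is antipodally quasi-uniform with constant $C_0$ (i.e. $\underline{h}>0$ and $h\le C_0\,\underline{h}$), $$\inf_{f_n\in L_n^k}\|f-f_n\|_{\mathcal{L}^2(\mathbb{S}^d)}\ \ge\ C'\,n^{-\frac{d+2k+1}{2d}}\,\|f\|_{\mathcal{L}^2(\mathbb{S}^d)} .$$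
   Context: $\mathbb{N}=\{1,2,\dots\}$; $\mathbb{S}^d=\{\eta\in\mathbb{R}^{d+1}:|\eta|=1\}$. The space $\mathcal{L}^2(\mathbb{S}^d)$ (real-valued functions) is taken with respect to the normalized surface measure (total mass $1$). For $\eta,\theta\in\mathbb{S}^d$, $\rho(\eta,\theta)=\arccos(\eta\cdot\theta)$ is the geodesic distance. Sobolev space: let $\Pi_m$ be the $\mathcal{L}^2$-orthogonal projection onto the space $\mathbb{Y}_m$ of spherical harmonics of degree $m$ on $\mathbb{S}^d$. For $r>0$, $\mathcal{H}^r(\mathbb{S}^d)$ is the set of $f\in\mathcal{L}^2(\mathbb{S}^d)$ with $\|f\|_{\mathcal{H}^r}^2:=\|f\|_{\mathcal{L}^2}^2+\sum_{m\ge1}m^{2r}\|\Pi_mf\|_{\mathcal{L}^2}^2<\infty$. Activation: $\sigma_k(t)=(\max\{t,0\})^k$ for $t\in\mathbb{R}$. Given $\{\theta_j^*\}_{j=1}^n\subset\mathbb{S}^d$, $L_n^k=\mathrm{span}\{\eta\mapsto\sigma_k(\theta_j^*\cdot\eta):\ j=1,\dots,n\}$, viewed as functions on $\mathbb{S}^d$. Fill distance: $h=\max_{\eta\in\mathbb{S}^d}\min_{1\le j\le n}\rho(\eta,\theta_j^* )$. Antipodal separation distance: $\underline{h}=\min_{i\ne j}\min\{\rho(\theta_i^*,\theta_j^* ),\rho(\theta_i^*,-\theta_j^* )\}$. A family of point sets is antipodally quasi-uniform if $h\lesssim\underline{h}$ with a constant uniform over the family. *)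

theory Defs
  imports "HOL-Analysis.Analysis"
begin

text \<open>
  The sphere \<open>S^d\<close> is \<open>sphere 0 1\<close> in a Euclidean space \<open>'a\<close> with \<open>DIM('a) = d + 1\<close>. Functions
  on the sphere are represented by total functions \<open>'a \<Rightarrow> real\<close>; all notions below depend
  only on their values on the sphere.
\<close>

text \<open>
  Normalized surface measure: the surface measure of \<open>A\<close> is proportional to the volume of the
  cone \<open>{t x | x \<in> A, 0 < t < 1}\<close> over \<open>A\<close> (polar coordinates). So it is the image of the
  uniform probability measure on the unit ball under \<open>x \<mapsto> x / |x| = sgn x\<close>, the null set
  \<open>{0}\<close> being discarded by the restriction to the sphere.
\<close>

definition sphere_measure :: "'a::euclidean_space measure" where
  "sphere_measure =
     restrict_space (distr (uniform_measure lborel (ball 0 1)) borel sgn) (sphere 0 1)"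

definition L2_sphere :: "('a::euclidean_space \<Rightarrow> real) set" where
  "L2_sphere = {f \<in> borel_measurable sphere_measure. integrable sphere_measure (\<lambda>\<eta>. (f \<eta>)\<^sup>2)}"

definition L2_inner :: "('a::euclidean_space \<Rightarrow> real) \<Rightarrow> ('a \<Rightarrow> real) \<Rightarrow> real" where
  "L2_inner f g = (LINT \<eta>|sphere_measure. f \<eta> * g \<eta>)"

definition L2_norm :: "('a::euclidean_space \<Rightarrow> real) \<Rightarrow> real" where
  "L2_norm f = sqrt (LINT \<eta>|sphere_measure. (f \<eta>)\<^sup>2)"

definition laplacian :: "('a::euclidean_space \<Rightarrow> real) \<Rightarrow> 'a \<Rightarrow> real" where
  "laplacian p x = (\<Sum>b\<in>Basis. (deriv ^^ 2) (\<lambda>t. p (x + t *\<^sub>R b)) 0)"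

definition homogeneous_harmonic_polynomial :: "nat \<Rightarrow> ('a::euclidean_space \<Rightarrow> real) \<Rightarrow> bool" where
  "homogeneous_harmonic_polynomial m p \<longleftrightarrow>
     real_polynomial_function p \<and> (\<forall>c x. p (c *\<^sub>R x) = c ^ m * p x) \<and> (\<forall>x. laplacian p x = 0)"

definition spherical_harmonics :: "nat \<Rightarrow> ('a::euclidean_space \<Rightarrow> real) set" where
  "spherical_harmonics m =
     {g. \<exists>p. homogeneous_harmonic_polynomial m p \<and> (\<forall>\<eta>\<in>sphere 0 1. g \<eta> = p \<eta>)}"

text \<open>
  The orthogonal projection of \<open>f\<close> is unique on the sphere; \<open>SOME\<close> only selects its
  irrelevant values elsewhere.
\<close>

definition harmonic_projection :: "nat \<Rightarrow> ('a::euclidean_space \<Rightarrow> real) \<Rightarrow> 'a \<Rightarrow> real" where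
  "harmonic_projection m f =
     (SOME g. g \<in> spherical_harmonics m \<and>
              (\<forall>y\<in>spherical_harmonics m. L2_inner (\<lambda>\<eta>. f \<eta> - g \<eta>) y = 0))"

text \<open>The sum over \<open>m \<ge> 1\<close> is reindexed by \<open>Suc\<close>.\<close>

definition sobolev_norm_sq :: "real \<Rightarrow> ('a::euclidean_space \<Rightarrow> real) \<Rightarrow> ennreal" where
  "sobolev_norm_sq r f =
     ennreal ((L2_norm f)\<^sup>2) +
     (\<Sum>m. ennreal (real (Suc m) powr (2 * r) * (L2_norm (harmonic_projection (Suc m) f))\<^sup>2))"

definition sobolev_sphere :: "real \<Rightarrow> ('a::euclidean_space \<Rightarrow> real) set" where
  "sobolev_sphere r = {f \<in> L2_sphere. sobolev_norm_sq r f < \<infinity>}"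

definition geodesic_dist :: "'a::euclidean_space \<Rightarrow> 'a \<Rightarrow> real" where
  "geodesic_dist \<eta> \<theta> = arccos (\<eta> \<bullet> \<theta>)"

definition relu_pow :: "nat \<Rightarrow> real \<Rightarrow> real" where
  "relu_pow k t = (max t 0) ^ k"

definition shallow_space :: "nat \<Rightarrow> nat \<Rightarrow> (nat \<Rightarrow> 'a::euclidean_space) \<Rightarrow> ('a \<Rightarrow> real) set" where
  "shallow_space k n \<theta> = {\<lambda>\<eta>. \<Sum>j=1..n. a j * relu_pow k (\<theta> j \<bullet> \<eta>) | a :: nat \<Rightarrow> real. True}"

text \<open>The supremum is a maximum, by compactness of the sphere.\<close>

definition fill_distance :: "nat \<Rightarrow> (nat \<Rightarrow> 'a::euclidean_space) \<Rightarrow> real" where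
  "fill_distance n \<theta> = (SUP \<eta>\<in>sphere 0 1. Min ((\<lambda>j. geodesic_dist \<eta> (\<theta> j)) ` {1..n}))"

definition antipodal_separation :: "nat \<Rightarrow> (nat \<Rightarrow> 'a::euclidean_space) \<Rightarrow> real" where
  "antipodal_separation n \<theta> =
     Min {min (geodesic_dist (\<theta> i) (\<theta> j)) (geodesic_dist (\<theta> i) (- \<theta> j)) | i j.
            i \<in> {1..n} \<and> j \<in> {1..n} \<and> i \<noteq> j}"

end

theory Submission
  imports Defs
begin

text \<open>
  Fix a network \<open>f_n = \<Sum>j. a_j relu_pow k (\<theta>_j \<bullet> \<eta>)\<close> and a degree \<open>l\<close> of the order of \<open>h\<^sup>-\<^sup>2\<close>, where
  \<open>h\<close> is the antipodal separation and \<open>k + l\<close> is odd. Convolution with \<open>relu_pow k\<close> and with the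
  \<open>l\<close>-th power acts on the spherical harmonics of degree \<open>m\<close> as a scalar \<open>\<mu>_m\<close>, respectively \<open>\<nu>_m\<close>
  (Funk-Hecke). Dividing the degree \<open>m\<close> component of \<open>\<Sum>j. a_j (\<theta>_j \<bullet> \<eta>) ^ l\<close> by \<open>\<mu>_m\<close> gives a
  polynomial \<open>\<phi>\<close> with \<open>\<langle>f_n, \<phi>\<rangle> = \<Sum>i j. a_i a_j (\<theta>_i \<bullet> \<theta>_j) ^ l\<close>. As the antipodal pairs are
  separated at scale \<open>l\<^sup>-\<^sup>1\<^sup>/\<^sup>2\<close>, this Gram matrix is diagonally dominant, so the pairing is
  comparable with \<open>|a|\<^sup>2\<close>. The decay of \<open>\<mu>_m\<close> and \<open>\<nu>_m\<close> bounds \<open>\<parallel>\<phi>\<parallel>\<^sup>2\<close> by \<open>l powr (k + 1/2) |a|\<^sup>2\<close>, and,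
  since \<open>2 r > d + 2 k + 1\<close>, also \<open>\<langle>f, \<phi>\<rangle>\<^sup>2\<close> by \<open>l powr (- d/2) |a|\<^sup>2\<close>. Either \<open>f_n\<close> is a bad approximation
  or \<open>|a| \<ge> \<parallel>f\<parallel> / (2 sqrt n)\<close>; in the second case \<open>n = O(h powr (- d))\<close> makes \<open>\<langle>f, \<phi>\<rangle>\<close> negligible and
  testing \<open>f - f_n\<close> against \<open>\<phi>\<close> yields the bound. Only polynomials are ever tested, so no
  completeness of the spherical harmonics is needed.
\<close>

section \<open>Invariance of the surface measure\<close>

text \<open>The exponents come from one maximisation. With d = \<open>DIM('a) - 1\<close>, \<nu>_m
  is at most of order l^(-d/2) exp (-m^2/(4l)), and \<mu>_m^(-2) grows at most like m^(2k+d+1). The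
  product peaks at m of order sqrt l with value l^(k+1/2), that is h^(-(2k+1)); its square root
  produces the factor h^(k+1/2) of the theorem. For f the growth of \<mu>_m^(-2) is paid by m^(2r),
  which is what the condition on r says, so only l^(-d/2), of order h^d, remains. Since n h^d is
  merely bounded and not small, the constant in front of h^(-2) must be large in terms of the norms
  of f: this is how the final constant comes to depend on f.

  The obstacle is parity: \<mu>_m vanishes for m > k with m - k even, so the test function is built
  from degrees of the other parity only. Such a function cannot tell a point from its antipode
  except by a sign, and the separation has to be antipodal. The power with k + l odd contains only
  admissible degrees and behaves like a Gaussian of width l^(-1/2) around the two poles.\<close>

lemma borel_measurable_sgn [measurable]: "sgn \<in> borel_measurable (borel :: 'a::euclidean_space measure)"
  unfolding sgn_div_norm by measurable

lemma linear_borel_measurable: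
  fixes T :: "'a::euclidean_space \<Rightarrow> 'a"
  shows "linear T \<Longrightarrow> T \<in> borel_measurable borel"
  by (intro borel_measurable_continuous_onI linear_continuous_on) (simp add: linear_conv_bounded_linear)

lemma nn_integral_lborel_translate:
  fixes f :: "'a::euclidean_space \<Rightarrow> ennreal"
  assumes [measurable]: "f \<in> borel_measurable borel"
  shows "(\<integral>\<^sup>+x. f (c + x) \<partial>lborel) = (\<integral>\<^sup>+x. f x \<partial>lborel)"
  by (subst (2) lborel_distr_plus[of c, symmetric]) (simp add: nn_integral_distr)

lemma nn_integral_lborel_reflect:
  fixes f :: "'a::euclidean_space \<Rightarrow> ennreal"
  assumes [measurable]: "f \<in> borel_measurable borel"
  shows "(\<integral>\<^sup>+x. f (c - x) \<partial>lborel) = (\<integral>\<^sup>+x. f x \<partial>lborel)"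
  by (subst (2) lborel_affine[of "-1" c]) (simp_all add: nn_integral_density nn_integral_distr)

text \<open>Uniqueness of Haar measure: comparing both measures with the ball, which the isometry
  preserves, by Fubini.\<close>

lemma nn_integral_lborel_isometry:
  fixes T :: "'a::euclidean_space \<Rightarrow> 'a" and f :: "'a \<Rightarrow> ennreal"
  assumes T: "linear T" "\<And>x. norm (T x) = norm x"
    and [measurable]: "f \<in> borel_measurable borel"
  shows "(\<integral>\<^sup>+x. f (T x) \<partial>lborel) = (\<integral>\<^sup>+x. f x \<partial>lborel)"
proof -
  note linear_borel_measurable[OF T(1), measurable]
  have [measurable]: "ball (0::'a) 1 \<in> sets borel" by simp
  have "inj T"
    using T by (subst linear_injective_0) (auto, metis norm_eq_zero)
  then have "surj T"
    using T(1) linear_injective_imp_surjective by blast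
  define v where "v = emeasure lborel (ball (0::'a) 1)"
  have v: "v \<noteq> 0" "v \<noteq> \<infinity>"
    using unit_ball_vol_pos[of "real DIM('a)"] by (simp_all add: v_def emeasure_ball less_imp_neq[symmetric])
  let ?B = "indicator (ball (0::'a) 1) :: 'a \<Rightarrow> ennreal"
  \<comment> \<open>Surjectivity turns a translation of the image into a translation of the
    argument.\<close>
  have shift: "(\<integral>\<^sup>+x. f (T x + y) \<partial>lborel) = (\<integral>\<^sup>+x. f (T x) \<partial>lborel)" for y
  proof -
    obtain z where z: "y = T z" using \<open>surj T\<close> by (metis surjD)
    have "(\<integral>\<^sup>+x. f (T x + y) \<partial>lborel) = (\<integral>\<^sup>+x. (\<lambda>w. f (T w)) (z + x) \<partial>lborel)"
      by (simp add: z linear_add[OF T(1)] add.commute)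
    then show ?thesis by (subst (asm) nn_integral_lborel_translate) simp_all
  qed
  have ballT: "(\<integral>\<^sup>+x. ?B (y - T x) \<partial>lborel) = v" for y
  proof -
    obtain z where z: "y = T z" using \<open>surj T\<close> by (metis surjD)
    have "(\<integral>\<^sup>+x. ?B (y - T x) \<partial>lborel) = (\<integral>\<^sup>+x. ?B (z - x) \<partial>lborel)"
      unfolding z by (simp add: linear_diff[OF T(1), symmetric] T(2) indicator_def)
    also have "\<dots> = (\<integral>\<^sup>+x. ?B x \<partial>lborel)"
      by (rule nn_integral_lborel_reflect) measurable
    finally show ?thesis by (simp add: v_def)
  qed
  have "(\<integral>\<^sup>+x. f (T x) \<partial>lborel) * v = (\<integral>\<^sup>+y. (\<integral>\<^sup>+x. f (T x) \<partial>lborel) * ?B y \<partial>lborel)"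
    by (simp add: v_def nn_integral_cmult)
  also have "\<dots> = (\<integral>\<^sup>+y. (\<integral>\<^sup>+x. f (T x + y) * ?B y \<partial>lborel) \<partial>lborel)"
    by (simp add: shift nn_integral_multc)
  also have "\<dots> = (\<integral>\<^sup>+x. (\<integral>\<^sup>+y. f (T x + y) * ?B y \<partial>lborel) \<partial>lborel)"
    by (rule lborel_pair.Fubini') measurable
  \<comment> \<open>Substituting for \<open>T x + y\<close> moves \<open>T\<close> out of
    \<open>f\<close> and into the ball, where it is harmless.\<close>
  also have "\<dots> = (\<integral>\<^sup>+x. (\<integral>\<^sup>+y. f y * ?B (y - T x) \<partial>lborel) \<partial>lborel)"
  proof (rule nn_integral_cong)
    fix x :: 'a
    have "(\<integral>\<^sup>+y. f y * ?B (y - T x) \<partial>lborel) = (\<integral>\<^sup>+y. (\<lambda>w. f w * ?B (w - T x)) (T x + y) \<partial>lborel)"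
      by (rule nn_integral_lborel_translate[symmetric]) measurable
    then show "(\<integral>\<^sup>+y. f (T x + y) * ?B y \<partial>lborel) = (\<integral>\<^sup>+y. f y * ?B (y - T x) \<partial>lborel)"
      by simp
  qed
  also have "\<dots> = (\<integral>\<^sup>+y. (\<integral>\<^sup>+x. f y * ?B (y - T x) \<partial>lborel) \<partial>lborel)"
    by (rule lborel_pair.Fubini') measurable
  also have "\<dots> = (\<integral>\<^sup>+y. f y * v \<partial>lborel)"
    by (intro nn_integral_cong) (subst nn_integral_cmult, measurable, simp add: ballT)
  also have "\<dots> = (\<integral>\<^sup>+y. f y \<partial>lborel) * v"
    by (simp add: nn_integral_multc)
  finally have "(\<integral>\<^sup>+x. f (T x) \<partial>lborel) * v / v = (\<integral>\<^sup>+x. f x \<partial>lborel) * v / v"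
    by simp
  then show ?thesis
    using v by (simp add: ennreal_mult_divide_eq)
qed

lemma distr_lborel_isometry:
  fixes T :: "'a::euclidean_space \<Rightarrow> 'a"
  assumes T: "linear T" "\<And>x. norm (T x) = norm x"
  shows "distr lborel borel T = lborel"
proof (rule measure_eqI)
  note linear_borel_measurable[OF T(1), measurable]
  fix A assume "A \<in> sets (distr lborel borel T)"
  then have [measurable]: "A \<in> sets borel" by simp
  have "emeasure (distr lborel borel T) A = (\<integral>\<^sup>+x. indicator A (T x) \<partial>lborel)"
    by (simp flip: nn_integral_indicator add: nn_integral_distr)
  also have "\<dots> = emeasure lborel A"
    by (subst nn_integral_lborel_isometry[OF T]) simp_all
  finally show "emeasure (distr lborel borel T) A = emeasure lborel A" .
qed simp

lemma space_sphere_measure [simp]: "space (sphere_measure :: 'a::euclidean_space measure) = sphere 0 1"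
  by (simp add: sphere_measure_def space_restrict_space)

lemma sets_sphere_measure [measurable_cong]:
  "sets (sphere_measure :: 'a::euclidean_space measure) = sets (restrict_space borel (sphere 0 1))"
  unfolding sphere_measure_def by (rule sets_restrict_space_cong) simp

lemma borel_measurable_sphere_measure:
  "h \<in> borel_measurable borel \<Longrightarrow> h \<in> borel_measurable (sphere_measure :: 'a::euclidean_space measure)"
  by (subst measurable_cong_sets[OF sets_sphere_measure refl]) (rule measurable_restrict_space1)

text \<open>\<open>sgn 0 = 0\<close> lies off the sphere, hence the puncture. In this form the
  invariance of Lebesgue measure can be transferred to the sphere.\<close>

lemma integral_sphere_measure:
  fixes h :: "'a::euclidean_space \<Rightarrow> real"
  assumes [measurable]: "h \<in> borel_measurable borel"
  shows "(LINT \<eta>|sphere_measure. h \<eta>) =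
    (LINT x|lborel. indicator (ball 0 1 - {0}) x * h (sgn x)) / measure lborel (ball (0::'a) 1)"
proof -
  have [measurable]: "sphere (0::'a) 1 \<in> sets borel" by simp
  have "(LINT \<eta>|sphere_measure. h \<eta>)
     = (LINT \<eta>|distr (uniform_measure lborel (ball 0 1)) borel sgn. indicator (sphere 0 1) \<eta> *\<^sub>R h \<eta>)"
    unfolding sphere_measure_def by (rule integral_restrict_space) simp
  also have "\<dots> = (LINT x|uniform_measure lborel (ball 0 1). indicator (sphere 0 1) (sgn x) *\<^sub>R h (sgn x))"
    by (rule integral_distr) measurable
  \<comment> \<open>\<open>integral_density\<close> wants a real density, so the quotient of
    extended reals becomes a quotient of reals.\<close>
  also have "uniform_measure lborel (ball (0::'a) 1) =
      density lborel (\<lambda>x. ennreal (indicator (ball 0 1) x / measure lborel (ball (0::'a) 1)))"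
    unfolding uniform_measure_def
  proof (rule arg_cong[where f="density lborel"], rule ext)
    fix x :: 'a
    have "emeasure lborel (ball (0::'a) 1) = ennreal (measure lborel (ball (0::'a) 1))"
      by (rule emeasure_eq_ennreal_measure) (use emeasure_lborel_ball_finite in \<open>auto simp: less_top\<close>)
    moreover have "measure lborel (ball (0::'a) 1) > 0"
      using unit_ball_vol_pos[of "real DIM('a)"] by (simp add: measure_def emeasure_ball)
    ultimately show "indicator (ball 0 1) x / emeasure lborel (ball (0::'a) 1) =
      ennreal (indicator (ball 0 1) x / measure lborel (ball (0::'a) 1))"
      by (auto simp: indicator_def divide_ennreal simp flip: ennreal_1)
  qed
  also have "(LINT x|\<dots>. indicator (sphere 0 1) (sgn x) *\<^sub>R h (sgn x))
     = (LINT x|lborel. (indicator (ball 0 1) x / measure lborel (ball (0::'a) 1)) *\<^sub>R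
          (indicator (sphere 0 1) (sgn x) *\<^sub>R h (sgn x)))"
    by (rule integral_density) (measurable, auto intro!: AE_I2)
  also have "\<dots> = (LINT x|lborel. (indicator (ball 0 1 - {0}) x * h (sgn x)) / measure lborel (ball (0::'a) 1))"
    by (rule Bochner_Integration.integral_cong) (auto simp: indicator_def norm_sgn)
  finally show ?thesis by simp
qed

lemma emeasure_sphere_measure:
  "emeasure (sphere_measure :: 'a::euclidean_space measure) (sphere 0 1) = 1"
proof -
  have pre: "sgn -` sphere 0 1 = - {0::'a}"
    by (auto simp: norm_sgn split: if_splits)
  have "emeasure (sphere_measure :: 'a measure) (sphere 0 1) =
      emeasure (distr (uniform_measure lborel (ball (0::'a) 1)) borel sgn) (sphere 0 1)"
    unfolding sphere_measure_def by (rule emeasure_restrict_space) auto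
  also have "\<dots> = emeasure (uniform_measure lborel (ball (0::'a) 1)) (- {0})"
    by (subst emeasure_distr) (simp_all add: pre)
  also have "\<dots> = emeasure lborel (ball (0::'a) 1 - {0}) / emeasure lborel (ball (0::'a) 1)"
    by (simp add: emeasure_uniform_measure Diff_eq)
  also have "emeasure lborel (ball (0::'a) 1 - {0}) = emeasure lborel (ball (0::'a) 1)"
    by (rule emeasure_Diff_null_set) auto
  also have "\<dots> / emeasure lborel (ball (0::'a) 1) = 1"
    using unit_ball_vol_pos[of "real DIM('a)"]
    by (intro ennreal_divide_self) (simp_all add: emeasure_ball less_imp_neq[symmetric])
  finally show ?thesis .
qed

text \<open>A linear isometry commutes with \<open>sgn\<close> and preserves the punctured
  ball.\<close>

lemma integral_sphere_measure_isometry: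
  fixes T :: "'a::euclidean_space \<Rightarrow> 'a" and h :: "'a \<Rightarrow> real"
  assumes T: "linear T" "\<And>x. norm (T x) = norm x" and h: "h \<in> borel_measurable borel"
  shows "(LINT \<eta>|sphere_measure. h (T \<eta>)) = (LINT \<eta>|sphere_measure. h \<eta>)"
proof -
  note linear_borel_measurable[OF T(1), measurable]
  have [measurable]: "ball (0::'a) 1 \<in> sets borel" by simp
  note h [measurable]
  have sgnT: "sgn (T x) = T (sgn x)" for x
    by (simp add: sgn_div_norm linear_cmul[OF T(1)] T(2))
  have T0: "T x = 0 \<longleftrightarrow> x = 0" for x
    using T(2)[of x] by (metis norm_eq_zero)
  have "(LINT x|lborel. indicator (ball 0 1 - {0}) x * h (T (sgn x))) =
      (LINT x|lborel. indicator (ball 0 1 - {0}) (T x) * h (sgn (T x)))"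
    by (rule Bochner_Integration.integral_cong) (simp_all add: sgnT indicator_def T(2) T0)
  also have "\<dots> = (LINT x|distr lborel borel T. indicator (ball 0 1 - {0}) x * h (sgn x))"
    by (rule integral_distr[symmetric]) measurable
  finally show ?thesis
    by (simp add: integral_sphere_measure distr_lborel_isometry[OF T])
qed

section \<open>Square-integrable functions and moments on the sphere\<close>

interpretation sphere: finite_measure "sphere_measure :: 'a::euclidean_space measure"
  by (rule finite_measureI) (simp add: emeasure_sphere_measure)

lemma measure_sphere_measure [simp]:
  "measure (sphere_measure :: 'a::euclidean_space measure) (sphere 0 1) = 1"
  by (simp add: measure_def emeasure_sphere_measure)

lemma borel_measurable_sphere_continuous:
  fixes h :: "'a::euclidean_space \<Rightarrow> real"
  shows "continuous_on UNIV h \<Longrightarrow> h \<in> borel_measurable sphere_measure"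
  by (intro borel_measurable_sphere_measure borel_measurable_continuous_onI)

lemma sphere_continuous_bound:
  fixes h :: "'a::euclidean_space \<Rightarrow> real"
  assumes "continuous_on UNIV h"
  obtains C where "C > 0" "\<And>\<eta>. norm \<eta> = 1 \<Longrightarrow> \<bar>h \<eta>\<bar> \<le> C"
proof -
  have "compact (h ` sphere 0 1)"
    using assms by (intro compact_continuous_image) (auto intro: continuous_on_subset)
  then obtain C where C: "C > 0" "\<And>y. y \<in> h ` sphere 0 1 \<Longrightarrow> norm y \<le> C"
    using compact_imp_bounded bounded_pos by metis
  show ?thesis
    by (rule that[of C]) (use C in auto)
qed

lemma integrable_sphere_mult:
  fixes f h :: "'a::euclidean_space \<Rightarrow> real"
  assumes f: "integrable sphere_measure f" and h: "continuous_on UNIV h"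
  shows "integrable sphere_measure (\<lambda>\<eta>. f \<eta> * h \<eta>)"
proof -
  obtain C where C: "C > 0" "\<And>\<eta>. norm \<eta> = 1 \<Longrightarrow> \<bar>h \<eta>\<bar> \<le> C"
    using sphere_continuous_bound[OF h] by blast
  show ?thesis
  proof (rule Bochner_Integration.integrable_bound)
    show "integrable sphere_measure (\<lambda>\<eta>. C * f \<eta>)" using f by simp
    show "(\<lambda>\<eta>. f \<eta> * h \<eta>) \<in> borel_measurable sphere_measure"
      using f borel_measurable_sphere_continuous[OF h] by (intro borel_measurable_times) auto
    show "AE \<eta> in sphere_measure. norm (f \<eta> * h \<eta>) \<le> norm (C * f \<eta>)"
      using C by (intro AE_I2) (auto simp: abs_mult mult.commute[of C] intro!: mult_mono)
  qed
qed

lemma integrable_sphere_continuous: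
  fixes h :: "'a::euclidean_space \<Rightarrow> real"
  shows "continuous_on UNIV h \<Longrightarrow> integrable sphere_measure h"
  using integrable_sphere_mult[of "\<lambda>_. 1" h] by simp

lemma continuous_L2_sphere:
  "continuous_on UNIV h \<Longrightarrow> h \<in> L2_sphere"
  unfolding L2_sphere_def
  by (auto intro!: borel_measurable_sphere_continuous integrable_sphere_continuous continuous_intros)

lemma L2_sphere_integrable_mult:
  assumes "f \<in> L2_sphere" "g \<in> L2_sphere"
  shows "integrable sphere_measure (\<lambda>\<eta>. f \<eta> * g \<eta>)"
proof (rule Bochner_Integration.integrable_bound)
  show "integrable sphere_measure (\<lambda>\<eta>. (f \<eta>)\<^sup>2 + (g \<eta>)\<^sup>2)"
    using assms by (simp add: L2_sphere_def)
  show "(\<lambda>\<eta>. f \<eta> * g \<eta>) \<in> borel_measurable sphere_measure"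
    using assms by (auto simp: L2_sphere_def intro!: borel_measurable_times)
  show "AE \<eta> in sphere_measure. norm (f \<eta> * g \<eta>) \<le> norm ((f \<eta>)\<^sup>2 + (g \<eta>)\<^sup>2)"
  proof (rule AE_I2)
    fix \<eta> :: 'a
    have "2 * (\<bar>f \<eta>\<bar> * \<bar>g \<eta>\<bar>) \<le> (f \<eta>)\<^sup>2 + (g \<eta>)\<^sup>2"
      using sum_squares_bound[of "\<bar>f \<eta>\<bar>" "\<bar>g \<eta>\<bar>"] by simp
    then show "norm (f \<eta> * g \<eta>) \<le> norm ((f \<eta>)\<^sup>2 + (g \<eta>)\<^sup>2)"
      using mult_nonneg_nonneg[of "\<bar>f \<eta>\<bar>" "\<bar>g \<eta>\<bar>"]
      by (simp add: abs_mult del: mult_nonneg_nonneg)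
  qed
qed

lemma L2_sphere_integrable: "f \<in> L2_sphere \<Longrightarrow> integrable sphere_measure f"
  using L2_sphere_integrable_mult[of f "\<lambda>_. 1"] continuous_L2_sphere[of "\<lambda>_. 1"] by simp

lemma L2_sphere_add:
  assumes "f \<in> L2_sphere" "g \<in> L2_sphere"
  shows "(\<lambda>\<eta>. f \<eta> + g \<eta>) \<in> L2_sphere"
proof -
  have "integrable sphere_measure (\<lambda>\<eta>. (f \<eta>)\<^sup>2 + (g \<eta>)\<^sup>2 + 2 * (f \<eta> * g \<eta>))"
    using assms L2_sphere_integrable_mult[OF assms] by (simp add: L2_sphere_def)
  then show ?thesis
    using assms by (auto simp: L2_sphere_def power2_sum mult.assoc intro!: borel_measurable_add)
qed

lemma L2_sphere_cmult: "f \<in> L2_sphere \<Longrightarrow> (\<lambda>\<eta>. c * f \<eta>) \<in> L2_sphere"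
  by (auto simp: L2_sphere_def power_mult_distrib intro!: borel_measurable_times)

lemma L2_sphere_diff:
  assumes "f \<in> L2_sphere" "g \<in> L2_sphere"
  shows "(\<lambda>\<eta>. f \<eta> - g \<eta>) \<in> L2_sphere"
  using L2_sphere_add[OF assms(1) L2_sphere_cmult[OF assms(2), of "-1"]] by simp

lemma L2_norm_nonneg [simp]: "0 \<le> L2_norm f"
  by (simp add: L2_norm_def)

lemma L2_norm_sq: "(L2_norm f)\<^sup>2 = L2_inner f f"
  by (simp add: L2_norm_def L2_inner_def power2_eq_square)

lemma L2_inner_commute: "L2_inner f g = L2_inner g f"
  by (simp add: L2_inner_def mult.commute)

lemma L2_inner_add_left:
  assumes "f \<in> L2_sphere" "g \<in> L2_sphere" "h \<in> L2_sphere"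
  shows "L2_inner (\<lambda>\<eta>. f \<eta> + g \<eta>) h = L2_inner f h + L2_inner g h"
  unfolding L2_inner_def
  by (simp add: distrib_right L2_sphere_integrable_mult assms)

lemma L2_inner_cmult_left: "L2_inner (\<lambda>\<eta>. c * f \<eta>) h = c * L2_inner f h"
  by (simp add: L2_inner_def mult.assoc)

lemma L2_inner_diff_left:
  assumes "f \<in> L2_sphere" "g \<in> L2_sphere" "h \<in> L2_sphere"
  shows "L2_inner (\<lambda>\<eta>. f \<eta> - g \<eta>) h = L2_inner f h - L2_inner g h"
  unfolding L2_inner_def
  by (simp add: left_diff_distrib L2_sphere_integrable_mult assms)

lemma L2_sphere_sum:
  assumes "\<And>i. i \<in> I \<Longrightarrow> F i \<in> L2_sphere"
  shows "(\<lambda>\<eta>. \<Sum>i\<in>I. F i \<eta>) \<in> L2_sphere"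
  using assms
  by (induction I rule: infinite_finite_induct)
    (auto intro: L2_sphere_add continuous_L2_sphere[of "\<lambda>_. 0"])

lemma L2_inner_sum_left:
  assumes "\<And>i. i \<in> I \<Longrightarrow> F i \<in> L2_sphere" "h \<in> L2_sphere"
  shows "L2_inner (\<lambda>\<eta>. \<Sum>i\<in>I. F i \<eta>) h = (\<Sum>i\<in>I. L2_inner (F i) h)"
  unfolding L2_inner_def sum_distrib_right
  by (rule Bochner_Integration.integral_sum) (simp add: L2_sphere_integrable_mult assms)

lemma L2_Cauchy_Schwarz:
  assumes f: "f \<in> L2_sphere" and g: "g \<in> L2_sphere"
  shows "\<bar>L2_inner f g\<bar> \<le> L2_norm f * L2_norm g"
proof -
  have quad: "0 \<le> (L2_norm f)\<^sup>2 - 2 * t * L2_inner f g + t\<^sup>2 * (L2_norm g)\<^sup>2" for t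
  proof -
    have "0 \<le> L2_inner (\<lambda>\<eta>. f \<eta> - t * g \<eta>) (\<lambda>\<eta>. f \<eta> - t * g \<eta>)"
      by (simp add: L2_inner_def)
    also have "\<dots> = L2_inner f f - 2 * t * L2_inner f g + t\<^sup>2 * L2_inner g g"
    proof -
      let ?h = "\<lambda>\<eta>. f \<eta> - t * g \<eta>"
      have tg: "(\<lambda>\<eta>. t * g \<eta>) \<in> L2_sphere" by (rule L2_sphere_cmult[OF g])
      have h: "?h \<in> L2_sphere" by (rule L2_sphere_diff[OF f tg])
      have fh: "L2_inner u ?h = L2_inner u f - t * L2_inner u g" if "u \<in> L2_sphere" for u
        using L2_inner_diff_left[OF f tg that] L2_inner_cmult_left[of t g u]
        by (simp add: L2_inner_commute)
      show ?thesis
        using L2_inner_diff_left[OF f tg h] L2_inner_cmult_left[of t g ?h] fh[OF f] fh[OF g]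
          L2_inner_commute[of g f]
        by (simp add: algebra_simps power2_eq_square)
    qed
    finally show ?thesis by (simp add: L2_norm_sq)
  qed
  have "(L2_inner f g)\<^sup>2 \<le> (L2_norm f)\<^sup>2 * (L2_norm g)\<^sup>2"
  proof (cases "L2_norm g = 0")
    case True
    have "L2_inner f g = 0"
    proof (rule ccontr)
      assume "L2_inner f g \<noteq> 0"
      \<comment> \<open>The quadratic has degenerated to a linear function of \<open>t\<close>, and
        this \<open>t\<close> gives it the value -1.\<close>
      then show False
        using quad[of "((L2_norm f)\<^sup>2 + 1) / (2 * L2_inner f g)"] True by (simp add: field_simps)
    qed
    then show ?thesis by simp
  next
    case False
    then have pos: "(L2_norm g)\<^sup>2 > 0" by simp
    \<comment> \<open>Here \<open>t\<close> is the vertex of the quadratic.\<close>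
    have "0 \<le> (L2_norm f)\<^sup>2 - (L2_inner f g)\<^sup>2 / (L2_norm g)\<^sup>2"
      using quad[of "L2_inner f g / (L2_norm g)\<^sup>2"] False by (simp add: field_simps power2_eq_square)
    then show ?thesis
      using pos by (simp add: field_simps)
  qed
  then show ?thesis
    by (metis abs_le_square_iff abs_of_nonneg L2_norm_nonneg mult_nonneg_nonneg power_mult_distrib)
qed

lemma L2_norm_triangle:
  assumes f: "f \<in> L2_sphere" and g: "g \<in> L2_sphere"
  shows "L2_norm (\<lambda>\<eta>. f \<eta> + g \<eta>) \<le> L2_norm f + L2_norm g"
proof (rule power2_le_imp_le)
  let ?h = "\<lambda>\<eta>. f \<eta> + g \<eta>"
  have h: "?h \<in> L2_sphere" by (rule L2_sphere_add[OF f g])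
  have "(L2_norm ?h)\<^sup>2 = L2_inner f ?h + L2_inner g ?h"
    unfolding L2_norm_sq by (rule L2_inner_add_left[OF f g h])
  also have "\<dots> = (L2_norm f)\<^sup>2 + 2 * L2_inner f g + (L2_norm g)\<^sup>2"
    using L2_inner_add_left[OF f g f] L2_inner_add_left[OF f g g] L2_inner_commute[of f ?h]
      L2_inner_commute[of g ?h] L2_inner_commute[of g f] by (simp add: L2_norm_sq)
  also have "\<dots> \<le> (L2_norm f + L2_norm g)\<^sup>2"
    using L2_Cauchy_Schwarz[OF f g] by (simp add: power2_sum)
  finally show "(L2_norm ?h)\<^sup>2 \<le> (L2_norm f + L2_norm g)\<^sup>2" .
qed simp

lemma L2_norm_cmult: "L2_norm (\<lambda>\<eta>. c * f \<eta>) = \<bar>c\<bar> * L2_norm f"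
  by (simp add: L2_norm_def power_mult_distrib real_sqrt_mult)

lemma L2_norm_sum_le:
  assumes "finite I" "\<And>i. i \<in> I \<Longrightarrow> F i \<in> L2_sphere"
  shows "L2_norm (\<lambda>\<eta>. \<Sum>i\<in>I. F i \<eta>) \<le> (\<Sum>i\<in>I. L2_norm (F i))"
  using assms
proof (induction I rule: finite_induct)
  case empty
  then show ?case by (simp add: L2_norm_def)
next
  case (insert i I)
  have "L2_norm (\<lambda>\<eta>. F i \<eta> + (\<Sum>i\<in>I. F i \<eta>)) \<le> L2_norm (F i) + L2_norm (\<lambda>\<eta>. \<Sum>i\<in>I. F i \<eta>)"
    by (rule L2_norm_triangle) (use insert in \<open>auto intro: L2_sphere_sum\<close>)
  then show ?case using insert by simp
qed

lemma L2_inner_cong_sphere: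
  assumes "\<And>\<eta>. norm \<eta> = 1 \<Longrightarrow> f \<eta> = f' \<eta>" "\<And>\<eta>. norm \<eta> = 1 \<Longrightarrow> g \<eta> = g' \<eta>"
  shows "L2_inner f g = L2_inner f' g'"
  unfolding L2_inner_def by (rule Bochner_Integration.integral_cong) (simp_all add: assms)

lemma L2_sphere_cong:
  fixes f g :: "'a::euclidean_space \<Rightarrow> real"
  assumes "\<And>\<eta>. norm \<eta> = 1 \<Longrightarrow> f \<eta> = g \<eta>"
  shows "f \<in> L2_sphere \<longleftrightarrow> g \<in> L2_sphere"
proof -
  have "f \<in> borel_measurable sphere_measure \<longleftrightarrow> g \<in> borel_measurable sphere_measure"
    by (rule measurable_cong) (simp add: assms)
  moreover have "integrable sphere_measure (\<lambda>\<eta>. (f \<eta>)\<^sup>2) \<longleftrightarrow> integrable sphere_measure (\<lambda>\<eta>. (g \<eta>)\<^sup>2)"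
    by (rule Bochner_Integration.integrable_cong) (simp_all add: assms)
  ultimately show ?thesis by (simp add: L2_sphere_def)
qed

text \<open>\<open>T\<close> is the reflection in the hyperplane orthogonal to
  \<open>e - e'\<close>; it is self-adjoint and exchanges the two vectors, because their norms
  agree.\<close>

lemma integral_sphere_inner_cong:
  fixes e e' :: "'a::euclidean_space" and h :: "real \<Rightarrow> real"
  assumes n: "norm e = norm e'" and h: "continuous_on UNIV h"
  shows "(LINT \<eta>|sphere_measure. h (e \<bullet> \<eta>)) = (LINT \<eta>|sphere_measure. h (e' \<bullet> \<eta>))"
proof (cases "e = e'")
  case False
  define u where "u = e - e'"
  define T where "T = (\<lambda>x::'a. x - (2 * (x \<bullet> u) / (u \<bullet> u)) *\<^sub>R u)"
  have u: "u \<bullet> u \<noteq> 0" using False by (simp add: u_def)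
  have ee: "e \<bullet> e = e' \<bullet> e'" using n by (simp add: norm_eq)
  have lin: "linear T"
    by (rule linearI) (auto simp: T_def inner_add_left algebra_simps add_divide_distrib)
  have nrm: "norm (T x) = norm x" for x
  proof -
    have "T x \<bullet> T x = x \<bullet> x"
      using u by (simp add: T_def inner_diff inner_commute field_simps)
    then show ?thesis by (simp add: norm_eq)
  qed
  have eu: "e \<bullet> u = (u \<bullet> u) / 2"
    using ee by (simp add: u_def inner_diff inner_commute)
  have Te: "e \<bullet> T x = e' \<bullet> x" for x
  proof -
    have "e \<bullet> T x = e \<bullet> x - x \<bullet> u"
      using u by (simp add: T_def inner_diff_right eu)
    then show ?thesis by (simp add: u_def inner_diff inner_commute)
  qed
  have "(LINT \<eta>|sphere_measure. h (e \<bullet> \<eta>)) = (LINT \<eta>|sphere_measure. h (e \<bullet> T \<eta>))"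
    by (rule integral_sphere_measure_isometry[OF lin nrm, symmetric])
      (intro borel_measurable_continuous_onI continuous_on_compose2[OF h] continuous_intros, simp)
  then show ?thesis by (simp add: Te)
qed simp

text \<open>The basis vector is arbitrary by rotation invariance. Absolute values let odd
  \<open>k\<close> give a nonzero moment, which the activation needs. The value is Gamma(D/2)
  Gamma((k+1)/2) / (sqrt pi Gamma((D+k)/2)) with D the dimension, but only its recursion in
  \<open>k\<close> is used below.\<close>

definition sphere_moment :: "'a::euclidean_space itself \<Rightarrow> nat \<Rightarrow> real" where
  "sphere_moment _ k = (LINT \<eta>|sphere_measure. \<bar>(SOME b::'a. b \<in> Basis) \<bullet> \<eta>\<bar> ^ k)"

lemma integral_sphere_abs_power:
  fixes x :: "'a::euclidean_space"
  assumes "x \<noteq> 0"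
  shows "(LINT \<eta>|sphere_measure. \<bar>x \<bullet> \<eta>\<bar> ^ k) = sphere_moment TYPE('a) k * norm x ^ k"
proof -
  define e where "e = (SOME b::'a. b \<in> Basis)"
  have "norm e = 1"
    unfolding e_def by (rule norm_Basis) (rule SOME_Basis)
  then have "(LINT \<eta>|sphere_measure. \<bar>x \<bullet> \<eta>\<bar> ^ k) = (LINT \<eta>|sphere_measure. \<bar>(norm x *\<^sub>R e) \<bullet> \<eta>\<bar> ^ k)"
    by (intro integral_sphere_inner_cong) (auto intro!: continuous_intros)
  also have "\<dots> = (LINT \<eta>|sphere_measure. norm x ^ k * \<bar>e \<bullet> \<eta>\<bar> ^ k)"
    by (simp add: abs_mult power_mult_distrib)
  finally show ?thesis by (simp add: sphere_moment_def e_def)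
qed

lemma integral_sphere_uminus:
  fixes h :: "'a::euclidean_space \<Rightarrow> real"
  assumes "continuous_on UNIV h"
  shows "(LINT \<eta>|sphere_measure. h (- \<eta>)) = (LINT \<eta>|sphere_measure. h \<eta>)"
  using assms
  by (intro integral_sphere_measure_isometry borel_measurable_continuous_onI)
    (auto simp: linear_conv_bounded_linear bounded_linear_minus[OF bounded_linear_ident])

lemma integral_sphere_power:
  fixes x :: "'a::euclidean_space"
  assumes "x \<noteq> 0"
  shows "(LINT \<eta>|sphere_measure. (x \<bullet> \<eta>) ^ k) =
    (if even k then sphere_moment TYPE('a) k else 0) * norm x ^ k"
proof (cases "even k")
  case True
  then show ?thesis
    using integral_sphere_abs_power[OF assms, of k] by (simp add: power_even_abs)
next
  case False
  have "(LINT \<eta>|sphere_measure. (x \<bullet> - \<eta>) ^ k) = (LINT \<eta>|sphere_measure. (x \<bullet> \<eta>) ^ k)"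
    by (rule integral_sphere_uminus) (intro continuous_intros)
  with False show ?thesis by simp
qed

lemma continuous_relu_pow: "continuous_on A (relu_pow k)"
  unfolding relu_pow_def by (intro continuous_intros)

lemma continuous_relu_ridge: "continuous_on A (\<lambda>\<eta>. relu_pow k (x \<bullet> \<eta>))"
  unfolding relu_pow_def by (intro continuous_intros)

lemma relu_ridge_L2_sphere: "(\<lambda>\<eta>. relu_pow k (x \<bullet> \<eta>)) \<in> L2_sphere"
  by (intro continuous_L2_sphere continuous_relu_ridge)

text \<open>For \<open>k \<ge> 1\<close> the power \<bar>t\<bar>^k is the sum of the activation at t
  and at -t, and the antipodal map shows that both halves have the same integral.\<close>

lemma integral_sphere_relu_pow:
  fixes x :: "'a::euclidean_space"
  assumes "x \<noteq> 0" and "k \<ge> 1"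
  shows "(LINT \<eta>|sphere_measure. relu_pow k (x \<bullet> \<eta>)) = sphere_moment TYPE('a) k / 2 * norm x ^ k"
proof -
  have cont': "continuous_on UNIV (\<lambda>\<eta>. relu_pow k (x \<bullet> - \<eta>))"
    unfolding relu_pow_def by (intro continuous_intros)
  have "(LINT \<eta>|sphere_measure. \<bar>x \<bullet> \<eta>\<bar> ^ k)
      = (LINT \<eta>|sphere_measure. relu_pow k (x \<bullet> \<eta>) + relu_pow k (x \<bullet> - \<eta>))"
    using \<open>k \<ge> 1\<close> by (intro Bochner_Integration.integral_cong refl) (auto simp: relu_pow_def max_def)
  also have "\<dots> = (LINT \<eta>|sphere_measure. relu_pow k (x \<bullet> \<eta>)) + (LINT \<eta>|sphere_measure. relu_pow k (x \<bullet> - \<eta>))"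
    by (rule Bochner_Integration.integral_add) (intro integrable_sphere_continuous continuous_relu_ridge cont')+
  also have "(LINT \<eta>|sphere_measure. relu_pow k (x \<bullet> - \<eta>)) = (LINT \<eta>|sphere_measure. relu_pow k (x \<bullet> \<eta>))"
    by (rule integral_sphere_uminus[OF continuous_relu_ridge])
  finally show ?thesis
    by (simp add: integral_sphere_abs_power[OF assms(1)])
qed

section \<open>Directional derivatives and solid harmonics\<close>

text \<open>Only polynomials are differentiated, so derivatives along lines suffice; they match the
  one-variable \<open>deriv\<close> inside \<open>laplacian\<close>.\<close>

definition ddir :: "'a::euclidean_space \<Rightarrow> ('a \<Rightarrow> real) \<Rightarrow> 'a \<Rightarrow> real" where
  "ddir v p x = deriv (\<lambda>t. p (x + t *\<^sub>R v)) 0"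

text \<open>The derivative is described at every \<open>t\<close>, by one polynomial evaluated along
  the line, so that the process can be iterated.\<close>

lemma real_polynomial_function_ddir_ex:
  fixes p :: "'a::euclidean_space \<Rightarrow> real"
  assumes "real_polynomial_function p"
  shows "\<exists>q. real_polynomial_function q \<and>
    (\<forall>x t. ((\<lambda>t. p (x + t *\<^sub>R v)) has_real_derivative q (x + t *\<^sub>R v)) (at t))"
  using assms
proof (induction p rule: real_polynomial_function.induct)
  case (linear f)
  then have "linear f" by (rule bounded_linear.linear)
  then have "((\<lambda>t. f (x + t *\<^sub>R v)) has_real_derivative f v) (at t)" for x t
    by (auto simp: linear_add linear_cmul intro!: derivative_eq_intros)
  then show ?case by (intro exI[of _ "\<lambda>_. f v"]) auto
next
  case (const c)
  show ?case by (intro exI[of _ "\<lambda>_. 0"]) auto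
next
  case (add f g)
  then obtain f' g' where
    "real_polynomial_function f'" "real_polynomial_function g'"
    "\<And>x t. ((\<lambda>t. f (x + t *\<^sub>R v)) has_real_derivative f' (x + t *\<^sub>R v)) (at t)"
    "\<And>x t. ((\<lambda>t. g (x + t *\<^sub>R v)) has_real_derivative g' (x + t *\<^sub>R v)) (at t)"
    by blast
  then show ?case by (intro exI[of _ "\<lambda>x. f' x + g' x"]) (auto intro: DERIV_add)
next
  case (mult f g)
  then obtain f' g' where
    "real_polynomial_function f'" "real_polynomial_function g'"
    "\<And>x t. ((\<lambda>t. f (x + t *\<^sub>R v)) has_real_derivative f' (x + t *\<^sub>R v)) (at t)"
    "\<And>x t. ((\<lambda>t. g (x + t *\<^sub>R v)) has_real_derivative g' (x + t *\<^sub>R v)) (at t)"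
    by blast
  then show ?case using mult
    by (intro exI[of _ "\<lambda>x. f' x * g x + g' x * f x"]) (auto intro: DERIV_mult)
qed

lemma ddir_eqI:
  assumes "((\<lambda>t. p (x + t *\<^sub>R v)) has_real_derivative D) (at 0)"
  shows "ddir v p x = D"
  unfolding ddir_def using assms by (rule DERIV_imp_deriv)

lemma
  assumes p: "real_polynomial_function p"
  shows real_polynomial_function_ddir [intro, simp]: "real_polynomial_function (ddir v p)"
    and has_derivative_ddir:
      "((\<lambda>t. p (x + t *\<^sub>R v)) has_real_derivative ddir v p (x + t *\<^sub>R v)) (at t)"
proof -
  obtain q where q: "real_polynomial_function q"
    "\<And>x t. ((\<lambda>t. p (x + t *\<^sub>R v)) has_real_derivative q (x + t *\<^sub>R v)) (at t)"
    using real_polynomial_function_ddir_ex[OF p] by blast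
  have "ddir v p = q"
  proof
    fix x show "ddir v p x = q x"
      using q(2)[of x 0] by (intro ddir_eqI) simp
  qed
  with q show "real_polynomial_function (ddir v p)"
    "((\<lambda>t. p (x + t *\<^sub>R v)) has_real_derivative ddir v p (x + t *\<^sub>R v)) (at t)" by auto
qed

lemma has_derivative_ddir_0:
  "real_polynomial_function p \<Longrightarrow> ((\<lambda>t. p (x + t *\<^sub>R v)) has_real_derivative ddir v p x) (at 0)"
  using has_derivative_ddir[of p x v 0] by simp

lemma ddir_const [simp]: "ddir v (\<lambda>x. c) = (\<lambda>x. 0)"
  by (rule ext, rule ddir_eqI) simp

lemma ddir_linear:
  assumes "bounded_linear f" shows "ddir v f = (\<lambda>x. f v)"
proof (rule ext, rule ddir_eqI)
  fix x
  have "linear f" using assms by (rule bounded_linear.linear)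
  then show "((\<lambda>t. f (x + t *\<^sub>R v)) has_real_derivative f v) (at 0)"
    by (auto simp: linear_add linear_cmul intro!: derivative_eq_intros)
qed

lemma ddir_add:
  assumes "real_polynomial_function p" "real_polynomial_function q"
  shows "ddir v (\<lambda>x. p x + q x) = (\<lambda>x. ddir v p x + ddir v q x)"
  by (rule ext, rule ddir_eqI, intro DERIV_add has_derivative_ddir_0 assms)

lemma ddir_mult:
  assumes "real_polynomial_function p" "real_polynomial_function q"
  shows "ddir v (\<lambda>x. p x * q x) = (\<lambda>x. ddir v p x * q x + p x * ddir v q x)"
proof (rule ext, rule ddir_eqI)
  fix x
  show "((\<lambda>t. p (x + t *\<^sub>R v) * q (x + t *\<^sub>R v)) has_real_derivative
    ddir v p x * q x + p x * ddir v q x) (at 0)"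
    using DERIV_mult[OF has_derivative_ddir_0[OF assms(1), of x v] has_derivative_ddir_0[OF assms(2), of x v]]
    by (simp add: mult.commute)
qed

lemma ddir_cmult:
  assumes "real_polynomial_function p"
  shows "ddir v (\<lambda>x. c * p x) = (\<lambda>x. c * ddir v p x)"
  using ddir_mult[OF real_polynomial_function.intros(2) assms, of v c] by simp

lemma ddir_sum:
  assumes "finite I" "\<And>i. i \<in> I \<Longrightarrow> real_polynomial_function (F i)"
  shows "ddir v (\<lambda>x. \<Sum>i\<in>I. F i x) = (\<lambda>x. \<Sum>i\<in>I. ddir v (F i) x)"
  using assms
  by (induction I rule: finite_induct) (simp_all add: ddir_add real_polynomial_function_sum)

lemma ddir_power:
  assumes "real_polynomial_function p"
  shows "ddir v (\<lambda>x. p x ^ n) = (\<lambda>x. of_nat n * p x ^ (n - 1) * ddir v p x)"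
  by (rule ext, rule ddir_eqI)
    (use DERIV_power[OF has_derivative_ddir_0[OF assms], of _ v n] in \<open>simp add: mult_ac\<close>)

lemma ddir_inner_left: "ddir v (\<lambda>x. x \<bullet> u) = (\<lambda>x. v \<bullet> u)"
  by (rule ddir_linear) (rule bounded_linear_inner_left)

text \<open>Linearity in the direction lets Euler's identity, a statement about the moving direction
  \<open>x\<close>, be differentiated as a finite sum.\<close>

lemma ddir_direction:
  assumes "real_polynomial_function p"
  shows "ddir v p x = (\<Sum>b\<in>Basis. (v \<bullet> b) * ddir b p x)"
  using assms
proof (induction p rule: real_polynomial_function.induct)
  case (linear f)
  then have "linear f" by (rule bounded_linear.linear)
  then have "f v = (\<Sum>b\<in>Basis. (v \<bullet> b) * f b)"
    using linear_sum[of f "\<lambda>b. (v \<bullet> b) *\<^sub>R b" Basis] by (simp add: euclidean_representation linear_cmul)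
  then show ?case by (simp add: ddir_linear[OF linear])
qed (simp_all add: ddir_add ddir_mult sum.distrib sum_distrib_left sum_distrib_right algebra_simps)

text \<open>Induction over the generators of the polynomials takes the place of the symmetry theorem
  for second derivatives.\<close>

lemma ddir_commute:
  assumes "real_polynomial_function p"
  shows "ddir v (ddir w p) = ddir w (ddir v p)"
  using assms
proof (induction p rule: real_polynomial_function.induct)
  case (mult f g)
  then show ?case
    by (simp add: ddir_add ddir_mult real_polynomial_function.intros(4)) (simp add: algebra_simps)
qed (simp_all add: ddir_linear ddir_add)

lemma laplacian_eq:
  assumes "real_polynomial_function p"
  shows "laplacian p x = (\<Sum>b\<in>Basis. ddir b (ddir b p) x)"
proof -
  have "(deriv ^^ 2) (\<lambda>t. p (x + t *\<^sub>R b)) 0 = ddir b (ddir b p) x" for b :: 'a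
  proof -
    have "deriv (\<lambda>t. p (x + t *\<^sub>R b)) = (\<lambda>t. ddir b p (x + t *\<^sub>R b))"
      by (rule ext, rule DERIV_imp_deriv, rule has_derivative_ddir[OF assms])
    then show ?thesis by (simp add: numeral_2_eq_2 ddir_def[of b "ddir b p"])
  qed
  then show ?thesis by (simp add: laplacian_def)
qed

lemma laplacian_add:
  assumes "real_polynomial_function p" "real_polynomial_function q"
  shows "laplacian (\<lambda>x. p x + q x) x = laplacian p x + laplacian q x"
  using assms by (simp add: laplacian_eq ddir_add sum.distrib real_polynomial_function.intros(3))

lemma laplacian_cmult:
  assumes p: "real_polynomial_function p"
  shows "laplacian (\<lambda>x. c * p x) x = c * laplacian p x"
proof -
  have "real_polynomial_function (\<lambda>x. c * p x)"
    using p by (intro real_polynomial_function.intros(2,4))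
  then show ?thesis
    using p by (simp add: laplacian_eq ddir_cmult sum_distrib_left)
qed

lemma laplacian_sum:
  fixes F :: "'i \<Rightarrow> 'a::euclidean_space \<Rightarrow> real"
  assumes "finite I" "\<And>i. i \<in> I \<Longrightarrow> real_polynomial_function (F i)"
  shows "laplacian (\<lambda>x. \<Sum>i\<in>I. F i x) x = (\<Sum>i\<in>I. laplacian (F i) x)"
  using assms
proof (induction I rule: finite_induct)
  case empty
  have "laplacian (\<lambda>x::'a. 0) x = 0"
    using laplacian_cmult[OF real_polynomial_function.intros(2)[of 0], of 0 x] by simp
  then show ?case by simp
next
  case (insert i I)
  then show ?case by (simp add: laplacian_add real_polynomial_function_sum)
qed

text \<open>Homogeneity enters through Euler's identity, which survives differentiation without any
  case distinction on the degree.\<close>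

definition solid_harmonic :: "nat \<Rightarrow> ('a::euclidean_space \<Rightarrow> real) \<Rightarrow> bool" where
  "solid_harmonic m p \<longleftrightarrow> real_polynomial_function p \<and>
     (\<forall>x. ddir x p x = real m * p x) \<and> (\<forall>x. laplacian p x = 0)"

lemma euler_identity:
  assumes p: "real_polynomial_function p" and hom: "\<And>c x. p (c *\<^sub>R x) = c ^ m * p x"
  shows "ddir x p x = real m * p x"
proof (rule ddir_eqI)
  have "p (x + t *\<^sub>R x) = (1 + t) ^ m * p x" for t
    using hom[of "1 + t" x] by (simp add: scaleR_add_left)
  then show "((\<lambda>t. p (x + t *\<^sub>R x)) has_real_derivative real m * p x) (at 0)"
    by (auto intro!: derivative_eq_intros)
qed

lemma homogeneous_harmonic_polynomial_solid:
  "homogeneous_harmonic_polynomial m p \<Longrightarrow> solid_harmonic m p"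
  unfolding homogeneous_harmonic_polynomial_def solid_harmonic_def
  by (auto intro: euler_identity)

text \<open>Euler's identity in degree 0 makes \<open>p\<close> constant along rays. It says nothing
  at the origin itself, which is reached by continuity.\<close>

lemma solid_harmonic_0:
  assumes "solid_harmonic 0 p"
  shows "p x = p 0"
proof -
  have p: "real_polynomial_function p" and 0: "\<And>x. ddir x p x = 0"
    using assms by (auto simp: solid_harmonic_def)
  have der: "((\<lambda>t. p (t *\<^sub>R x)) has_real_derivative ddir x p (t *\<^sub>R x)) (at t)" for t
    using has_derivative_ddir[OF p, of 0 x t] by simp
  have "ddir x p (t *\<^sub>R x) = 0" if "t > 0" for t
  proof -
    have "t * ddir x p (t *\<^sub>R x) = ddir (t *\<^sub>R x) p (t *\<^sub>R x)"
      by (simp add: ddir_direction[OF p, of x] ddir_direction[OF p, of "t *\<^sub>R x"]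
          sum_distrib_left mult.assoc)
    with that 0 show ?thesis by simp
  qed
  then have der0: "((\<lambda>t. p (t *\<^sub>R x)) has_real_derivative 0) (at t)" if "0 < t" for t
    using der[of t] that by simp
  have "(\<lambda>t. p (t *\<^sub>R x)) 1 = (\<lambda>t. p (t *\<^sub>R x)) 0"
  proof (rule DERIV_isconst_end[where a=0 and b=1])
    show "continuous_on {0..1} (\<lambda>t. p (t *\<^sub>R x))"
      using der by (intro continuous_at_imp_continuous_on ballI DERIV_isCont)
  qed (use der0 in auto)
  then show ?thesis by simp
qed

text \<open>Differentiating Euler's identity along \<open>v\<close> produces one extra copy of
  \<open>ddir v p\<close>; moving it across lowers the degree from m + 1 to m.\<close>

lemma solid_harmonic_ddir:
  assumes "solid_harmonic (Suc m) p"
  shows "solid_harmonic m (ddir v p)"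
proof -
  have p: "real_polynomial_function p" and eul: "\<And>x. ddir x p x = real (Suc m) * p x"
    and lap: "\<And>x. laplacian p x = 0"
    using assms by (auto simp: solid_harmonic_def)
  note poly = p real_polynomial_function.intros(1)[OF bounded_linear_inner_left]
  have "ddir x (ddir v p) x = real m * ddir v p x" for x
  proof -
    have "(\<lambda>x. \<Sum>b\<in>Basis. (x \<bullet> b) * ddir b p x) = (\<lambda>x. real (Suc m) * p x)"
      using eul by (simp add: ddir_direction[OF p, symmetric])
    then have "ddir v (\<lambda>x. \<Sum>b\<in>Basis. (x \<bullet> b) * ddir b p x) x = ddir v (\<lambda>x. real (Suc m) * p x) x"
      by simp
    then have "(\<Sum>b\<in>Basis. (v \<bullet> b) * ddir b p x + (x \<bullet> b) * ddir v (ddir b p) x) = real (Suc m) * ddir v p x"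
      using p by (subst (asm) ddir_sum)
        (auto intro!: real_polynomial_function.intros(4) poly simp: ddir_mult poly ddir_cmult ddir_inner_left)
    then show ?thesis
      using p by (simp add: sum.distrib ddir_commute[OF p, of v] ddir_direction[OF p, of v, symmetric]
          ddir_direction[OF real_polynomial_function_ddir[OF p], symmetric] algebra_simps)
  qed
  moreover have "laplacian (ddir v p) x = 0" for x
  proof -
    have "laplacian (ddir v p) x = ddir v (\<lambda>x. \<Sum>b\<in>Basis. ddir b (ddir b p) x) x"
      using p by (simp add: laplacian_eq ddir_sum ddir_commute[of _ v])
    also have "(\<lambda>x. \<Sum>b\<in>Basis. ddir b (ddir b p) x) = (\<lambda>x. 0)"
      using lap by (simp add: laplacian_eq[OF p, symmetric])
    finally show ?thesis by simp
  qed
  ultimately show ?thesis using p by (simp add: solid_harmonic_def)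
qed

lemma continuous_real_polynomial_function:
  fixes p :: "'a::euclidean_space \<Rightarrow> real"
  shows "real_polynomial_function p \<Longrightarrow> continuous_on A p"
  by (induction p rule: real_polynomial_function.induct)
    (auto intro: continuous_intros linear_continuous_on)

section \<open>The Funk-Hecke formula for ridge functions\<close>

text \<open>What the Funk-Hecke argument uses of a family of profiles: each is the normalised
  antiderivative of its predecessor, and its mean over the sphere is known. Both the powers
  (\<open>K = 0\<close>) and the activations (\<open>K = 1\<close>, as the step function is not
  continuous) are instances.\<close>

locale ridge_family =
  fixes g :: "nat \<Rightarrow> real \<Rightarrow> real" and c :: "nat \<Rightarrow> real" and K :: nat
  assumes deriv: "\<And>k t. K \<le> k \<Longrightarrow> (g (Suc k) has_real_derivative real (Suc k) * g k t) (at t)"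
    and cont: "\<And>k. K \<le> k \<Longrightarrow> continuous_on UNIV (g k)"
    and mean: "\<And>k (x::'a::euclidean_space). K \<le> k \<Longrightarrow> x \<noteq> 0 \<Longrightarrow>
      (LINT \<eta>|sphere_measure. g k (x \<bullet> \<eta>)) = c k * norm x ^ k"
begin

lemma continuous_ridge:
  "K \<le> k \<Longrightarrow> continuous_on UNIV (\<lambda>\<eta>::'a. g k (x \<bullet> \<eta>))"
  by (rule continuous_on_compose2[OF cont]) (auto intro: continuous_intros)

text \<open>Differentiation under the integral: dominated convergence along sequences, with the mean
  value theorem supplying the majorant.\<close>

lemma ridge_integral_deriv:
  fixes x v :: 'a
  assumes K: "K \<le> k" and q: "continuous_on UNIV q"
  shows "((\<lambda>t. LINT \<eta>|sphere_measure. g (Suc k) ((x + t *\<^sub>R v) \<bullet> \<eta>) * q \<eta>) has_real_derivative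
    real (Suc k) * (LINT \<eta>|sphere_measure. g k (x \<bullet> \<eta>) * ((v \<bullet> \<eta>) * q \<eta>))) (at 0)"
proof -
  define F where "F t = (LINT \<eta>|sphere_measure. g (Suc k) ((x + t *\<^sub>R v) \<bullet> \<eta>) * q \<eta>)" for t
  define D where "D \<eta> = real (Suc k) * (g k (x \<bullet> \<eta>) * ((v \<bullet> \<eta>) * q \<eta>))" for \<eta>
  define Q where "Q h \<eta> = (g (Suc k) ((x + h *\<^sub>R v) \<bullet> \<eta>) * q \<eta> - g (Suc k) (x \<bullet> \<eta>) * q \<eta>) / h" for h \<eta>
  have K': "K \<le> Suc k" using K by simp
  have int: "integrable sphere_measure (\<lambda>\<eta>. g (Suc k) (y \<bullet> \<eta>) * q \<eta>)" for y
    by (intro integrable_sphere_continuous continuous_intros continuous_ridge K' q)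
  have contQ: "continuous_on UNIV (Q h)" if "h \<noteq> 0" for h
    unfolding Q_def using that by (intro continuous_intros continuous_ridge K' q) auto
  have contD: "continuous_on UNIV D"
    unfolding D_def by (intro continuous_intros continuous_ridge K q)
  have "(\<lambda>h. (F h - F 0) / h) \<midarrow>0\<rightarrow> (LINT \<eta>|sphere_measure. D \<eta>)"
    unfolding tendsto_at_iff_sequentially comp_def
  proof (intro allI impI)
    fix X :: "nat \<Rightarrow> real"
    assume X: "\<forall>i. X i \<in> UNIV - {0}" "X \<longlonglongrightarrow> 0"
    then have X0: "X i \<noteq> 0" for i by auto
    obtain R where R: "\<And>i. \<bar>X i\<bar> \<le> R"
      using X(2) Bseq_def convergentI convergent_imp_Bseq by (metis real_norm_def)
    \<comment> \<open>All arguments of the profile that occur stay in [-S, S], uniformly in the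
      sequence index and in \<eta>.\<close>
    define S where "S = norm x + R * norm v"
    have R0: "R \<ge> 0" using R[of 0] by simp
    obtain B where B: "\<And>t. \<bar>t\<bar> \<le> S \<Longrightarrow> \<bar>real (Suc k) * g k t\<bar> \<le> B"
    proof -
      have "compact ((\<lambda>t. real (Suc k) * g k t) ` {-S..S})"
        by (intro compact_continuous_image continuous_intros continuous_on_subset[OF cont[OF K]]) auto
      then obtain B where "\<And>y. y \<in> (\<lambda>t. real (Suc k) * g k t) ` {-S..S} \<Longrightarrow> norm y \<le> B"
        using compact_imp_bounded bounded_iff by metis
      then show ?thesis by (intro that[of B]) (auto simp: abs_le_iff)
    qed
    have "(\<lambda>i. LINT \<eta>|sphere_measure. Q (X i) \<eta>) \<longlonglongrightarrow> (LINT \<eta>|sphere_measure. D \<eta>)"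
    proof (rule integral_dominated_convergence)
      show "D \<in> borel_measurable sphere_measure"
        by (rule borel_measurable_sphere_continuous[OF contD])
      show "Q (X i) \<in> borel_measurable sphere_measure" for i
        by (rule borel_measurable_sphere_continuous[OF contQ[OF X0]])
      show "integrable sphere_measure (\<lambda>\<eta>::'a. B * \<bar>v \<bullet> \<eta>\<bar> * \<bar>q \<eta>\<bar>)"
        by (intro integrable_sphere_continuous continuous_intros q)
      show "AE \<eta> in sphere_measure. (\<lambda>i. Q (X i) \<eta>) \<longlonglongrightarrow> D \<eta>"
      proof (rule AE_I2)
        fix \<eta> :: 'a
        have "((\<lambda>t. g (Suc k) ((x + t *\<^sub>R v) \<bullet> \<eta>) * q \<eta>) has_real_derivative D \<eta>) (at 0)"
          unfolding D_def
          by (rule derivative_eq_intros refl DERIV_chain2[OF deriv[OF K]] | simp add: inner_add_left)+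
        then have "(\<lambda>h. Q h \<eta>) \<midarrow>0\<rightarrow> D \<eta>"
          by (simp add: DERIV_def Q_def)
        then show "(\<lambda>i. Q (X i) \<eta>) \<longlonglongrightarrow> D \<eta>"
          using X unfolding tendsto_at_iff_sequentially comp_def by blast
      qed
      show "AE \<eta> in sphere_measure. norm (Q (X i) \<eta>) \<le> B * \<bar>v \<bullet> \<eta>\<bar> * \<bar>q \<eta>\<bar>" for i
      proof (rule AE_I2)
        fix \<eta> :: 'a assume "\<eta> \<in> space sphere_measure"
        then have n: "norm \<eta> = 1" by simp
        have xb: "\<bar>x \<bullet> \<eta>\<bar> \<le> norm x" and vb: "\<bar>v \<bullet> \<eta>\<bar> \<le> norm v"
          using Cauchy_Schwarz_ineq2[of x \<eta>] Cauchy_Schwarz_ineq2[of v \<eta>] n by auto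
        have m: "\<bar>X i * (v \<bullet> \<eta>)\<bar> \<le> R * norm v"
          unfolding abs_mult by (intro mult_mono R vb R0) auto
        have "norm (g (Suc k) ((x + X i *\<^sub>R v) \<bullet> \<eta>) - g (Suc k) (x \<bullet> \<eta>))
            \<le> B * norm ((x + X i *\<^sub>R v) \<bullet> \<eta> - x \<bullet> \<eta>)"
        proof (rule field_differentiable_bound[of "{-S..S}"])
          show "(g (Suc k) has_field_derivative real (Suc k) * g k t) (at t within {-S..S})" for t
            using deriv[OF K] by (rule has_field_derivative_at_within)
        qed (use B xb m R0 in \<open>auto simp: S_def inner_add_left abs_le_iff\<close>)
        then have "norm ((g (Suc k) ((x + X i *\<^sub>R v) \<bullet> \<eta>) - g (Suc k) (x \<bullet> \<eta>)) * q \<eta>)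
            \<le> B * \<bar>X i * (v \<bullet> \<eta>)\<bar> * \<bar>q \<eta>\<bar>"
          by (simp add: abs_mult inner_add_left mult_right_mono)
        then show "norm (Q (X i) \<eta>) \<le> B * \<bar>v \<bullet> \<eta>\<bar> * \<bar>q \<eta>\<bar>"
          using X0[of i] by (simp add: Q_def abs_mult field_simps)
      qed
    qed
    moreover have "(LINT \<eta>|sphere_measure. Q (X i) \<eta>) = (F (X i) - F 0) / X i" for i
      unfolding Q_def F_def
      using int[of x] int[of "x + X i *\<^sub>R v"] by (simp add: diff_divide_distrib)
    ultimately show "(\<lambda>i. (F (X i) - F 0) / X i) \<longlonglongrightarrow> (LINT \<eta>|sphere_measure. D \<eta>)"
      by simp
  qed
  then have "(F has_real_derivative (LINT \<eta>|sphere_measure. D \<eta>)) (at 0)"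
    by (simp add: DERIV_def)
  moreover have "(LINT \<eta>|sphere_measure. D \<eta>) =
      real (Suc k) * (LINT \<eta>|sphere_measure. g k (x \<bullet> \<eta>) * ((v \<bullet> \<eta>) * q \<eta>))"
    by (simp add: D_def)
  ultimately show ?thesis unfolding F_def by metis
qed

end

text \<open>The eigenvalue on degree \<open>m\<close> of convolution with the \<open>k\<close>-th
  profile. One degree is traded for one index; the numerator is the exponent of the norm that
  differentiation brings down, and its zero at m = k + 1 is the source of all vanishing
  multipliers.\<close>

primrec funk_hecke_coeff :: "(nat \<Rightarrow> real) \<Rightarrow> nat \<Rightarrow> nat \<Rightarrow> real" where
  "funk_hecke_coeff c 0 k = c k"
| "funk_hecke_coeff c (Suc m) k = funk_hecke_coeff c m (Suc k) * (real k + 1 - real m) / (real k + 1)"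

text \<open>A real exponent, because k - m in the Funk-Hecke formula may be negative.\<close>

lemma has_derivative_norm_powr:
  fixes x v :: "'a::euclidean_space"
  assumes "x \<noteq> 0"
  shows "((\<lambda>t. norm (x + t *\<^sub>R v) powr s) has_real_derivative s * norm x powr (s - 2) * (v \<bullet> x)) (at 0)"
proof -
  have nx: "norm x > 0" using assms by simp
  have "((\<lambda>t. norm (x + t *\<^sub>R v)) has_real_derivative (v \<bullet> x) / norm x) (at 0)"
  proof -
    have "((\<lambda>t. sqrt (x \<bullet> x + 2 * t * (v \<bullet> x) + t\<^sup>2 * (v \<bullet> v))) has_real_derivative (v \<bullet> x) / norm x) (at 0)"
      using nx inner_ge_zero[of x]
      by (auto intro!: derivative_eq_intros simp: norm_eq_sqrt_inner field_simps simp del: inner_ge_zero)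
    moreover have "(\<lambda>t. norm (x + t *\<^sub>R v)) = (\<lambda>t. sqrt (x \<bullet> x + 2 * t * (v \<bullet> x) + t\<^sup>2 * (v \<bullet> v)))"
      by (auto simp: norm_eq_sqrt_inner inner_add inner_commute power2_eq_square algebra_simps)
    ultimately show ?thesis by simp
  qed
  then have "((\<lambda>t. norm (x + t *\<^sub>R v) powr s) has_real_derivative
      s * norm x powr (s - 1) * ((v \<bullet> x) / norm x)) (at 0)"
    using nx DERIV_fun_powr[of "\<lambda>t. norm (x + t *\<^sub>R v)" "(v \<bullet> x) / norm x" 0 s] by simp
  moreover have "norm x powr (s - 1) = norm x powr (s - 2) * norm x"
  proof -
    have "norm x powr (s - 1) = norm x powr (s - 2) * norm x powr 1"
      by (subst powr_add[symmetric]) simp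
    then show ?thesis using nx by simp
  qed
  ultimately show ?thesis using nx by (simp add: mult_ac)
qed

context ridge_family
begin

text \<open>Euler's identity writes \<open>p\<close> through its first derivatives; the extra factors \<open>\<eta> \<bullet> b\<close>
  come from differentiating the ridge function of the next higher index.\<close>

theorem funk_hecke:
  fixes x :: 'a
  assumes "solid_harmonic m p" "K \<le> k" "x \<noteq> 0"
  shows "(LINT \<eta>|sphere_measure. g k (x \<bullet> \<eta>) * p \<eta>) =
    funk_hecke_coeff c m k * norm x powr (real k - real m) * p x"
  using assms
proof (induction m arbitrary: p k x)
  case 0
  then have "p \<eta> = p x" for \<eta> using solid_harmonic_0[of p] by metis
  then have "(LINT \<eta>|sphere_measure. g k (x \<bullet> \<eta>) * p \<eta>) = (LINT \<eta>|sphere_measure. g k (x \<bullet> \<eta>) * p x)"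
    by (intro Bochner_Integration.integral_cong refl arg_cong2[where f="(*)"])
  then show ?case using mean[OF 0(2,3)] 0(3) by (simp add: powr_realpow)
next
  case (Suc m)
  have p: "real_polynomial_function p" and eul: "\<And>x. ddir x p x = real (Suc m) * p x"
    and lap: "\<And>x. laplacian p x = 0"
    using Suc.prems(1) by (auto simp: solid_harmonic_def)
  define C where "C = funk_hecke_coeff c m (Suc k)"
  define s where "s = real (Suc k) - real m"
  have q: "solid_harmonic m (ddir b p)" "real_polynomial_function (ddir b p)"
    "continuous_on UNIV (ddir b p)" for b
    using solid_harmonic_ddir[OF Suc.prems(1)] p by (auto intro: continuous_real_polynomial_function)
  \<comment> \<open>The same derivative in direction \<open>b\<close> is computed twice: under the
    integral, and from the closed form that the induction hypothesis provides near
    \<open>x\<close>.\<close>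
  have step: "real (Suc k) * (LINT \<eta>|sphere_measure. g k (x \<bullet> \<eta>) * ((b \<bullet> \<eta>) * ddir b p \<eta>)) =
      C * (s * norm x powr (s - 2) * (b \<bullet> x) * ddir b p x + norm x powr s * ddir b (ddir b p) x)" for b
  proof (rule DERIV_unique)
    show "((\<lambda>t. LINT \<eta>|sphere_measure. g (Suc k) ((x + t *\<^sub>R b) \<bullet> \<eta>) * ddir b p \<eta>) has_real_derivative
      real (Suc k) * (LINT \<eta>|sphere_measure. g k (x \<bullet> \<eta>) * ((b \<bullet> \<eta>) * ddir b p \<eta>))) (at 0)"
      by (rule ridge_integral_deriv[OF Suc.prems(2) q(3)])
    have "((\<lambda>t. C * (norm (x + t *\<^sub>R b) powr s * ddir b p (x + t *\<^sub>R b))) has_real_derivative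
      C * (s * norm x powr (s - 2) * (b \<bullet> x) * ddir b p x + norm x powr s * ddir b (ddir b p) x)) (at 0)"
      by (rule DERIV_cong[OF DERIV_cmult[OF DERIV_mult[OF has_derivative_norm_powr[OF Suc.prems(3)]
        has_derivative_ddir_0[OF q(2)]]]]) simp
    moreover have "\<forall>\<^sub>F t in nhds 0. C * (norm (x + t *\<^sub>R b) powr s * ddir b p (x + t *\<^sub>R b)) =
        (LINT \<eta>|sphere_measure. g (Suc k) ((x + t *\<^sub>R b) \<bullet> \<eta>) * ddir b p \<eta>)"
    proof -
      have "\<forall>\<^sub>F t in nhds 0. x + t *\<^sub>R b \<in> - {0}"
      proof (rule topological_tendstoD)
        show "((\<lambda>t. x + t *\<^sub>R b) \<longlongrightarrow> x) (nhds (0::real))"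
          by (rule tendsto_eq_intros refl filterlim_ident | simp)+
      qed (use Suc.prems(3) in auto)
      then show ?thesis
      proof eventually_elim
        case (elim t)
        then show ?case
          using Suc.IH[OF q(1), of "Suc k" "x + t *\<^sub>R b" b] Suc.prems(2) by (simp add: C_def s_def)
      qed
    qed
    ultimately show "((\<lambda>t. LINT \<eta>|sphere_measure. g (Suc k) ((x + t *\<^sub>R b) \<bullet> \<eta>) * ddir b p \<eta>) has_real_derivative
      C * (s * norm x powr (s - 2) * (b \<bullet> x) * ddir b p x + norm x powr s * ddir b (ddir b p) x)) (at 0)"
      by (simp add: DERIV_cong_ev)
  qed
  have "real (Suc k) * real (Suc m) * (LINT \<eta>|sphere_measure. g k (x \<bullet> \<eta>) * p \<eta>)
      = real (Suc k) * (LINT \<eta>|sphere_measure. (\<Sum>b\<in>Basis. g k (x \<bullet> \<eta>) * ((b \<bullet> \<eta>) * ddir b p \<eta>)))"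
  proof -
    have "(\<Sum>b\<in>Basis. g k (x \<bullet> \<eta>) * ((b \<bullet> \<eta>) * ddir b p \<eta>)) = real (Suc m) * (g k (x \<bullet> \<eta>) * p \<eta>)" for \<eta>
      using eul[of \<eta>] by (simp add: ddir_direction[OF p, of \<eta>] sum_distrib_left[symmetric] inner_commute)
    then show ?thesis by simp
  qed
  also have "\<dots> = (\<Sum>b\<in>Basis. real (Suc k) * (LINT \<eta>|sphere_measure. g k (x \<bullet> \<eta>) * ((b \<bullet> \<eta>) * ddir b p \<eta>)))"
    by (subst Bochner_Integration.integral_sum)
      (auto intro!: integrable_sphere_continuous continuous_intros continuous_ridge Suc.prems(2) q(3)
        simp: sum_distrib_left)
  \<comment> \<open>Summed over \<open>b\<close>, the first parts reassemble Euler's identity at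
    \<open>x\<close> and the second parts form the Laplacian of \<open>p\<close>, which is
    zero.\<close>
  also have "\<dots> = C * (s * norm x powr (s - 2) * (real (Suc m) * p x) + norm x powr s * 0)"
    unfolding step
    using eul[of x] lap[of x]
    by (simp add: ddir_direction[OF p, of x] laplacian_eq[OF p] sum.distrib sum_distrib_left[symmetric]
      inner_commute mult.assoc)
  finally have "real (Suc m) * (real (Suc k) * (LINT \<eta>|sphere_measure. g k (x \<bullet> \<eta>) * p \<eta>)) =
      real (Suc m) * (C * s * norm x powr (s - 2) * p x)"
    by (simp add: algebra_simps)
  then have "real (Suc k) * (LINT \<eta>|sphere_measure. g k (x \<bullet> \<eta>) * p \<eta>) = C * s * norm x powr (s - 2) * p x"
    by (metis mult_left_cancel of_nat_0_eq_iff nat.distinct(1))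
  moreover have "s - 2 = real k - real (Suc m)" by (simp add: s_def)
  ultimately show ?case
    by (simp add: C_def s_def field_simps)
qed

end

section \<open>Multipliers of the powers and of the activation\<close>

lemma solid_harmonic_inner: "solid_harmonic 1 (\<lambda>x. x \<bullet> b)"
proof -
  have "real_polynomial_function (\<lambda>x. x \<bullet> b)"
    by (intro real_polynomial_function.intros(1) bounded_linear_inner_left)
  then show ?thesis
    by (auto simp: solid_harmonic_def ddir_inner_left laplacian_eq)
qed

context ridge_family
begin

text \<open>The Funk-Hecke formula in degree 1, for the coordinate functions, is differentiated once
  more in the coordinate's own direction. Summing over the basis collapses the squares to 1 on the
  sphere and leaves the mean of the \<open>l\<close>-th profile.\<close>

lemma coeff_recursion:
  assumes "K \<le> l"
  shows "(real l + real DIM('a)) * c (l + 2) = (real l + 1) * c l"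
proof -
  obtain x :: 'a where x: "norm x = 1"
    by (rule that[OF norm_Basis[OF SOME_Basis]])
  then have x0: "x \<noteq> 0" by auto
  have step: "real (Suc l) * (LINT \<eta>|sphere_measure. g l (x \<bullet> \<eta>) * ((b \<bullet> \<eta>) * (\<eta> \<bullet> b))) =
      c (l + 2) * (real l * (b \<bullet> x)\<^sup>2 + 1)" if b: "b \<in> Basis" for b
  proof (rule DERIV_unique)
    show "((\<lambda>t. LINT \<eta>|sphere_measure. g (Suc l) ((x + t *\<^sub>R b) \<bullet> \<eta>) * (\<eta> \<bullet> b)) has_real_derivative
      real (Suc l) * (LINT \<eta>|sphere_measure. g l (x \<bullet> \<eta>) * ((b \<bullet> \<eta>) * (\<eta> \<bullet> b)))) (at 0)"
      by (rule ridge_integral_deriv[OF assms]) (intro continuous_intros)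
    have "((\<lambda>t. (x + t *\<^sub>R b) \<bullet> b) has_real_derivative 1) (at 0)"
      using b by (auto intro!: derivative_eq_intros simp: inner_add_left)
    then have "((\<lambda>t. c (l + 2) * (norm (x + t *\<^sub>R b) powr real l * ((x + t *\<^sub>R b) \<bullet> b))) has_real_derivative
      c (l + 2) * (real l * (b \<bullet> x)\<^sup>2 + 1)) (at 0)"
      by (rule DERIV_cong[OF DERIV_cmult[OF DERIV_mult[OF has_derivative_norm_powr[OF x0]]]])
        (simp add: x power2_eq_square inner_commute)
    moreover have "\<forall>\<^sub>F t in nhds 0. c (l + 2) * (norm (x + t *\<^sub>R b) powr real l * ((x + t *\<^sub>R b) \<bullet> b)) =
        (LINT \<eta>|sphere_measure. g (Suc l) ((x + t *\<^sub>R b) \<bullet> \<eta>) * (\<eta> \<bullet> b))"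
    proof -
      have "\<forall>\<^sub>F t in nhds 0. x + t *\<^sub>R b \<in> - {0}"
      proof (rule topological_tendstoD)
        show "((\<lambda>t. x + t *\<^sub>R b) \<longlongrightarrow> x) (nhds (0::real))"
          by (rule tendsto_eq_intros refl filterlim_ident | simp)+
      qed (use x0 in auto)
      then show ?thesis
      proof eventually_elim
        case (elim t)
        then show ?case
          using funk_hecke[OF solid_harmonic_inner, of "Suc l" "x + t *\<^sub>R b" b] assms by simp
      qed
    qed
    ultimately show "((\<lambda>t. LINT \<eta>|sphere_measure. g (Suc l) ((x + t *\<^sub>R b) \<bullet> \<eta>) * (\<eta> \<bullet> b)) has_real_derivative
      c (l + 2) * (real l * (b \<bullet> x)\<^sup>2 + 1)) (at 0)"
      by (simp add: DERIV_cong_ev)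
  qed
  have sumB: "(\<Sum>b\<in>Basis. (b \<bullet> y)\<^sup>2) = 1" if "norm y = 1" for y :: 'a
    using that euclidean_inner[of y y] by (simp add: norm_eq_1 power2_eq_square inner_commute)
  have "(real l + 1) * c l = real (Suc l) * (LINT \<eta>|sphere_measure. g l (x \<bullet> \<eta>))"
    using mean[OF assms x0] by (simp add: x)
  also have "(LINT \<eta>|sphere_measure. g l (x \<bullet> \<eta>)) =
      (LINT \<eta>|sphere_measure. (\<Sum>b\<in>Basis. g l (x \<bullet> \<eta>) * ((b \<bullet> \<eta>) * (\<eta> \<bullet> b))))"
    by (rule Bochner_Integration.integral_cong)
      (use sumB in \<open>simp_all add: sum_distrib_left[symmetric] power2_eq_square inner_commute\<close>)
  also have "\<dots> = (\<Sum>b\<in>Basis. LINT \<eta>|sphere_measure. g l (x \<bullet> \<eta>) * ((b \<bullet> \<eta>) * (\<eta> \<bullet> b)))"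
    by (rule Bochner_Integration.integral_sum)
      (auto intro!: integrable_sphere_continuous continuous_intros continuous_ridge assms)
  also have "real (Suc l) * \<dots> = (\<Sum>b\<in>Basis. c (l + 2) * (real l * (b \<bullet> x)\<^sup>2 + 1))"
    by (simp add: sum_distrib_left step del: of_nat_Suc)
  also have "\<dots> = c (l + 2) * (real l + real DIM('a))"
    by (simp add: sum_distrib_left[symmetric] sum.distrib sumB[OF x])
  finally show ?thesis by (simp add: mult.commute)
qed

text \<open>The defining recursion moves along m + k constant; this one moves along m - k constant.
  Combined, they change \<open>m\<close> by two with \<open>k\<close> fixed.\<close>

lemma funk_hecke_coeff_diagonal:
  "K \<le> k \<Longrightarrow> (real k + 1) * funk_hecke_coeff c m k =
    (real k + real m + real DIM('a)) * funk_hecke_coeff c (Suc m) (Suc k)"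
proof (induction m arbitrary: k)
  case 0
  then show ?case using coeff_recursion[of k] by simp
next
  case (Suc m)
  have "(real k + real (Suc m) + real DIM('a)) * funk_hecke_coeff c (Suc (Suc m)) (Suc k) =
      ((real (Suc k) + real m + real DIM('a)) * funk_hecke_coeff c (Suc m) (Suc (Suc k))) *
      ((real (Suc k) + 1 - real (Suc m)) / (real (Suc k) + 1))"
    by simp
  also have "\<dots> = (real (Suc k) + 1) * funk_hecke_coeff c m (Suc k) *
      ((real (Suc k) + 1 - real (Suc m)) / (real (Suc k) + 1))"
    using Suc.IH[of "Suc k"] Suc.prems by (simp only: le_SucI)
  also have "\<dots> = (real k + 1) * funk_hecke_coeff c (Suc m) k"
    by (simp add: field_simps)
  finally show ?case by simp
qed

text \<open>The source of all estimates of the multipliers: its factor is zero exactly at m = k,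
  negative beyond, and bounded by 1 in absolute value.\<close>

lemma funk_hecke_coeff_step:
  assumes "K \<le> k"
  shows "funk_hecke_coeff c (m + 2) k =
    funk_hecke_coeff c m k * ((real k - real m) / (real k + real m + real DIM('a)))"
proof -
  have "real k + real m + real DIM('a) \<noteq> 0" "real k + 1 \<noteq> 0"
    by (simp_all add: add_nonneg_eq_0_iff)
  moreover have "funk_hecke_coeff c (m + 2) k =
      funk_hecke_coeff c (Suc m) (Suc k) * ((real k - real m) / (real k + 1))"
    by simp
  moreover have "funk_hecke_coeff c (Suc m) (Suc k) =
      (real k + 1) * funk_hecke_coeff c m k / (real k + real m + real DIM('a))"
    using funk_hecke_coeff_diagonal[OF assms, of m] calculation(1) by (simp add: field_simps)
  ultimately show ?thesis by simp
qed

end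

text \<open>At the kink the difference quotient of \<open>relu_pow (Suc k)\<close> is
  \<open>relu_pow k\<close> itself, which tends to 0 for \<open>k \<ge> 1\<close>.\<close>

lemma has_derivative_relu_pow:
  assumes "k \<ge> 1"
  shows "(relu_pow (Suc k) has_real_derivative real (Suc k) * relu_pow k t) (at t)"
proof -
  consider "t > 0" | "t < 0" | "t = 0" by linarith
  then show ?thesis
  proof cases
    case 1
    have "((\<lambda>t. t ^ Suc k) has_real_derivative real (Suc k) * relu_pow k t) (at t)"
      using 1 DERIV_pow[of "Suc k" t] by (simp add: relu_pow_def)
    moreover have "\<forall>\<^sub>F s in nhds t. s ^ Suc k = relu_pow (Suc k) s"
      using eventually_nhds_in_open[of "{0<..}" t] 1
      by (auto elim!: eventually_mono simp: relu_pow_def)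
    ultimately show ?thesis by (rule DERIV_cong_ev[OF refl _ refl, THEN iffD1, rotated])
  next
    case 2
    have "((\<lambda>t. 0) has_real_derivative real (Suc k) * relu_pow k t) (at t)"
      using 2 assms by (simp add: relu_pow_def max_def power_0_left)
    moreover have "\<forall>\<^sub>F s in nhds t. 0 = relu_pow (Suc k) s"
      using eventually_nhds_in_open[of "{..<0}" t] 2
      by (auto elim!: eventually_mono simp: relu_pow_def)
    ultimately show ?thesis by (rule DERIV_cong_ev[OF refl _ refl, THEN iffD1, rotated])
  next
    case 3
    have "isCont (relu_pow k) 0"
      using continuous_relu_pow[of UNIV k] by (simp add: continuous_on_eq_continuous_at)
    moreover have zero: "relu_pow k 0 = 0"
      using assms by (simp add: relu_pow_def power_0_left)
    ultimately have "relu_pow k \<midarrow>0\<rightarrow> 0"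
      by (simp add: isCont_def)
    moreover have "(relu_pow (Suc k) (0 + h) - relu_pow (Suc k) 0) / h = relu_pow k h" if "h \<noteq> 0" for h
      using that assms by (auto simp: relu_pow_def max_def power_0_left)
    ultimately have "(\<lambda>h. (relu_pow (Suc k) (0 + h) - relu_pow (Suc k) 0) / h) \<midarrow>0\<rightarrow> 0"
      using LIM_cong[of 0 0 "\<lambda>h. (relu_pow (Suc k) (0 + h) - relu_pow (Suc k) 0) / h" "relu_pow k" 0 0]
      by blast
    then show ?thesis
      using 3 zero by (simp add: DERIV_def)
  qed
qed

definition power_coeff :: "'a::euclidean_space itself \<Rightarrow> nat \<Rightarrow> real" where
  "power_coeff T k = (if even k then sphere_moment T k else 0)"

lemma ridge_family_relu:
  "ridge_family TYPE('a) relu_pow (\<lambda>k. sphere_moment TYPE('a::euclidean_space) k / 2) 1"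
  by (unfold_locales; rule has_derivative_relu_pow continuous_relu_pow integral_sphere_relu_pow; assumption)

lemma ridge_family_power:
  "ridge_family TYPE('a) (\<lambda>k t. t ^ k) (power_coeff TYPE('a::euclidean_space)) 0"
proof
  show "((\<lambda>t. t ^ Suc k) has_real_derivative real (Suc k) * t ^ k) (at t)" for k and t :: real
    using DERIV_pow[of "Suc k" t] by simp
qed (auto simp: integral_sphere_power power_coeff_def intro!: continuous_intros)

text \<open>The activations cover both parities but start at index 1; the powers supply l =
  0.\<close>

lemma sphere_moment_recursion:
  "(real l + real DIM('a)) * sphere_moment TYPE('a::euclidean_space) (l + 2) =
    (real l + 1) * sphere_moment TYPE('a) l"
proof (cases "l = 0")
  case True
  then show ?thesis
    using ridge_family.coeff_recursion[OF ridge_family_power, of 0, where 'a='a]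
    by (simp add: power_coeff_def numeral_2_eq_2)
next
  case False
  then show ?thesis
    using ridge_family.coeff_recursion[OF ridge_family_relu, of l, where 'a='a] by simp
qed

lemma sphere_moment_0: "sphere_moment TYPE('a::euclidean_space) 0 = 1"
  by (simp add: sphere_moment_def)

lemma sphere_moment_decreasing:
  "sphere_moment TYPE('a::euclidean_space) (Suc l) \<le> sphere_moment TYPE('a) l"
  unfolding sphere_moment_def
proof (rule integral_mono)
  fix \<eta> :: 'a assume "\<eta> \<in> space sphere_measure"
  then have "\<bar>(SOME b::'a. b \<in> Basis) \<bullet> \<eta>\<bar> \<le> 1"
    using Cauchy_Schwarz_ineq2[of "SOME b::'a. b \<in> Basis" \<eta>] norm_Basis[OF SOME_Basis, where 'a='a] by simp
  then show "\<bar>(SOME b::'a. b \<in> Basis) \<bullet> \<eta>\<bar> ^ Suc l \<le> \<bar>(SOME b::'a. b \<in> Basis) \<bullet> \<eta>\<bar> ^ l"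
    by (intro power_decreasing) auto
qed (auto intro!: integrable_sphere_continuous continuous_intros)

text \<open>The recursion runs within one parity class. The odd class is started by monotonicity,
  from the second moment.\<close>

lemma sphere_moment_pos: "sphere_moment TYPE('a::euclidean_space) l > 0"
proof (induction l rule: induct_nat_012)
  case 1
  have "real DIM('a) * sphere_moment TYPE('a) 2 = 1"
    using sphere_moment_recursion[of 0, where 'a='a] by (simp add: sphere_moment_0 numeral_2_eq_2)
  then have "0 < sphere_moment TYPE('a) 2"
    using zero_less_mult_pos[of "real DIM('a)" "sphere_moment TYPE('a) 2"] by simp
  then show ?case
    using sphere_moment_decreasing[of 1, where 'a='a] by (simp add: numeral_2_eq_2)
next
  case (ge2 n)
  have "0 < (real n + 1) * sphere_moment TYPE('a) n"
    using ge2 by (intro mult_pos_pos) auto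
  then have "0 < (real n + real DIM('a)) * sphere_moment TYPE('a) (n + 2)"
    by (simp only: sphere_moment_recursion)
  then have "0 < sphere_moment TYPE('a) (n + 2)"
    by (rule zero_less_mult_pos) (simp add: add_nonneg_pos)
  then show ?case by simp
qed (simp add: sphere_moment_0)

text \<open>For this parity the chain m, m + 2, ... never meets m = k, the zero of the two-step
  factor.\<close>

lemma relu_coeff_nonzero:
  assumes "k \<ge> 1" "odd (k + m)"
  shows "funk_hecke_coeff (\<lambda>k. sphere_moment TYPE('a::euclidean_space) k / 2) m k \<noteq> 0"
  using assms(2)
proof (induction m rule: induct_nat_012)
  case 0
  then show ?case using sphere_moment_pos[of k, where 'a='a] by simp
next
  case 1
  then show ?case using sphere_moment_pos[of "Suc k", where 'a='a] by simp
next
  case (ge2 m)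
  then show ?case
    using ridge_family.funk_hecke_coeff_step[OF ridge_family_relu, of k m, where 'a='a] assms
    by (auto simp: add_nonneg_eq_0_iff)
qed

lemma power_coeff_odd:
  "odd (l + m) \<Longrightarrow> funk_hecke_coeff (power_coeff TYPE('a::euclidean_space)) m l = 0"
  by (induction m arbitrary: l) (auto simp: power_coeff_def)

text \<open>For even l + m the two-step chain is killed when it passes m = l; for odd l + m the
  multiplier is zero by symmetry.\<close>

lemma power_coeff_large:
  assumes "l < m"
  shows "funk_hecke_coeff (power_coeff TYPE('a::euclidean_space)) m l = 0"
proof (cases "even (l + m)")
  case True
  have "funk_hecke_coeff (power_coeff TYPE('a)) (l + 2 + 2 * j) l = 0" for j
  proof (induction j)
    case 0
    show ?case
      using ridge_family.funk_hecke_coeff_step[OF ridge_family_power, of l l, where 'a='a] by simp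
  next
    case (Suc j)
    then show ?case
      using ridge_family.funk_hecke_coeff_step[OF ridge_family_power, of l "l + 2 + 2 * j", where 'a='a] 
      by simp
  qed
  moreover obtain j where "m = l + 2 + 2 * j"
  proof -
    have "even (m - l)" "m - l \<ge> 2" using True assms by (simp, presburger)
    then have "m = l + 2 + 2 * ((m - l - 2) div 2)" using assms by auto
    then show ?thesis using that by blast
  qed
  ultimately show ?thesis by simp
qed (simp add: power_coeff_odd)

text \<open>The two-step factor is at most (l - m)/(l + m) \<le> 1 - m/l \<le> exp (-m/l), and the
  exponents m/l collected along the chain add up to m (m - 2)/(4l).\<close>

lemma power_coeff_bounds:
  assumes "l \<ge> 1" "m \<le> l" "even (l + m)"
  shows "0 < funk_hecke_coeff (power_coeff TYPE('a::euclidean_space)) m l"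
    and "funk_hecke_coeff (power_coeff TYPE('a)) m l \<le>
      sphere_moment TYPE('a) l * exp (- (real m * (real m - 2) / (4 * real l)))"
proof -
  let ?n = "\<lambda>m. funk_hecke_coeff (power_coeff TYPE('a)) m l"
  have "0 < ?n m \<and> ?n m \<le> sphere_moment TYPE('a) l * exp (- (real m * (real m - 2) / (4 * real l)))"
    using assms(2,3)
  proof (induction m rule: induct_nat_012)
    case 0
    then show ?case using sphere_moment_pos[of l, where 'a='a] by (simp add: power_coeff_def)
  next
    \<comment> \<open>At m = 1 the exponent is the positive number 1/(4l), so monotonicity of the
      moments is enough.\<close>
    case 1
    have "sphere_moment TYPE('a) (Suc l) * 1 \<le> sphere_moment TYPE('a) l * exp (1 / (4 * real l))"
      using sphere_moment_pos[of l, where 'a='a]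
      by (intro mult_mono sphere_moment_decreasing) auto
    then show ?case using 1 sphere_moment_pos[of "Suc l", where 'a='a] by (simp add: power_coeff_def)
  next
    case (ge2 m)
    define r where "r = (real l - real m) / (real l + real m + real DIM('a))"
    have IH: "0 < ?n m" "?n m \<le> sphere_moment TYPE('a) l * exp (- (real m * (real m - 2) / (4 * real l)))"
      using ge2 by auto
    have lm: "real m + 2 \<le> real l" using ge2.prems by linarith
    have r0: "0 < r" using lm by (simp add: r_def add_nonneg_pos)
    have "r \<le> (real l - real m) / (real l + real m)"
      unfolding r_def using lm by (intro divide_left_mono) (auto intro!: mult_pos_pos add_nonneg_pos)
    also have "\<dots> \<le> 1 - real m / real l"
      using lm mult_left_mono[of "real m" "real l" "real m"]
      by (simp add: field_simps)
    also have "\<dots> \<le> exp (- (real m / real l))"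
      using exp_ge_add_one_self[of "- (real m / real l)"] by simp
    finally have r: "r \<le> exp (- (real m / real l))" .
    have eq: "?n (Suc (Suc m)) = ?n m * r"
      using ridge_family.funk_hecke_coeff_step[OF ridge_family_power, of l m, where 'a='a]
      by (simp add: r_def)
    have "?n m * r \<le> sphere_moment TYPE('a) l * exp (- (real m * (real m - 2) / (4 * real l))) *
        exp (- (real m / real l))"
      using IH r r0 by (intro mult_mono) auto
    also have "\<dots> = sphere_moment TYPE('a) l *
        exp (- (real m * (real m - 2) / (4 * real l)) + - (real m / real l))"
      by (simp only: exp_add mult.assoc)
    also have "- (real m * (real m - 2) / (4 * real l)) + - (real m / real l) =
        - (real (Suc (Suc m)) * (real (Suc (Suc m)) - 2) / (4 * real l))"
      using lm by (simp add: field_simps)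
    finally show ?case unfolding eq using IH(1) r0 by simp
  qed
  then show "0 < ?n m"
    "?n m \<le> sphere_moment TYPE('a) l * exp (- (real m * (real m - 2) / (4 * real l)))"
    by auto
qed

section \<open>Decay rates from two-step recursions\<close>

lemma powr_step_lower:
  fixes x s :: real
  assumes "x > 2" "s \<ge> 0"
  shows "((x - 2) / x) powr s \<le> x / (x + 2 * s)"
proof -
  have "((x - 2) / x) powr s = exp (s * ln ((x - 2) / x))"
    using assms by (simp add: powr_def)
  also have "\<dots> \<le> exp (s * (- (2 / x)))"
  proof -
    have "ln ((x - 2) / x) \<le> (x - 2) / x - 1"
      using assms by (intro ln_le_minus_one) auto
    also have "\<dots> = - (2 / x)" using assms by (simp add: field_simps)
    finally have "s * ln ((x - 2) / x) \<le> s * (- (2 / x))" using assms by (intro mult_left_mono)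
    then show ?thesis by simp
  qed
  also have "\<dots> = inverse (exp (2 * s / x))"
    by (simp add: exp_minus[symmetric] mult.commute)
  also have "\<dots> \<le> inverse (1 + 2 * s / x)"
    using assms by (intro le_imp_inverse_le exp_ge_add_one_self) (auto intro: add_pos_nonneg)
  also have "\<dots> = x / (x + 2 * s)"
    using assms by (simp add: field_simps)
  finally show ?thesis .
qed

text \<open>The moments pick up a factor of the form x/(x + 2s) per two-step, and so do the absolute
  values of the activation multipliers. \<open>powr_step_lower\<close> and the present bound trap
  this factor between quotients of s-th powers of shifted arguments, so that multiplication with a
  shifted power gives a monotone sequence and the rate x^(-s) follows without asymptotics of the
  Gamma function.\<close>

lemma powr_step_upper:
  fixes x s :: real
  assumes "x > 0" "s \<ge> 0"
  shows "x / (x + 2 * s) \<le> ((x + 2 * s) / (x + 2 * s + 2)) powr s"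
proof -
  define y where "y = x + 2 * s"
  have y: "y > 0" using assms by (simp add: y_def)
  have "x / y = 1 + - (2 * s / y)" using y by (simp add: y_def field_simps)
  also have "\<dots> \<le> exp (- (2 * s / y))" by (rule exp_ge_add_one_self)
  also have "\<dots> \<le> exp (- s * ln ((y + 2) / y))"
  proof -
    have "ln ((y + 2) / y) \<le> (y + 2) / y - 1"
      using y by (intro ln_le_minus_one) auto
    also have "\<dots> = 2 / y" using y by (simp add: field_simps)
    finally have "s * ln ((y + 2) / y) \<le> s * (2 / y)" using assms by (intro mult_left_mono)
    then show ?thesis by (simp add: mult.commute)
  qed
  also have "\<dots> = (y / (y + 2)) powr s"
  proof -
    have "ln (y / (y + 2)) = - ln ((y + 2) / y)" using y by (simp add: ln_div)
    then show ?thesis using y by (simp add: powr_def)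
  qed
  finally show ?thesis by (simp add: y_def)
qed

lemma sphere_moment_step:
  "sphere_moment TYPE('a::euclidean_space) (l + 2) =
    sphere_moment TYPE('a) l * ((real l + 1) / (real l + 1 + (real DIM('a) - 1)))"
proof -
  have "real l + real DIM('a) \<noteq> 0" by (simp add: add_nonneg_eq_0_iff)
  then show ?thesis
    using sphere_moment_recursion[of l, where 'a='a] by (simp add: field_simps)
qed

lemma sphere_moment_upper:
  "\<exists>C>0. \<forall>l\<ge>1. sphere_moment TYPE('a::euclidean_space) l \<le> C * real l powr (- ((real DIM('a) - 1) / 2))"
proof -
  define s where "s = (real DIM('a) - 1) / 2"
  have s: "s \<ge> 0" using DIM_positive[where 'a='a] by (simp add: s_def Suc_leI)
  have "real DIM('a) - 1 = 2 * s" by (simp add: s_def)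
  note step = sphere_moment_step[where 'a='a, unfolded this]
  \<comment> \<open>The shift 1 + 2s is the one for which \<open>powr_step_upper\<close> makes
    \<open>U\<close> nonincreasing in steps of two.\<close>
  define U where "U l = sphere_moment TYPE('a) l * (real l + 1 + 2 * s) powr s" for l
  have U: "U (l + 2) \<le> U l" for l
  proof -
    have "sphere_moment TYPE('a) (l + 2) \<le>
        sphere_moment TYPE('a) l * ((real l + 1 + 2 * s) / (real l + 1 + 2 * s + 2)) powr s"
      unfolding step[of l]
      using powr_step_upper[of "real l + 1" s] s sphere_moment_pos[of l, where 'a='a]
      by (intro mult_left_mono) auto
    also have "\<dots> = sphere_moment TYPE('a) l *
        ((real l + 1 + 2 * s) powr s / (real l + 1 + 2 * s + 2) powr s)"
      using s by (subst powr_divide) auto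
    finally show ?thesis
      using s by (simp add: U_def field_simps)
  qed
  define C where "C = max (U 0) (U 1)"
  have UC: "U l \<le> C" for l
    by (induction l rule: induct_nat_012)
      (use U in \<open>auto simp: C_def le_max_iff_disj intro: order_trans\<close>)
  have "C > 0"
    using sphere_moment_pos[of 0, where 'a='a] s
    by (auto simp: C_def U_def less_max_iff_disj)
  have "sphere_moment TYPE('a) l \<le> C * real l powr (- s)" if "l \<ge> 1" for l
  proof -
    have "sphere_moment TYPE('a) l * real l powr s \<le> U l"
      unfolding U_def using that s sphere_moment_pos[of l, where 'a='a]
      by (intro mult_left_mono powr_mono2) auto
    also note UC
    finally show ?thesis using that by (simp add: powr_minus field_simps)
  qed
  with \<open>C > 0\<close> show ?thesis by (auto simp: s_def)
qed

lemma sphere_moment_lower: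
  "\<exists>C>0. \<forall>l\<ge>1. C * real l powr (- ((real DIM('a) - 1) / 2)) \<le> sphere_moment TYPE('a::euclidean_space) l"
proof -
  define s where "s = (real DIM('a) - 1) / 2"
  have s: "s \<ge> 0" using DIM_positive[where 'a='a] by (simp add: s_def Suc_leI)
  have "real DIM('a) - 1 = 2 * s" by (simp add: s_def)
  note step = sphere_moment_step[where 'a='a, unfolded this]
  \<comment> \<open>Shifted so that \<open>powr_step_lower\<close>, taken at x = l + 1, makes
    \<open>L\<close> nondecreasing in steps of two.\<close>
  define L where "L l = sphere_moment TYPE('a) l * (real l - 1) powr s" for l
  have L: "L l \<le> L (l + 2)" if "l \<ge> 2" for l
  proof -
    have "sphere_moment TYPE('a) l * ((real l + 1 - 2) / (real l + 1)) powr s \<le> sphere_moment TYPE('a) (l + 2)"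
      unfolding step[of l]
      using powr_step_lower[of "real l + 1" s] s sphere_moment_pos[of l, where 'a='a] that
      by (intro mult_left_mono) auto
    moreover have "((real l + 1 - 2) / (real l + 1)) powr s = (real l - 1) powr s / (real l + 1) powr s"
      using that by (subst powr_divide) auto
    ultimately have "sphere_moment TYPE('a) l * (real l - 1) powr s / (real l + 1) powr s
        \<le> sphere_moment TYPE('a) (l + 2)" by simp
    then have "sphere_moment TYPE('a) l * (real l - 1) powr s
        \<le> sphere_moment TYPE('a) (l + 2) * (real l + 1) powr s"
      by (subst (asm) pos_divide_le_eq) auto
    then show ?thesis
      by (simp add: L_def add.commute)
  qed
  \<comment> \<open>\<open>L 2\<close> and \<open>L 3\<close> start the two parity classes; l = 1
    stands apart because its shifted base is 0.\<close>
  define C where "C = min (sphere_moment TYPE('a) 1) (min (L 2) (L 3))"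
  have "C > 0"
    using sphere_moment_pos[where 'a='a] by (auto simp: C_def L_def)
  have LC: "C \<le> L (l + 2)" for l
  proof (induction l rule: induct_nat_012)
    case (ge2 n)
    then show ?case using L[of "n + 2"] by (simp add: numeral_2_eq_2)
  qed (auto simp: C_def numeral_2_eq_2 numeral_3_eq_3)
  have "C * real l powr (- s) \<le> sphere_moment TYPE('a) l" if "l \<ge> 1" for l
  proof (cases "l = 1")
    case True
    then show ?thesis by (simp add: C_def)
  next
    case False
    then have "l = (l - 2) + 2" using that by linarith
    then obtain j where j: "l = j + 2" by blast
    have "C \<le> L l" using LC[of j] j by simp
    also have "L l \<le> sphere_moment TYPE('a) l * real l powr s"
      unfolding L_def using j s sphere_moment_pos[of l, where 'a='a]
      by (intro mult_left_mono powr_mono2) auto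
    finally show ?thesis using that by (simp add: powr_minus field_simps)
  qed
  with \<open>C > 0\<close> show ?thesis by (auto simp: s_def)
qed

text \<open>In terms of x = m - k the absolute value of the two-step factor is x/(x + 2s) with 2s =
  2k + D, D the dimension, so the comparison used for the moments applies again.\<close>

lemma relu_coeff_lower:
  assumes k: "k \<ge> 1"
  shows "\<exists>C>0. \<forall>m. odd (k + m) \<longrightarrow> C * real (max 1 m) powr (- (real (2 * k + DIM('a)) / 2)) \<le>
    \<bar>funk_hecke_coeff (\<lambda>k. sphere_moment TYPE('a::euclidean_space) k / 2) m k\<bar>"
proof -
  define s where "s = real (2 * k + DIM('a)) / 2"
  define v where "v m = \<bar>funk_hecke_coeff (\<lambda>k. sphere_moment TYPE('a) k / 2) m k\<bar>" for m
  have s: "s \<ge> 0" by (simp add: s_def)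
  \<comment> \<open>The first degree of the right parity with x > 2 is k + 3.\<close>
  define L where "L i = v (k + 3 + 2 * i) * (real (k + 3 + 2 * i) - k - 2) powr s" for i
  have "L i \<le> L (Suc i)" for i
  proof -
    define m where "m = k + 3 + 2 * i"
    define x where "x = real m - real k"
    have x: "x > 2" by (simp add: x_def m_def)
    have "\<bar>(real k - real m) / (real k + real m + real DIM('a))\<bar> = x / (x + 2 * s)"
      using x by (simp add: x_def s_def abs_divide abs_of_nonneg)
    then have "v (m + 2) = v m * (x / (x + 2 * s))"
      unfolding v_def ridge_family.funk_hecke_coeff_step[OF ridge_family_relu k] abs_mult by simp
    moreover have "v m * ((x - 2) / x) powr s \<le> v m * (x / (x + 2 * s))"
      using powr_step_lower[OF x s] by (intro mult_left_mono) (auto simp: v_def)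
    moreover have "((x - 2) / x) powr s = (x - 2) powr s / x powr s"
      using x by (subst powr_divide) auto
    ultimately have "v m * (x - 2) powr s \<le> v (m + 2) * x powr s"
      using x by (simp add: field_simps)
    then show ?thesis by (simp add: L_def m_def x_def)
  qed
  then have L: "L 0 \<le> L i" for i by (rule lift_Suc_mono_le) simp
  have v_pos: "v m > 0" if "odd (k + m)" for m
    using relu_coeff_nonzero[OF k that, where 'a='a] by (simp add: v_def)
  have L0: "L 0 > 0" using v_pos[of "k + 3"] by (simp add: L_def)
  \<comment> \<open>The finitely many degrees up to k + 1 are covered by their minimum, which is
    positive because none of these multipliers vanishes.\<close>
  define C where "C = min (L 0) (Min (v ` {m. m \<le> k + 1 \<and> odd (k + m)}))"
  have fin: "finite {m. m \<le> k + 1 \<and> odd (k + m)}" by simp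
  have ne: "{m. m \<le> k + 1 \<and> odd (k + m)} \<noteq> {}" by (auto intro!: exI[of _ "k + 1"])
  have "C > 0"
    unfolding C_def using L0 fin ne v_pos by (subst min_less_iff_conj, subst Min_gr_iff) auto
  moreover have "C * real (max 1 m) powr (- s) \<le> v m" if m: "odd (k + m)" for m
  proof (cases "m \<le> k + 1")
    case True
    have "real (max 1 m) powr (- s) \<le> 1 powr (- s)"
      using s by (intro powr_mono2') auto
    then have "C * real (max 1 m) powr (- s) \<le> C * 1"
      using \<open>C > 0\<close> by (intro mult_left_mono) auto
    also have "C * 1 \<le> v m"
      unfolding C_def using True m fin by (auto intro!: min.coboundedI2 Min_le)
    finally show ?thesis .
  next
    case False
    then have "m \<ge> k + 3" using m by (cases "m = k + 2") auto
    then obtain i where i: "m = k + 3 + 2 * i"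
    proof -
      have "even (m - (k + 3))" using m \<open>m \<ge> k + 3\<close> by auto
      then obtain i where "m - (k + 3) = 2 * i" by (rule evenE)
      then show ?thesis using \<open>m \<ge> k + 3\<close> by (intro that[of i]) linarith
    qed
    have "C \<le> L i" using L[of i] by (simp add: C_def min.coboundedI1)
    also have "L i \<le> v m * real m powr s"
      unfolding L_def i[symmetric] using \<open>m \<ge> k + 3\<close> s
      by (intro mult_left_mono powr_mono2) (auto simp: v_def)
    finally show ?thesis
      using \<open>m \<ge> k + 3\<close> by (simp add: powr_minus field_simps max_def)
  qed
  ultimately show ?thesis unfolding s_def v_def by blast
qed

lemma power_le_fact_exp:
  fixes x :: real
  assumes "x \<ge> 0"
  shows "x ^ q \<le> fact q * exp x"
proof -
  have "(\<Sum>n\<in>{q}. inverse (fact n) * x ^ n) \<le> (\<Sum>n. inverse (fact n) * x ^ n)"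
    using assms by (intro sum_le_suminf summable_exp) auto
  then have "x ^ q / fact q \<le> exp x" by (simp add: exp_def field_simps)
  then show ?thesis by (simp add: divide_le_eq mult.commute)
qed

lemma exp_minus_sq_mult_power_le:
  fixes z :: real
  assumes "z \<ge> 0"
  shows "exp (- z\<^sup>2) * z ^ q \<le> fact q"
proof (cases "z \<le> 1")
  case True
  have "exp (- z\<^sup>2) * z ^ q \<le> 1 * 1"
    using assms True by (intro mult_mono power_le_one) auto
  also have "\<dots> \<le> (fact q :: real)" by simp
  finally show ?thesis by simp
next
  case False
  have "z ^ q \<le> fact q * exp z" by (rule power_le_fact_exp[OF assms])
  also have "\<dots> \<le> fact q * exp (z\<^sup>2)"
    using False by (simp add: power2_eq_square)
  finally have "z ^ q \<le> fact q * exp (z\<^sup>2)" .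
  then show ?thesis by (simp add: exp_minus field_simps)
qed

text \<open>Up to constants, the second bound controls \<nu>_m / \<mu>_m^2, since the exponent
  \<open>2 * k + DIM('a)\<close> is twice the decay rate in \<open>relu_coeff_lower\<close>. The
  first bound serves once the weight m^(2r) has absorbed \<mu>_m^(-2).\<close>

lemma power_coeff_asymp:
  fixes k :: nat
  defines "d \<equiv> DIM('a::euclidean_space) - 1"
  shows "\<exists>C>0. \<forall>l\<ge>1. \<forall>m\<le>l. even (l + m) \<longrightarrow>
    funk_hecke_coeff (power_coeff TYPE('a)) m l \<le> C * real l powr (- (real d / 2)) \<and>
    funk_hecke_coeff (power_coeff TYPE('a)) m l * real (max 1 m) ^ (2 * k + DIM('a)) \<le>
      C * real l powr (real k + 1 / 2)"
proof -
  have D: "real DIM('a) = real d + 1" using DIM_positive[where 'a='a] by (simp add: d_def of_nat_diff)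
  define q where "q = 2 * k + DIM('a)"
  obtain C0 where C0: "C0 > 0" "\<And>l. l \<ge> 1 \<Longrightarrow> sphere_moment TYPE('a) l \<le> C0 * real l powr (- (real d / 2))"
    using sphere_moment_upper[where 'a='a] D by auto
  define C where "C = 2 * C0 * 2 ^ q * fact q"
  have C1: "2 * C0 \<le> C"
  proof -
    have "2 * C0 * (1 * 1) \<le> 2 * C0 * (2 ^ q * fact q)"
      using C0 by (intro mult_left_mono mult_mono) auto
    then show ?thesis by (simp add: C_def mult_ac)
  qed
  have "C > 0" using C0 C1 by linarith
  moreover have "funk_hecke_coeff (power_coeff TYPE('a)) m l \<le> C * real l powr (- (real d / 2)) \<and>
    funk_hecke_coeff (power_coeff TYPE('a)) m l * real (max 1 m) ^ q \<le> C * real l powr (real k + 1 / 2)"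
    if l: "l \<ge> 1" "m \<le> l" "even (l + m)" for l m
  proof -
    define n where "n = funk_hecke_coeff (power_coeff TYPE('a)) m l"
    define A where "A = C0 * real l powr (- (real d / 2))"
    have A: "A > 0" using C0 l by (simp add: A_def)
    have n0: "n > 0" using power_coeff_bounds(1)[OF l, where 'a='a] by (simp add: n_def)
    \<comment> \<open>The natural variable m / sqrt l: exp (-m^2/(4l)) becomes exp (-z^2), and m^q
      splits off l^(q/2).\<close>
    define z where "z = real m / (2 * sqrt (real l))"
    have z: "z \<ge> 0" by (simp add: z_def)
    have "n \<le> sphere_moment TYPE('a) l * exp (- (real m * (real m - 2) / (4 * real l)))"
      using power_coeff_bounds(2)[OF l, where 'a='a] by (simp add: n_def)
    also have "\<dots> \<le> A * (2 * exp (- z\<^sup>2))"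
    proof (rule mult_mono)
      \<comment> \<open>Replacing m - 2 by m costs the factor exp (m/(2l)), at most 2 because m
        \<le> l.\<close>
      have "- (real m * (real m - 2) / (4 * real l)) = - z\<^sup>2 + real m / (2 * real l)"
        using l by (simp add: z_def power_divide power_mult_distrib field_simps power2_eq_square)
      then have "exp (- (real m * (real m - 2) / (4 * real l))) = exp (- z\<^sup>2) * exp (real m / (2 * real l))"
        by (simp only: exp_add)
      also have "\<dots> \<le> exp (- z\<^sup>2) * 2"
      proof (intro mult_left_mono)
        have "exp (real m / (2 * real l)) \<le> exp (1 / 2)" using l by (simp add: field_simps)
        also have "\<dots> \<le> 2" using exp_bound_half[of "1/2::real"] by simp
        finally show "exp (real m / (2 * real l)) \<le> 2" .
      qed simp
      finally show "exp (- (real m * (real m - 2) / (4 * real l))) \<le> 2 * exp (- z\<^sup>2)" by simp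
    qed (use C0 l A in \<open>auto simp: A_def\<close>)
    finally have n: "n \<le> A * (2 * exp (- z\<^sup>2))" .
    have nA: "n \<le> 2 * A"
    proof -
      have "A * (2 * exp (- z\<^sup>2)) \<le> A * (2 * 1)" using A by (intro mult_left_mono) auto
      with n show ?thesis by simp
    qed
    have "2 * A \<le> C * real l powr (- (real d / 2))"
      using mult_right_mono[OF C1, of "real l powr (- (real d / 2))"] by (simp add: A_def mult_ac)
    with nA have first: "n \<le> C * real l powr (- (real d / 2))" by linarith
    have sq: "real l powr (- (real d / 2)) * sqrt (real l) ^ q = real l powr (real k + 1 / 2)"
    proof -
      have "sqrt (real l) ^ q = (real l powr (1 / 2)) powr real q"
        using l by (simp add: powr_half_sqrt powr_realpow)
      also have "\<dots> = real l powr (real q / 2)" by (simp add: powr_powr)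
      finally have "real l powr (- (real d / 2)) * sqrt (real l) ^ q = real l powr (- (real d / 2) + real q / 2)"
        by (simp only: powr_add)
      also have "- (real d / 2) + real q / 2 = real k + 1 / 2"
        by (simp add: q_def D field_simps)
      finally show ?thesis .
    qed
    have ge1: "sqrt (real l) ^ q \<ge> 1" using l by (intro one_le_power) auto
    have second: "n * real (max 1 m) ^ q \<le> C * real l powr (real k + 1 / 2)"
    proof (cases "m = 0")
      case True
      have "n * real (max 1 m) ^ q \<le> C * real l powr (- (real d / 2)) * 1"
        using True first by simp
      also have "\<dots> \<le> C * real l powr (- (real d / 2)) * sqrt (real l) ^ q"
        using ge1 \<open>C > 0\<close> by (intro mult_left_mono) auto
      finally show ?thesis by (simp add: mult.assoc sq)
    next
      case False
      have m: "real m = 2 * sqrt (real l) * z" using l by (simp add: z_def)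
      have "n * real (max 1 m) ^ q = n * (2 ^ q * sqrt (real l) ^ q * z ^ q)"
        using False by (simp add: max_def m power_mult_distrib)
      also have "\<dots> \<le> (A * (2 * exp (- z\<^sup>2))) * (2 ^ q * sqrt (real l) ^ q * z ^ q)"
        using n z by (intro mult_right_mono) auto
      also have "\<dots> = 2 * 2 ^ q * (A * sqrt (real l) ^ q) * (exp (- z\<^sup>2) * z ^ q)"
        by (simp add: mult_ac)
      also have "\<dots> \<le> 2 * 2 ^ q * (A * sqrt (real l) ^ q) * fact q"
        using A by (intro mult_left_mono exp_minus_sq_mult_power_le z) auto
      also have "A * sqrt (real l) ^ q = C0 * real l powr (real k + 1 / 2)"
        by (simp add: A_def mult.assoc sq)
      finally show ?thesis by (simp add: C_def mult_ac)
    qed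
    from first second show ?thesis by (simp add: n_def)
  qed
  ultimately show ?thesis unfolding q_def by blast
qed

section \<open>Zonal harmonics and the projection onto spherical harmonics\<close>

lemma real_polynomial_function_inner_self: "real_polynomial_function (\<lambda>x::'a::euclidean_space. x \<bullet> x)"
proof -
  have "(\<lambda>x::'a. x \<bullet> x) = (\<lambda>x. \<Sum>b\<in>Basis. (x \<bullet> b) * (x \<bullet> b))"
    by (rule ext) (rule euclidean_inner)
  then show ?thesis
    by (simp only:) (intro real_polynomial_function_sum real_polynomial_function.intros(4)
      real_polynomial_function.intros(1)[OF bounded_linear_inner_left] finite_Basis)
qed

lemma ddir_inner_self: "ddir v (\<lambda>x. x \<bullet> x) = (\<lambda>x. 2 * (x \<bullet> v))"
proof (rule ext, rule ddir_eqI)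
  fix x :: 'a
  have "(\<lambda>t. (x + t *\<^sub>R v) \<bullet> (x + t *\<^sub>R v)) = (\<lambda>t. x \<bullet> x + 2 * t * (x \<bullet> v) + t\<^sup>2 * (v \<bullet> v))"
    by (auto simp: inner_add inner_commute power2_eq_square algebra_simps)
  then show "((\<lambda>t. (x + t *\<^sub>R v) \<bullet> (x + t *\<^sub>R v)) has_real_derivative 2 * (x \<bullet> v)) (at 0)"
    by (auto intro!: derivative_eq_intros)
qed

lemma euler_inner_self_power_mult:
  assumes q: "real_polynomial_function q" "\<And>x. ddir x q x = e * q x"
  shows "ddir x (\<lambda>x. (x \<bullet> x) ^ j * q x) x = (2 * real j + e) * ((x \<bullet> x) ^ j * q x)"
  using q
  by (cases j) (simp_all add: ddir_mult ddir_power real_polynomial_function_power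
    real_polynomial_function_inner_self ddir_inner_self algebra_simps del: power_Suc, simp add: algebra_simps)

lemma laplacian_inner_self_mult:
  fixes q :: "'a::euclidean_space \<Rightarrow> real"
  assumes q: "real_polynomial_function q" "\<And>x. ddir x q x = e * q x"
  shows "laplacian (\<lambda>x. (x \<bullet> x) * q x) x = (2 * real DIM('a) + 4 * e) * q x + (x \<bullet> x) * laplacian q x"
proof -
  note poly = real_polynomial_function_inner_self real_polynomial_function_ddir[OF q(1)] q(1)
    real_polynomial_function.intros(1)[OF bounded_linear_inner_left]
  have lin: "ddir v (\<lambda>x. 2 * (x \<bullet> b)) = (\<lambda>x. 2 * (v \<bullet> b))" for v b :: 'a
    by (simp add: ddir_cmult poly ddir_inner_left)
  have lin_poly: "real_polynomial_function (\<lambda>x::'a. 2 * (x \<bullet> b))" for b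
    by (intro real_polynomial_function.intros(2,4) poly)
  have "ddir b (ddir b (\<lambda>x. (x \<bullet> x) * q x)) x =
      2 * q x + 4 * ((x \<bullet> b) * ddir b q x) + (x \<bullet> x) * ddir b (ddir b q) x" if "b \<in> Basis" for b
  proof -
    have 1: "ddir b (\<lambda>x. (x \<bullet> x) * q x) = (\<lambda>x. 2 * (x \<bullet> b) * q x + (x \<bullet> x) * ddir b q x)"
      by (simp add: ddir_mult poly ddir_inner_self)
    have 2: "ddir b (\<lambda>x. 2 * (x \<bullet> b) * q x + (x \<bullet> x) * ddir b q x) =
        (\<lambda>x. ddir b (\<lambda>x. 2 * (x \<bullet> b) * q x) x + ddir b (\<lambda>x. (x \<bullet> x) * ddir b q x) x)"
      by (rule ddir_add) (rule real_polynomial_function.intros(4) lin_poly poly)+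
    have 3: "ddir b (\<lambda>x. 2 * (x \<bullet> b) * q x) = (\<lambda>x. 2 * (b \<bullet> b) * q x + 2 * (x \<bullet> b) * ddir b q x)"
      using ddir_mult[OF lin_poly q(1), of b b] by (simp add: lin)
    have 4: "ddir b (\<lambda>x. (x \<bullet> x) * ddir b q x) =
        (\<lambda>x. 2 * (x \<bullet> b) * ddir b q x + (x \<bullet> x) * ddir b (ddir b q) x)"
      using ddir_mult[OF poly(1,2), of b b] by (simp add: ddir_inner_self)
    show ?thesis
      unfolding 1 2 3 4 using that by simp
  qed
  then have "laplacian (\<lambda>x. (x \<bullet> x) * q x) x =
      (\<Sum>b\<in>Basis. 2 * q x + 4 * ((x \<bullet> b) * ddir b q x) + (x \<bullet> x) * ddir b (ddir b q) x)"
    by (simp add: laplacian_eq real_polynomial_function.intros(4) poly)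
  also have "\<dots> = 2 * real DIM('a) * q x + 4 * ddir x q x + (x \<bullet> x) * laplacian q x"
    by (simp add: sum.distrib sum_distrib_left[symmetric] laplacian_eq[OF q(1)]
      ddir_direction[OF q(1), of x] del: q(2))
  finally show ?thesis by (simp add: q(2) algebra_simps)
qed

text \<open>The exponent \<open>j - 1\<close> is truncated only at j = 0, where its factor
  \<open>j\<close> is zero.\<close>

lemma laplacian_inner_self_power_mult:
  fixes q :: "'a::euclidean_space \<Rightarrow> real"
  assumes q: "real_polynomial_function q" "\<And>x. ddir x q x = e * q x"
  shows "laplacian (\<lambda>x. (x \<bullet> x) ^ j * q x) x =
    2 * real j * (real DIM('a) + 2 * e + 2 * real j - 2) * (x \<bullet> x) ^ (j - 1) * q x
    + (x \<bullet> x) ^ j * laplacian q x"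
proof (induction j)
  case (Suc j)
  have poly: "real_polynomial_function (\<lambda>x. (x \<bullet> x) ^ j * q x)"
    by (intro real_polynomial_function.intros(4) real_polynomial_function_power
      real_polynomial_function_inner_self q)
  have "laplacian (\<lambda>x. (x \<bullet> x) ^ Suc j * q x) x = laplacian (\<lambda>x. (x \<bullet> x) * ((x \<bullet> x) ^ j * q x)) x"
    by (simp add: mult.assoc)
  also have "\<dots> = (2 * real DIM('a) + 4 * (2 * real j + e)) * ((x \<bullet> x) ^ j * q x) +
      (x \<bullet> x) * laplacian (\<lambda>x. (x \<bullet> x) ^ j * q x) x"
    by (rule laplacian_inner_self_mult[OF poly euler_inner_self_power_mult[OF q]])
  also have "(x \<bullet> x) * laplacian (\<lambda>x. (x \<bullet> x) ^ j * q x) x =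
     2 * real j * (real DIM('a) + 2 * e + 2 * real j - 2) * (x \<bullet> x) ^ j * q x + (x \<bullet> x) ^ Suc j * laplacian q x"
    unfolding Suc by (cases j) (simp_all add: algebra_simps)
  finally show ?case by (simp add: algebra_simps)
qed simp

text \<open>Coefficients of the monic Gegenbauer polynomial of degree \<open>m\<close> with
  parameter (D - 2)/2, the Chebyshev polynomial when D = 2. The recursion is the condition under
  which consecutive terms of the Laplacian cancel.\<close>

primrec zonal_coeff :: "nat \<Rightarrow> nat \<Rightarrow> nat \<Rightarrow> real" where
  "zonal_coeff D m 0 = 1"
| "zonal_coeff D m (Suc j) = - zonal_coeff D m j * (real (m - 2 * j) * (real (m - 2 * j) - 1)) /
     (2 * (real j + 1) * (real D + 2 * real m - 2 * real j - 4))"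

text \<open>\<open>J\<close> stands for any family of polynomials with the calculus of powers of a
  linear form. Below it is both the powers of \<theta> \<bullet> x and their averages
  \<open>power_transform f\<close>, so one construction yields the components of the test function
  and the projection of \<open>f\<close>.\<close>

definition zonal :: "nat \<Rightarrow> (nat \<Rightarrow> 'a::euclidean_space \<Rightarrow> real) \<Rightarrow> 'a \<Rightarrow> real" where
  "zonal m J x = (\<Sum>j\<le>m div 2. zonal_coeff DIM('a) m j * ((x \<bullet> x) ^ j * J (m - 2 * j) x))"

text \<open>The Laplacian of the \<open>j\<close>-th term splits into a part \<open>A j\<close>,
  from the power of the radius, and a part \<open>B j\<close>, from \<open>J\<close>. Since
  \<open>A (Suc j)\<close> cancels \<open>B j\<close>, the sum telescopes; the last \<open>B\<close>
  vanishes because its degree is 0 or 1.\<close>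

lemma homogeneous_harmonic_polynomial_zonal:
  fixes J :: "nat \<Rightarrow> 'a::euclidean_space \<Rightarrow> real"
  assumes poly: "\<And>a. real_polynomial_function (J a)"
    and hom: "\<And>a c x. J a (c *\<^sub>R x) = c ^ a * J a x"
    and lap: "\<And>a x. laplacian (J a) x = real a * (real a - 1) * J (a - 2) x"
  shows "homogeneous_harmonic_polynomial m (zonal m J)"
  unfolding homogeneous_harmonic_polynomial_def
proof (intro conjI allI)
  have eul: "ddir x (J a) x = real a * J a x" for a x
    by (rule euler_identity[OF poly hom])
  have P: "real_polynomial_function (\<lambda>x. (x \<bullet> x) ^ j * J a x)" for j a
    by (intro real_polynomial_function.intros(4) real_polynomial_function_power
      real_polynomial_function_inner_self poly)
  have P': "real_polynomial_function (\<lambda>x. c * ((x \<bullet> x) ^ j * J a x))" for c j a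
    by (intro real_polynomial_function.intros(2) real_polynomial_function.intros(4)[OF _ P])
  show "real_polynomial_function (zonal m J)"
    unfolding zonal_def by (intro real_polynomial_function_sum P') simp
  show "zonal m J (c *\<^sub>R x) = c ^ m * zonal m J x" for c x
  proof -
    have "((c *\<^sub>R x) \<bullet> (c *\<^sub>R x)) ^ j * J (m - 2 * j) (c *\<^sub>R x) = c ^ m * ((x \<bullet> x) ^ j * J (m - 2 * j) x)"
      if "j \<le> m div 2" for j
    proof -
      have "c ^ m = (c * c) ^ j * c ^ (m - 2 * j)"
        using that by (simp add: power_mult[symmetric] power_add[symmetric] power2_eq_square[symmetric])
      then show ?thesis by (simp add: hom power_mult_distrib mult_ac)
    qed
    then show ?thesis
      by (simp add: zonal_def sum_distrib_left mult.left_commute)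
  qed
  show "laplacian (zonal m J) x = 0" for x
  proof -
    define z where "z = zonal_coeff DIM('a) m"
    define A where "A j = z j * (2 * real j * (real DIM('a) + 2 * real (m - 2 * j) + 2 * real j - 2) *
      (x \<bullet> x) ^ (j - 1) * J (m - 2 * j) x)" for j
    define B where "B j = z j * ((x \<bullet> x) ^ j * (real (m - 2 * j) * (real (m - 2 * j) - 1) * J (m - 2 * j - 2) x))" for j
    have "laplacian (zonal m J) x = (\<Sum>j\<le>m div 2. laplacian (\<lambda>x. z j * ((x \<bullet> x) ^ j * J (m - 2 * j) x)) x)"
      unfolding zonal_def z_def by (rule laplacian_sum) (simp_all add: P')
    also have "\<dots> = (\<Sum>j\<le>m div 2. A j + B j)"
      by (rule sum.cong) (simp_all add: laplacian_cmult[OF P] laplacian_inner_self_power_mult[OF poly eul]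
        lap A_def B_def distrib_left)
    \<comment> \<open>Stated for all partial sums, so that the telescoping can be an
      induction.\<close>
    also have "(\<Sum>j\<le>n. A j + B j) = B n" if "n \<le> m div 2" for n
      using that
    proof (induction n)
      case 0
      then show ?case by (simp add: A_def)
    next
      case (Suc n)
      then have n: "2 * n + 2 \<le> m" by linarith
      have den: "real DIM('a) + 2 * real m - 2 * real n - 4 > 0"
      proof -
        have "2 * real n + 2 \<le> real m" using n by linarith
        moreover have "real DIM('a) > 0" by simp
        ultimately show ?thesis by linarith
      qed
      have eq: "real DIM('a) + 2 * real (m - 2 * Suc n) + 2 * real (Suc n) - 2 =
          real DIM('a) + 2 * real m - 2 * real n - 4"
        using n by (simp add: of_nat_diff)
      have "A (Suc n) = z (Suc n) * (2 * (real n + 1) * (real DIM('a) + 2 * real m - 2 * real n - 4)) *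
          ((x \<bullet> x) ^ n * J (m - 2 * Suc n) x)"
        unfolding A_def unfolding eq unfolding diff_Suc_1 of_nat_Suc by (simp only: mult_ac add_ac)
      also have "z (Suc n) * (2 * (real n + 1) * (real DIM('a) + 2 * real m - 2 * real n - 4)) =
          - z n * (real (m - 2 * n) * (real (m - 2 * n) - 1))"
        using den by (simp add: z_def)
      finally have "A (Suc n) = - B n"
        by (simp add: B_def)
      then show ?case using Suc by simp
    qed
    also have "B (m div 2) = 0"
    proof -
      have "m - 2 * (m div 2) = 0 \<or> m - 2 * (m div 2) = 1" by presburger
      then show ?thesis by (auto simp: B_def)
    qed
    finally show ?thesis by simp
  qed
qed

text \<open>The system is triangular with unit diagonal, as \<open>zonal_coeff D m 0 = 1\<close>.
  The order of quantifiers matters: the weights serve every sequence \<open>F\<close>, hence every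
  point and every argument at once.\<close>

lemma zonal_inversion:
  "\<exists>w. \<forall>F :: nat \<Rightarrow> real. F l = (\<Sum>m | m \<le> l \<and> even (l + m). w m * (\<Sum>j\<le>m div 2. zonal_coeff D m j * F (m - 2 * j)))"
proof (induction l rule: less_induct)
  case (less l)
  define Z where "Z F m = (\<Sum>j\<le>m div 2. zonal_coeff D m j * F (m - 2 * j))" for F :: "nat \<Rightarrow> real" and m
  define S where "S l = {m. m \<le> l \<and> even (l + m)}" for l :: nat
  have "\<forall>l'. \<exists>w. l' < l \<longrightarrow> (\<forall>F. F l' = (\<Sum>m\<in>S l'. w m * Z F m))"
    using less.IH by (auto simp: Z_def S_def)
  then obtain W where "\<forall>l'. l' < l \<longrightarrow> (\<forall>F. F l' = (\<Sum>m\<in>S l'. W l' m * Z F m))"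
    by (rule choice[THEN exE])
  then have W: "F l' = (\<Sum>m\<in>S l'. W l' m * Z F m)" if "l' < l" for l' F
    using that by blast
  \<comment> \<open>Solve the equation for \<open>Z F l\<close> for its leading term
    \<open>F l\<close> and insert the expansions of the lower \<open>F (l - 2 * j)\<close>.\<close>
  define w where "w m = (if m = l then 1 else 0) -
    (\<Sum>j\<in>{1..l div 2}. zonal_coeff D l j * (if m \<in> S (l - 2 * j) then W (l - 2 * j) m else 0))" for m
  have fin: "finite (S l)" by (simp add: S_def)
  have "F l = (\<Sum>m\<in>S l. w m * Z F m)" for F
  proof -
    have "(\<Sum>m\<in>S l. (\<Sum>j\<in>{1..l div 2}. zonal_coeff D l j * (if m \<in> S (l - 2 * j) then W (l - 2 * j) m else 0)) * Z F m)
        = (\<Sum>j\<in>{1..l div 2}. zonal_coeff D l j * (\<Sum>m\<in>S l. if m \<in> S (l - 2 * j) then W (l - 2 * j) m * Z F m else 0))"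
      unfolding sum_distrib_right sum_distrib_left
      by (subst sum.swap) (auto intro!: sum.cong)
    also have "\<dots> = (\<Sum>j\<in>{1..l div 2}. zonal_coeff D l j * F (l - 2 * j))"
    proof (rule sum.cong)
      fix j assume j: "j \<in> {1..l div 2}"
      then have lt: "l - 2 * j < l" and le: "2 * j \<le> l" by auto
      have "S (l - 2 * j) \<subseteq> S l"
        using le by (auto simp: S_def)
      then have "(\<Sum>m\<in>S l. if m \<in> S (l - 2 * j) then W (l - 2 * j) m * Z F m else 0) =
          (\<Sum>m\<in>S (l - 2 * j). W (l - 2 * j) m * Z F m)"
        using fin by (subst sum.inter_restrict[symmetric]) (auto simp: Int_absorb1)
      then show "zonal_coeff D l j * (\<Sum>m\<in>S l. if m \<in> S (l - 2 * j) then W (l - 2 * j) m * Z F m else 0) =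
          zonal_coeff D l j * F (l - 2 * j)"
        using W[OF lt, of F] by simp
    qed simp
    also have "\<dots> = Z F l - F l"
    proof -
      have "Z F l = zonal_coeff D l 0 * F (l - 2 * 0) + (\<Sum>j\<in>{1..l div 2}. zonal_coeff D l j * F (l - 2 * j))"
      proof -
        have "{..l div 2} = insert 0 {1..l div 2}" by auto
        then show ?thesis by (simp add: Z_def)
      qed
      then show ?thesis by simp
    qed
    finally have "(\<Sum>m\<in>S l. (\<Sum>j\<in>{1..l div 2}. zonal_coeff D l j *
        (if m \<in> S (l - 2 * j) then W (l - 2 * j) m else 0)) * Z F m) = Z F l - F l" .
    moreover have "(\<Sum>m\<in>S l. (if m = l then 1 else 0) * Z F m) = Z F l"
    proof -
      have "l \<in> S l" by (simp add: S_def)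
      then show ?thesis using fin by (simp add: if_distrib[of "\<lambda>x. x * _"] cong: if_cong)
    qed
    ultimately show ?thesis
      by (simp add: w_def left_diff_distrib sum_subtractf)
  qed
  then show ?case unfolding S_def Z_def by blast
qed

lemma inner_power_family:
  fixes \<theta> :: "'a::euclidean_space"
  assumes "norm \<theta> = 1"
  shows "real_polynomial_function (\<lambda>x. (\<theta> \<bullet> x) ^ a)"
    and "(\<theta> \<bullet> (c *\<^sub>R x)) ^ a = c ^ a * (\<theta> \<bullet> x) ^ a"
    and "laplacian (\<lambda>x. (\<theta> \<bullet> x) ^ a) x = real a * (real a - 1) * (\<theta> \<bullet> x) ^ (a - 2)"
proof -
  have lin: "real_polynomial_function (\<lambda>x. \<theta> \<bullet> x)"
    by (intro real_polynomial_function.intros(1) bounded_linear_inner_right)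
  then show P: "real_polynomial_function (\<lambda>x. (\<theta> \<bullet> x) ^ a)" for a
    by (rule real_polynomial_function_power)
  show "(\<theta> \<bullet> (c *\<^sub>R x)) ^ a = c ^ a * (\<theta> \<bullet> x) ^ a" by (simp add: power_mult_distrib)
  have d1: "ddir b (\<lambda>x. (\<theta> \<bullet> x) ^ a) = (\<lambda>x. (real a * (\<theta> \<bullet> b)) * (\<theta> \<bullet> x) ^ (a - 1))" for a b
    by (simp add: ddir_power[OF lin] ddir_linear[OF bounded_linear_inner_right] mult_ac)
  have "ddir b (ddir b (\<lambda>x. (\<theta> \<bullet> x) ^ a)) x = (real a * (real a - 1) * (\<theta> \<bullet> x) ^ (a - 2)) * ((\<theta> \<bullet> b) * (\<theta> \<bullet> b))" for b
    unfolding d1 ddir_cmult[OF P]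
    by (cases a) (simp_all add: numeral_2_eq_2 mult_ac)
  then have "laplacian (\<lambda>x. (\<theta> \<bullet> x) ^ a) x =
      (real a * (real a - 1) * (\<theta> \<bullet> x) ^ (a - 2)) * (\<Sum>b\<in>Basis. (\<theta> \<bullet> b) * (\<theta> \<bullet> b))"
    by (simp only: laplacian_eq[OF P] sum_distrib_left)
  moreover have "(\<Sum>b\<in>Basis. (\<theta> \<bullet> b) * (\<theta> \<bullet> b)) = 1"
    using assms by (simp add: euclidean_inner[symmetric] norm_eq_1)
  ultimately show "laplacian (\<lambda>x. (\<theta> \<bullet> x) ^ a) x = real a * (real a - 1) * (\<theta> \<bullet> x) ^ (a - 2)"
    by simp
qed

text \<open>The continuous analogue of a combination of powers of \<theta> \<bullet> x, with
  \<open>f\<close> as the density of the coefficients.\<close>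

definition power_transform :: "('a::euclidean_space \<Rightarrow> real) \<Rightarrow> nat \<Rightarrow> 'a \<Rightarrow> real" where
  "power_transform f a x = (LINT \<eta>|sphere_measure. f \<eta> * (x \<bullet> \<eta>) ^ a)"

lemma integrable_mult_inner:
  fixes f :: "'a::euclidean_space \<Rightarrow> real"
  shows "integrable sphere_measure f \<Longrightarrow> integrable sphere_measure (\<lambda>\<eta>. f \<eta> * (v \<bullet> \<eta>))"
  by (erule integrable_sphere_mult) (intro continuous_intros)

lemma sum_Basis_inner: "(\<Sum>b\<in>Basis. (v \<bullet> b) * (b \<bullet> \<eta>)) = v \<bullet> \<eta>"
  unfolding euclidean_inner[of v \<eta>] by (rule sum.cong) (simp_all add: inner_commute)

text \<open>One factor x \<bullet> \<eta> is expanded in coordinates and its \<eta>-part joined to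
  \<open>f\<close>. Differentiation in x and exchange of integrals thereby become finite sums,
  handled by induction on the exponent with \<open>f\<close> arbitrary.\<close>

lemma power_transform_Suc:
  fixes f :: "'a::euclidean_space \<Rightarrow> real"
  assumes f: "integrable sphere_measure f"
  shows "power_transform f (Suc a) x = (\<Sum>b\<in>Basis. (x \<bullet> b) * power_transform (\<lambda>\<eta>. f \<eta> * (b \<bullet> \<eta>)) a x)"
proof -
  have "power_transform f (Suc a) x =
      (LINT \<eta>|sphere_measure. (\<Sum>b\<in>Basis. (x \<bullet> b) * (f \<eta> * (b \<bullet> \<eta>) * (x \<bullet> \<eta>) ^ a)))"
    unfolding power_transform_def
  proof (rule Bochner_Integration.integral_cong)
    fix \<eta> :: 'a
    have "f \<eta> * (x \<bullet> \<eta>) ^ Suc a = (x \<bullet> \<eta>) * (f \<eta> * (x \<bullet> \<eta>) ^ a)" by simp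
    also have "\<dots> = (\<Sum>b\<in>Basis. (x \<bullet> b) * (b \<bullet> \<eta>)) * (f \<eta> * (x \<bullet> \<eta>) ^ a)"
      by (simp only: sum_Basis_inner)
    finally show "f \<eta> * (x \<bullet> \<eta>) ^ Suc a = (\<Sum>b\<in>Basis. (x \<bullet> b) * (f \<eta> * (b \<bullet> \<eta>) * (x \<bullet> \<eta>) ^ a))"
      unfolding sum_distrib_right by (simp only: mult_ac)
  qed simp
  also have "\<dots> = (\<Sum>b\<in>Basis. (x \<bullet> b) * power_transform (\<lambda>\<eta>. f \<eta> * (b \<bullet> \<eta>)) a x)"
    unfolding power_transform_def
    by (subst Bochner_Integration.integral_sum)
      (auto intro!: integrable_sphere_mult integrable_mult_inner f continuous_intros)
  finally show ?thesis .
qed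

lemma power_transform_sum:
  fixes f :: "'a::euclidean_space \<Rightarrow> real"
  assumes f: "integrable sphere_measure f"
  shows "(\<Sum>b\<in>Basis. (v \<bullet> b) * power_transform (\<lambda>\<eta>. f \<eta> * (b \<bullet> \<eta>)) a x) =
    power_transform (\<lambda>\<eta>. f \<eta> * (v \<bullet> \<eta>)) a x"
proof -
  have "(\<Sum>b\<in>Basis. (v \<bullet> b) * power_transform (\<lambda>\<eta>. f \<eta> * (b \<bullet> \<eta>)) a x) =
      (LINT \<eta>|sphere_measure. (\<Sum>b\<in>Basis. (v \<bullet> b) * (f \<eta> * (b \<bullet> \<eta>) * (x \<bullet> \<eta>) ^ a)))"
    unfolding power_transform_def
    by (subst Bochner_Integration.integral_sum)
      (auto intro!: integrable_sphere_mult integrable_mult_inner f continuous_intros)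
  also have "(\<lambda>\<eta>. \<Sum>b\<in>Basis. (v \<bullet> b) * (f \<eta> * (b \<bullet> \<eta>) * (x \<bullet> \<eta>) ^ a)) = (\<lambda>\<eta>. f \<eta> * (v \<bullet> \<eta>) * (x \<bullet> \<eta>) ^ a)"
  proof
    fix \<eta>
    have "(\<Sum>b\<in>Basis. (v \<bullet> b) * (f \<eta> * (b \<bullet> \<eta>) * (x \<bullet> \<eta>) ^ a)) =
        f \<eta> * (x \<bullet> \<eta>) ^ a * (\<Sum>b\<in>Basis. (v \<bullet> b) * (b \<bullet> \<eta>))"
      by (simp add: sum_distrib_left mult_ac)
    also have "\<dots> = f \<eta> * (v \<bullet> \<eta>) * (x \<bullet> \<eta>) ^ a"
      unfolding sum_Basis_inner by (simp only: mult_ac)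
    finally show "(\<Sum>b\<in>Basis. (v \<bullet> b) * (f \<eta> * (b \<bullet> \<eta>) * (x \<bullet> \<eta>) ^ a)) = f \<eta> * (v \<bullet> \<eta>) * (x \<bullet> \<eta>) ^ a" .
  qed
  finally show ?thesis by (simp add: power_transform_def)
qed

text \<open>Both claims are proved together, because the product rule for \<open>ddir\<close> asks
  for polynomiality.\<close>

lemma power_transform_calculus:
  fixes f :: "'a::euclidean_space \<Rightarrow> real"
  assumes "integrable sphere_measure f"
  shows "real_polynomial_function (power_transform f a) \<and>
    (\<forall>v. ddir v (power_transform f a) = (\<lambda>x. real a * power_transform (\<lambda>\<eta>. f \<eta> * (v \<bullet> \<eta>)) (a - 1) x))"
  using assms
proof (induction a arbitrary: f)
  case 0
  have "power_transform f 0 = (\<lambda>x. LINT \<eta>|sphere_measure. f \<eta>)"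
    by (simp add: power_transform_def fun_eq_iff)
  then show ?case by (auto intro: real_polynomial_function.intros(2))
next
  case (Suc a)
  let ?F = "\<lambda>b. power_transform (\<lambda>\<eta>. f \<eta> * (b \<bullet> \<eta>)) a"
  have eq: "power_transform f (Suc a) = (\<lambda>x. \<Sum>b\<in>Basis. (x \<bullet> b) * ?F b x)"
    by (rule ext) (rule power_transform_Suc[OF Suc.prems])
  have IH: "real_polynomial_function (?F b)"
    "ddir v (?F b) = (\<lambda>x. real a * power_transform (\<lambda>\<eta>. f \<eta> * (b \<bullet> \<eta>) * (v \<bullet> \<eta>)) (a - 1) x)" for b v
    using Suc.IH[OF integrable_mult_inner[OF Suc.prems]] by auto
  have lin: "real_polynomial_function (\<lambda>x::'a. x \<bullet> b)" for b
    by (intro real_polynomial_function.intros(1) bounded_linear_inner_left)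
  have P: "real_polynomial_function (\<lambda>x. (x \<bullet> b) * ?F b x)" for b
    by (intro real_polynomial_function.intros(4) lin IH(1))
  have "real_polynomial_function (power_transform f (Suc a))"
    unfolding eq by (intro real_polynomial_function_sum P) simp
  moreover have "ddir v (power_transform f (Suc a)) x = real (Suc a) * power_transform (\<lambda>\<eta>. f \<eta> * (v \<bullet> \<eta>)) (Suc a - 1) x" for v x
  proof -
    have "ddir v (power_transform f (Suc a)) x = (\<Sum>b\<in>Basis. (v \<bullet> b) * ?F b x + (x \<bullet> b) * ddir v (?F b) x)"
      unfolding eq by (subst ddir_sum[OF _ P]) (simp_all add: ddir_mult lin IH(1) ddir_inner_left)
    also have "\<dots> = ?F v x + real a * (\<Sum>b\<in>Basis. (x \<bullet> b) * power_transform (\<lambda>\<eta>. f \<eta> * (b \<bullet> \<eta>) * (v \<bullet> \<eta>)) (a - 1) x)"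
      by (simp add: sum.distrib power_transform_sum[OF Suc.prems] IH(2) sum_distrib_left mult.left_commute)
    also have "real a * (\<Sum>b\<in>Basis. (x \<bullet> b) * power_transform (\<lambda>\<eta>. f \<eta> * (b \<bullet> \<eta>) * (v \<bullet> \<eta>)) (a - 1) x) = real a * ?F v x"
    proof (cases a)
      case (Suc a')
      have "(\<lambda>\<eta>. f \<eta> * (b \<bullet> \<eta>) * (v \<bullet> \<eta>)) = (\<lambda>\<eta>. f \<eta> * (v \<bullet> \<eta>) * (b \<bullet> \<eta>))" for b
        by (simp add: mult_ac)
      then show ?thesis
        using power_transform_Suc[OF integrable_mult_inner[OF Suc.prems], of v a' x] Suc by simp
    qed simp
    finally show ?thesis by (simp add: algebra_simps)
  qed
  ultimately show ?case by blast
qed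

lemma power_transform_family:
  fixes f :: "'a::euclidean_space \<Rightarrow> real"
  assumes f: "integrable sphere_measure f"
  shows "real_polynomial_function (power_transform f a)"
    and "power_transform f a (c *\<^sub>R x) = c ^ a * power_transform f a x"
    and "laplacian (power_transform f a) x = real a * (real a - 1) * power_transform f (a - 2) x"
proof -
  show P: "real_polynomial_function (power_transform f a)"
    using power_transform_calculus[OF f] by blast
  have "power_transform f a (c *\<^sub>R x) = (LINT \<eta>|sphere_measure. c ^ a * (f \<eta> * (x \<bullet> \<eta>) ^ a))"
    by (simp add: power_transform_def power_mult_distrib mult_ac)
  then show "power_transform f a (c *\<^sub>R x) = c ^ a * power_transform f a x"
    by (simp add: power_transform_def)
  have d: "ddir b (power_transform h a) = (\<lambda>x. real a * power_transform (\<lambda>\<eta>. h \<eta> * (b \<bullet> \<eta>)) (a - 1) x)"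
    "real_polynomial_function (power_transform h a)"
    if "integrable sphere_measure h" for h :: "'a \<Rightarrow> real" and a b
    using power_transform_calculus[OF that] by auto
  have "ddir b (ddir b (power_transform f a)) x =
      real a * (real (a - 1) * power_transform (\<lambda>\<eta>. f \<eta> * (b \<bullet> \<eta>) * (b \<bullet> \<eta>)) (a - 1 - 1) x)" for b
    unfolding d(1)[OF f] ddir_cmult[OF d(2)[OF integrable_mult_inner[OF f]]]
      d(1)[OF integrable_mult_inner[OF f]] ..
  then have "laplacian (power_transform f a) x =
      real a * (real (a - 1) * (\<Sum>b\<in>Basis. power_transform (\<lambda>\<eta>. f \<eta> * (b \<bullet> \<eta>) * (b \<bullet> \<eta>)) (a - 1 - 1) x))"
    by (simp add: laplacian_eq[OF P] sum_distrib_left)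
  \<comment> \<open>The trace of the second derivatives multiplies the density by the squared norm
    of \<eta>, which is 1 on the sphere.\<close>
  also have "(\<Sum>b\<in>Basis. power_transform (\<lambda>\<eta>. f \<eta> * (b \<bullet> \<eta>) * (b \<bullet> \<eta>)) (a - 1 - 1) x) =
      (LINT \<eta>|sphere_measure. (\<Sum>b\<in>Basis. f \<eta> * (b \<bullet> \<eta>) * (b \<bullet> \<eta>) * (x \<bullet> \<eta>) ^ (a - 1 - 1)))"
    unfolding power_transform_def
    by (rule Bochner_Integration.integral_sum[symmetric])
      (intro integrable_sphere_mult integrable_mult_inner f continuous_intros)
  also have "\<dots> = power_transform f (a - 1 - 1) x"
    unfolding power_transform_def
  proof (rule Bochner_Integration.integral_cong)
    fix \<eta> :: 'a assume "\<eta> \<in> space sphere_measure"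
    then have "(\<Sum>b\<in>Basis. (b \<bullet> \<eta>) * (b \<bullet> \<eta>)) = 1"
      using euclidean_inner[of \<eta> \<eta>] by (simp add: norm_eq_1 inner_commute)
    then have "f \<eta> * (x \<bullet> \<eta>) ^ (a - 1 - 1) * (\<Sum>b\<in>Basis. (b \<bullet> \<eta>) * (b \<bullet> \<eta>)) = f \<eta> * (x \<bullet> \<eta>) ^ (a - 1 - 1)"
      by simp
    then show "(\<Sum>b\<in>Basis. f \<eta> * (b \<bullet> \<eta>) * (b \<bullet> \<eta>) * (x \<bullet> \<eta>) ^ (a - 1 - 1)) = f \<eta> * (x \<bullet> \<eta>) ^ (a - 1 - 1)"
      by (simp add: sum_distrib_left mult_ac)
  qed simp
  finally show "laplacian (power_transform f a) x = real a * (real a - 1) * power_transform f (a - 2) x"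
    by (cases a) (simp_all add: numeral_2_eq_2)
qed

text \<open>Fubini for the polynomial kernel \<open>(x \<bullet> \<eta>) ^ a\<close>, by expanding one factor in coordinates.\<close>

lemma power_transform_swap:
  fixes f h :: "'a::euclidean_space \<Rightarrow> real"
  assumes "integrable sphere_measure f" "integrable sphere_measure h"
  shows "(LINT x|sphere_measure. power_transform f a x * h x) = (LINT x|sphere_measure. power_transform h a x * f x)"
  using assms
proof (induction a arbitrary: f h)
  case 0
  then show ?case by (simp add: power_transform_def mult.commute)
next
  case (Suc a)
  have cont: "continuous_on UNIV (power_transform u a)" if "integrable sphere_measure u" for u :: "'a \<Rightarrow> real"
    by (rule continuous_real_polynomial_function) (rule power_transform_family(1)[OF that])
  have expand: "(LINT x|sphere_measure. power_transform u (Suc a) x * v x) =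
      (\<Sum>b\<in>Basis. LINT x|sphere_measure. power_transform (\<lambda>\<eta>. u \<eta> * (b \<bullet> \<eta>)) a x * (v x * (b \<bullet> x)))"
    if u: "integrable sphere_measure u" and v: "integrable sphere_measure v" for u v :: "'a \<Rightarrow> real"
  proof -
    have "(LINT x|sphere_measure. power_transform u (Suc a) x * v x) =
       (LINT x|sphere_measure. (\<Sum>b\<in>Basis. v x * (b \<bullet> x) * power_transform (\<lambda>\<eta>. u \<eta> * (b \<bullet> \<eta>)) a x))"
      by (simp add: power_transform_Suc[OF u] sum_distrib_left sum_distrib_right inner_commute mult_ac)
    also have "\<dots> = (\<Sum>b\<in>Basis. LINT x|sphere_measure. v x * (b \<bullet> x) * power_transform (\<lambda>\<eta>. u \<eta> * (b \<bullet> \<eta>)) a x)"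
      by (rule Bochner_Integration.integral_sum)
        (intro integrable_sphere_mult[OF integrable_mult_inner[OF v]] cont integrable_mult_inner u)
    finally show ?thesis by (simp add: mult.commute)
  qed
  show ?case
    unfolding expand[OF Suc.prems] expand[OF Suc.prems(2,1)]
    by (rule sum.cong[OF refl], rule Suc.IH) (intro integrable_mult_inner Suc.prems)+
qed

section \<open>Orthogonality of the degrees and existence of the projection\<close>

lemma funk_hecke_power:
  fixes x :: "'a::euclidean_space"
  assumes "solid_harmonic m p" "norm x = 1"
  shows "power_transform p l x = funk_hecke_coeff (power_coeff TYPE('a)) m l * p x"
proof -
  have "x \<noteq> 0" using assms by auto
  then show ?thesis
    using ridge_family.funk_hecke[OF ridge_family_power assms(1), of l x] assms(2)
    by (simp add: power_transform_def mult.commute)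
qed

lemma solid_harmonic_continuous: "solid_harmonic m p \<Longrightarrow> continuous_on A p"
  by (simp add: solid_harmonic_def continuous_real_polynomial_function)

lemma power_coeff_diag_pos: "funk_hecke_coeff (power_coeff TYPE('a::euclidean_space)) m m > 0"
proof (cases "m = 0")
  case True
  then show ?thesis by (simp add: power_coeff_def sphere_moment_0)
qed (simp add: power_coeff_bounds(1))

text \<open>Convolution with the \<open>m\<close>-th power is symmetric, has a positive eigenvalue
  on degree m and annihilates every higher degree; pairing p with q after moving it across gives
  0.\<close>

lemma solid_harmonic_orthogonal_less:
  fixes p q :: "'a::euclidean_space \<Rightarrow> real"
  assumes p: "solid_harmonic m p" and q: "solid_harmonic m' q" and "m < m'"
  shows "L2_inner p q = 0"
proof -
  let ?c = "funk_hecke_coeff (power_coeff TYPE('a))"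
  have int: "integrable sphere_measure p" "integrable sphere_measure q"
    using p q by (auto intro!: integrable_sphere_continuous solid_harmonic_continuous)
  have "?c m m * L2_inner p q = (LINT x|sphere_measure. power_transform p m x * q x)"
    unfolding L2_inner_def integral_mult_right_zero[symmetric]
    by (rule Bochner_Integration.integral_cong) (simp_all add: funk_hecke_power[OF p])
  also have "\<dots> = (LINT x|sphere_measure. power_transform q m x * p x)"
    by (rule power_transform_swap[OF int])
  also have "\<dots> = (LINT x|(sphere_measure :: 'a measure). 0 :: real)"
    by (rule Bochner_Integration.integral_cong)
      (simp_all add: funk_hecke_power[OF q] power_coeff_large[OF \<open>m < m'\<close>])
  finally show ?thesis using power_coeff_diag_pos[of m, where 'a='a] by simp
qed

lemma solid_harmonic_orthogonal:
  "solid_harmonic m p \<Longrightarrow> solid_harmonic m' q \<Longrightarrow> m \<noteq> m' \<Longrightarrow> L2_inner p q = 0"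
  using solid_harmonic_orthogonal_less[of m p m' q] solid_harmonic_orthogonal_less[of m' q m p]
    L2_inner_commute[of p q] by (cases "m < m'") auto

lemma zonal_sphere:
  "norm x = 1 \<Longrightarrow> zonal m J x = (\<Sum>j\<le>m div 2. zonal_coeff DIM('a) m j * J (m - 2 * j) (x :: 'a::euclidean_space))"
  by (simp add: zonal_def norm_eq_1)

text \<open>The zonal harmonic built from the transforms of \<open>f\<close> represents, up to a factor, the
  functional \<open>L2_inner f\<close> on spherical harmonics of degree \<open>m\<close>: all lower order terms are
  annihilated by Funk-Hecke.\<close>

lemma harmonic_projection_exists:
  fixes f :: "'a::euclidean_space \<Rightarrow> real"
  assumes f: "f \<in> L2_sphere"
  shows "\<exists>g. g \<in> spherical_harmonics m \<and> (\<forall>y\<in>spherical_harmonics m. L2_inner (\<lambda>\<eta>. f \<eta> - g \<eta>) y = 0)"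
proof -
  let ?c = "funk_hecke_coeff (power_coeff TYPE('a)) m"
  have int: "integrable sphere_measure f" by (rule L2_sphere_integrable[OF f])
  define Z where "Z = zonal m (power_transform f)"
  have Z: "homogeneous_harmonic_polynomial m Z"
    unfolding Z_def by (rule homogeneous_harmonic_polynomial_zonal) (rule power_transform_family[OF int])+
  define g where "g x = inverse (?c m) * Z x" for x
  have cZ: "continuous_on UNIV Z"
    using Z by (auto simp: homogeneous_harmonic_polynomial_def intro: continuous_real_polynomial_function)
  have "homogeneous_harmonic_polynomial m g"
    using Z unfolding homogeneous_harmonic_polynomial_def g_def
    by (auto simp: laplacian_cmult intro!: real_polynomial_function.intros(2,4))
  then have "g \<in> spherical_harmonics m"
    by (auto simp: spherical_harmonics_def)
  moreover have "L2_inner (\<lambda>\<eta>. f \<eta> - g \<eta>) y = 0" if y: "y \<in> spherical_harmonics m" for y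
  proof -
    obtain p where "homogeneous_harmonic_polynomial m p" and yp: "\<And>\<eta>. norm \<eta> = 1 \<Longrightarrow> y \<eta> = p \<eta>"
      using y by (auto simp: spherical_harmonics_def)
    then have p: "solid_harmonic m p" by (intro homogeneous_harmonic_polynomial_solid)
    have cp: "continuous_on UNIV p" by (rule solid_harmonic_continuous[OF p])
    have cT: "continuous_on UNIV (power_transform f a)" for a
      by (rule continuous_real_polynomial_function) (rule power_transform_family(1)[OF int])
    have "L2_inner Z p = (LINT x|sphere_measure. (\<Sum>j\<le>m div 2. zonal_coeff DIM('a) m j * (power_transform f (m - 2 * j) x * p x)))"
      unfolding L2_inner_def
      by (rule Bochner_Integration.integral_cong) (simp_all add: Z_def zonal_sphere sum_distrib_right mult.assoc)
    also have "\<dots> = (\<Sum>j\<le>m div 2. zonal_coeff DIM('a) m j * (LINT x|sphere_measure. power_transform f (m - 2 * j) x * p x))"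
      by (subst Bochner_Integration.integral_sum)
        (auto intro!: integrable_sphere_continuous continuous_on_mult cp cT)
    \<comment> \<open>For j > 0 the exponent m - 2j is too small to see degree m. The surviving
      multiplier is what the inverse factor in \<open>g\<close> compensates.\<close>
    also have "\<dots> = (\<Sum>j\<le>m div 2. if j = 0 then ?c m * L2_inner f p else 0)"
    proof (rule sum.cong[OF refl])
      fix j assume "j \<in> {..m div 2}"
      have "(LINT x|sphere_measure. power_transform f (m - 2 * j) x * p x) =
          (LINT x|sphere_measure. power_transform p (m - 2 * j) x * f x)"
        by (rule power_transform_swap[OF int integrable_sphere_continuous[OF cp]])
      also have "\<dots> = (LINT x|sphere_measure. ?c (m - 2 * j) * (f x * p x))"
        by (rule Bochner_Integration.integral_cong) (simp_all add: funk_hecke_power[OF p])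
      also have "\<dots> = ?c (m - 2 * j) * L2_inner f p" by (simp add: L2_inner_def)
      finally show "zonal_coeff DIM('a) m j * (LINT x|sphere_measure. power_transform f (m - 2 * j) x * p x) =
          (if j = 0 then ?c m * L2_inner f p else 0)"
        using \<open>j \<in> {..m div 2}\<close> power_coeff_large[of "m - 2 * j" m, where 'a='a]
        by (cases "j = 0") auto
    qed
    also have "\<dots> = ?c m * L2_inner f p" by simp
    finally have "L2_inner g p = L2_inner f p"
      using power_coeff_diag_pos[of m, where 'a='a]
      by (simp add: g_def[abs_def] L2_inner_cmult_left)
    moreover have "g \<in> L2_sphere"
      unfolding g_def by (intro continuous_L2_sphere continuous_intros cZ)
    ultimately have "L2_inner (\<lambda>\<eta>. f \<eta> - g \<eta>) p = 0"
      using L2_inner_diff_left[OF f _ continuous_L2_sphere[OF cp]] by simp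
    then show ?thesis
      using L2_inner_cong_sphere[of "\<lambda>\<eta>. f \<eta> - g \<eta>" "\<lambda>\<eta>. f \<eta> - g \<eta>" y p] yp by simp
  qed
  ultimately show ?thesis by blast
qed

lemma harmonic_projection:
  fixes f :: "'a::euclidean_space \<Rightarrow> real"
  assumes f: "f \<in> L2_sphere"
  shows "harmonic_projection m f \<in> L2_sphere"
    and "homogeneous_harmonic_polynomial m p \<Longrightarrow> L2_inner f p = L2_inner (harmonic_projection m f) p"
proof -
  let ?g = "harmonic_projection m f"
  have g: "?g \<in> spherical_harmonics m" "\<And>y. y \<in> spherical_harmonics m \<Longrightarrow> L2_inner (\<lambda>\<eta>. f \<eta> - ?g \<eta>) y = 0"
    using someI_ex[OF harmonic_projection_exists[OF f, of m]] unfolding harmonic_projection_def by auto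
  obtain q where q: "homogeneous_harmonic_polynomial m q" "\<And>\<eta>. norm \<eta> = 1 \<Longrightarrow> ?g \<eta> = q \<eta>"
    using g(1) by (auto simp: spherical_harmonics_def)
  then have "q \<in> L2_sphere"
    by (auto simp: homogeneous_harmonic_polynomial_def intro!: continuous_L2_sphere continuous_real_polynomial_function)
  then show L2: "?g \<in> L2_sphere"
    using L2_sphere_cong[of ?g q] q(2) by blast
  assume "homogeneous_harmonic_polynomial m p"
  then have "p \<in> spherical_harmonics m" "p \<in> L2_sphere"
    by (auto simp: spherical_harmonics_def homogeneous_harmonic_polynomial_def
      intro!: continuous_L2_sphere continuous_real_polynomial_function)
  then show "L2_inner f p = L2_inner ?g p"
    using g(2)[of p] L2_inner_diff_left[OF f L2] by simp
qed

section \<open>Packing and covering\<close>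

text \<open>Volume comparison: disjoint balls of radius \<delta>/2 inside one ball of radius R +
  \<delta>/2.\<close>

lemma packing_card:
  fixes P :: "'a::euclidean_space set"
  assumes "finite P" "\<delta> > 0" "R \<ge> 0"
    and sep: "\<And>p q. p \<in> P \<Longrightarrow> q \<in> P \<Longrightarrow> p \<noteq> q \<Longrightarrow> dist p q \<ge> \<delta>"
    and near: "\<And>p. p \<in> P \<Longrightarrow> dist \<eta> p \<le> R"
  shows "real (card P) \<le> (1 + 2 * R / \<delta>) ^ DIM('a)"
proof -
  let ?V = "unit_ball_vol (real DIM('a))"
  have V: "?V > 0" by simp
  have disj: "disjoint_family_on (\<lambda>p. ball p (\<delta> / 2)) P"
    unfolding disjoint_family_on_def
  proof (intro ballI impI)
    fix p q assume "p \<in> P" "q \<in> P" "p \<noteq> q"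
    then have "dist p q \<ge> \<delta>" by (rule sep)
    then show "ball p (\<delta> / 2) \<inter> ball q (\<delta> / 2) = {}"
      by (intro disjoint_ballI) simp
  qed
  have "real (card P) * (?V * (\<delta> / 2) ^ DIM('a)) = (\<Sum>p\<in>P. measure lborel (ball p (\<delta> / 2)))"
    using \<open>\<delta> > 0\<close> by (simp add: content_ball)
  also have "\<dots> = measure lborel (\<Union>p\<in>P. ball p (\<delta> / 2))"
    using assms(1) disj emeasure_lborel_ball_finite[where 'a='a, THEN less_imp_neq]
    by (intro measure_finite_Union[symmetric]) auto
  also have "\<dots> \<le> measure lborel (ball \<eta> (R + \<delta> / 2))"
  proof (rule measure_mono_fmeasurable)
    show "(\<Union>p\<in>P. ball p (\<delta> / 2)) \<subseteq> ball \<eta> (R + \<delta> / 2)"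
    proof
      fix x assume "x \<in> (\<Union>p\<in>P. ball p (\<delta> / 2))"
      then obtain p where "p \<in> P" "dist p x < \<delta> / 2" by auto
      then show "x \<in> ball \<eta> (R + \<delta> / 2)"
        using near[of p] dist_triangle[of \<eta> x p] by simp
    qed
  qed (use emeasure_lborel_ball_finite[of \<eta> "R + \<delta> / 2"] in \<open>auto simp: fmeasurable_def intro!: borel_open\<close>)
  also have "\<dots> = ?V * (R + \<delta> / 2) ^ DIM('a)"
    using assms by (simp add: content_ball)
  finally have "real (card P) * (\<delta> / 2) ^ DIM('a) \<le> (R + \<delta> / 2) ^ DIM('a)"
    using V by (simp add: mult.left_commute mult_le_cancel_left_pos)
  then have "real (card P) \<le> (R + \<delta> / 2) ^ DIM('a) / (\<delta> / 2) ^ DIM('a)"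
    using \<open>\<delta> > 0\<close> by (subst pos_le_divide_eq) auto
  also have "\<dots> = (1 + 2 * R / \<delta>) ^ DIM('a)"
  proof -
    have "(R + \<delta> / 2) / (\<delta> / 2) = 1 + 2 * R / \<delta>"
      using \<open>\<delta> > 0\<close> by (simp add: field_simps)
    then show ?thesis by (simp only: power_divide[symmetric])
  qed
  finally show ?thesis .
qed

text \<open>The numerator is the constant in the count of one shell, the denominator comes from the
  geometric series of ratio exp (-1/2).\<close>

definition packing_const :: "nat \<Rightarrow> real" where
  "packing_const D = 2 ^ D * fact D * exp 1 / (1 - exp (- (1 / 2)))"

lemma packing_const_pos: "packing_const D > 0"
  by (simp add: packing_const_def)

text \<open>The points are sorted into shells of width \<open>\<delta> / 2\<close> around \<open>\<eta>\<close>; the \<open>i\<close>-th shell contains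
  polynomially many of them and contributes \<open>exp (- A i\<^sup>2)\<close> each.\<close>

lemma gaussian_packing_sum:
  fixes P :: "'a::euclidean_space set"
  assumes P: "finite P" "\<delta> > 0" "A \<ge> 1" "l * \<delta>\<^sup>2 \<ge> 8 * A"
    and sep: "\<And>p q. p \<in> P \<Longrightarrow> q \<in> P \<Longrightarrow> p \<noteq> q \<Longrightarrow> dist p q \<ge> \<delta>"
    and far: "\<And>p. p \<in> P \<Longrightarrow> dist \<eta> p \<ge> \<delta> / 2"
  shows "(\<Sum>p\<in>P. exp (- (l * (dist \<eta> p)\<^sup>2 / 2))) \<le> packing_const DIM('a) * exp (- (A - 1))"
proof -
  define D where "D = DIM('a)"
  define C where "C = 2 ^ D * fact D * exp (1::real)"
  define q where "q = exp (- (1 / 2) :: real)"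
  have q: "0 < q" "q < 1" by (auto simp: q_def)
  have C: "C > 0" by (simp add: C_def)
  define idx where "idx p = nat \<lfloor>2 * dist \<eta> p / \<delta>\<rfloor>" for p
  have idx: "real (idx p) \<le> 2 * dist \<eta> p / \<delta>" "2 * dist \<eta> p / \<delta> < real (idx p) + 1" for p
  proof -
    have "0 \<le> 2 * dist \<eta> p / \<delta>" using P(2) by simp
    then show "real (idx p) \<le> 2 * dist \<eta> p / \<delta>" "2 * dist \<eta> p / \<delta> < real (idx p) + 1"
      unfolding idx_def by (simp_all add: of_nat_nat)
  qed
  have idx1: "idx p \<ge> 1" if "p \<in> P" for p
  proof -
    have "1 \<le> 2 * dist \<eta> p / \<delta>" using P(2) far[OF that] by (simp add: field_simps)
    then have "1 \<le> \<lfloor>2 * dist \<eta> p / \<delta>\<rfloor>" by simp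
    then show ?thesis unfolding idx_def by linarith
  qed
  have l: "l \<ge> 0"
  proof -
    have "0 < l * \<delta>\<^sup>2" using P(3,4) by linarith
    then show ?thesis using P(2) by (simp add: zero_less_mult_iff)
  qed
  have term_le: "exp (- (l * (dist \<eta> p)\<^sup>2 / 2)) \<le> exp (- (A - 1)) * exp (- real (idx p))" if "p \<in> P" for p
  proof -
    define i where "i = real (idx p)"
    have i1: "i \<ge> 1" using idx1[OF that] by (simp add: i_def)
    have "i * \<delta> / 2 \<le> dist \<eta> p" using idx(1)[of p] P(2) by (simp add: i_def field_simps)
    then have "(i * \<delta> / 2)\<^sup>2 \<le> (dist \<eta> p)\<^sup>2" using i1 P(2) by (intro power_mono) auto
    then have "l * (i * \<delta> / 2)\<^sup>2 / 2 \<le> l * (dist \<eta> p)\<^sup>2 / 2"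
      using l by (intro divide_right_mono mult_left_mono) auto
    moreover have "l * (i * \<delta> / 2)\<^sup>2 / 2 = (l * \<delta>\<^sup>2) * i\<^sup>2 / 8"
      by (simp add: power_mult_distrib power_divide)
    moreover have "8 * A * i\<^sup>2 / 8 \<le> (l * \<delta>\<^sup>2) * i\<^sup>2 / 8"
      using P(4) by (intro divide_right_mono mult_right_mono) auto
    \<comment> \<open>Of the Gaussian exponent, A - 1 is saved as the overall gain and one
      \<open>i\<close> is kept for summability over the shells.\<close>
    moreover have "(A - 1) + i \<le> A * i\<^sup>2"
    proof -
      have "i \<le> i\<^sup>2" using i1 by (simp add: power2_eq_square)
      moreover have "(A - 1) * 1 \<le> (A - 1) * i\<^sup>2" using P(3) i1 by (intro mult_left_mono) auto
      ultimately show ?thesis by (simp add: algebra_simps)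
    qed
    ultimately have "(A - 1) + i \<le> l * (dist \<eta> p)\<^sup>2 / 2" by simp
    then show ?thesis by (simp add: exp_add[symmetric] i_def)
  qed
  have shell: "real (card {p \<in> P. idx p = i}) \<le> C * exp (real i / 2)" for i
  proof -
    have "real (card {p \<in> P. idx p = i}) \<le> (1 + 2 * ((real i + 1) * \<delta> / 2) / \<delta>) ^ D"
      unfolding D_def
    proof (rule packing_card)
      fix p assume "p \<in> {p \<in> P. idx p = i}"
      then show "dist \<eta> p \<le> (real i + 1) * \<delta> / 2"
        using idx(2)[of p] P(2) by (simp add: field_simps)
    next
      show "finite {p \<in> P. idx p = i}" using P(1) by simp
      show "\<delta> \<le> dist p q" if "p \<in> {p \<in> P. idx p = i}" "q \<in> {p \<in> P. idx p = i}" "p \<noteq> q" for p q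
        using sep that by blast
    qed (use P(2) in simp_all)
    also have "\<dots> = 2 ^ D * ((real i + 2) / 2) ^ D"
    proof -
      have "1 + 2 * ((real i + 1) * \<delta> / 2) / \<delta> = 2 * ((real i + 2) / 2)"
        using P(2) by (simp add: field_simps)
      then show ?thesis by (simp only: power_mult_distrib)
    qed
    \<comment> \<open>The polynomial number of points is absorbed by half of the exponential decay
      in \<open>i\<close>.\<close>
    also have "\<dots> \<le> 2 ^ D * (fact D * exp ((real i + 2) / 2))"
      by (intro mult_left_mono power_le_fact_exp) auto
    also have "\<dots> = C * exp (real i / 2)"
      by (simp add: C_def exp_add add_divide_distrib)
    finally show ?thesis .
  qed
  have "(\<Sum>p\<in>P. exp (- (l * (dist \<eta> p)\<^sup>2 / 2))) \<le> (\<Sum>p\<in>P. exp (- (A - 1)) * exp (- real (idx p)))"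
    by (intro sum_mono term_le)
  also have "\<dots> = (\<Sum>i\<in>idx ` P. \<Sum>p | p \<in> P \<and> idx p = i. exp (- (A - 1)) * exp (- real (idx p)))"
    by (rule sum.image_gen[OF P(1)])
  also have "\<dots> = (\<Sum>i\<in>idx ` P. real (card {p \<in> P. idx p = i}) * (exp (- (A - 1)) * exp (- real i)))"
    by simp
  also have "\<dots> \<le> (\<Sum>i\<in>idx ` P. (C * exp (real i / 2)) * (exp (- (A - 1)) * exp (- real i)))"
    by (intro sum_mono mult_right_mono shell) auto
  also have "\<dots> = (\<Sum>i\<in>idx ` P. (exp (- (A - 1)) * C) * q ^ i)"
  proof (rule sum.cong[OF refl])
    fix i
    have "exp (real i / 2) * exp (- real i) = q ^ i"
      by (simp add: q_def exp_add[symmetric] exp_of_nat_mult[symmetric])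
    then have "C * exp (- (A - 1)) * (exp (real i / 2) * exp (- real i)) = C * exp (- (A - 1)) * q ^ i"
      by (simp only:)
    then show "(C * exp (real i / 2)) * (exp (- (A - 1)) * exp (- real i)) = (exp (- (A - 1)) * C) * q ^ i"
      by (simp only: mult_ac)
  qed
  also have "\<dots> = exp (- (A - 1)) * C * (\<Sum>i\<in>idx ` P. q ^ i)"
    by (simp add: sum_distrib_left)
  also have "\<dots> \<le> exp (- (A - 1)) * C * (\<Sum>i. q ^ i)"
    using q C P(1) by (intro mult_left_mono sum_le_suminf summable_geometric) auto
  also have "(\<Sum>i. q ^ i) = 1 / (1 - q)"
    using q by (intro suminf_geometric) auto
  finally show ?thesis by (simp add: packing_const_def C_def q_def D_def mult_ac)
qed

section \<open>Inner products of antipodally separated points\<close>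

lemma sin_ge_half:
  fixes x :: real
  assumes "0 \<le> x" "x \<le> pi / 3"
  shows "x / 2 \<le> sin x"
proof -
  have "(\<lambda>t. sin t - t / 2) 0 \<le> (\<lambda>t. sin t - t / 2) x"
  proof (rule DERIV_nonneg_imp_nondecreasing[OF assms(1)])
    fix t assume t: "0 \<le> t" "t \<le> x"
    have "((\<lambda>t. sin t - t / 2) has_real_derivative cos t - 1 / 2) (at t)"
      by (auto intro!: derivative_eq_intros)
    moreover have "cos (pi / 3) \<le> cos t"
      using t assms by (intro cos_monotone_0_pi_le) auto
    ultimately show "\<exists>y. ((\<lambda>t. sin t - t / 2) has_real_derivative y) (at t) \<and> 0 \<le> y"
      by (auto simp: cos_60)
  qed
  then show ?thesis by simp
qed

text \<open>The constant is 2 (1/4)^2: \<open>sin_ge_half\<close> at h/2 in the half-angle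
  formula.\<close>

lemma cos_le_quadratic:
  fixes h :: real
  assumes "0 \<le> h" "h \<le> pi / 2"
  shows "cos h \<le> 1 - h\<^sup>2 / 8"
proof -
  have "(h / 2 / 2)\<^sup>2 \<le> (sin (h / 2))\<^sup>2"
    using assms sin_ge_half[of "h / 2"] by (intro power_mono) auto
  moreover have "cos h = 1 - 2 * (sin (h / 2))\<^sup>2"
    using cos_double_sin[of "h / 2"] by simp
  ultimately show ?thesis by (simp add: power_divide)
qed

lemma cos_ge_quadratic: "1 - h\<^sup>2 / 2 \<le> cos (h::real)"
proof -
  have "(sin (h / 2))\<^sup>2 \<le> (h / 2)\<^sup>2"
    by (subst abs_le_square_iff[symmetric]) (rule abs_sin_x_le_abs_x)
  moreover have "cos h = 1 - 2 * (sin (h / 2))\<^sup>2"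
    using cos_double_sin[of "h / 2"] by simp
  ultimately show ?thesis by (simp add: power_divide)
qed

lemma abs_inner_le_one: "norm x = 1 \<Longrightarrow> norm y = 1 \<Longrightarrow> \<bar>x \<bullet> y\<bar> \<le> 1"
  using Cauchy_Schwarz_ineq2[of x y] by simp

lemma antipodal_separation_le:
  fixes \<theta> :: "nat \<Rightarrow> 'a::euclidean_space"
  assumes "i \<in> {1..n}" "j \<in> {1..n}" "i \<noteq> j"
  shows "antipodal_separation n \<theta> \<le> arccos (\<theta> i \<bullet> \<theta> j)"
    and "antipodal_separation n \<theta> \<le> arccos (- (\<theta> i \<bullet> \<theta> j))"
proof -
  let ?f = "\<lambda>(i, j). min (geodesic_dist (\<theta> i) (\<theta> j)) (geodesic_dist (\<theta> i) (- \<theta> j))"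
  let ?S = "{min (geodesic_dist (\<theta> i) (\<theta> j)) (geodesic_dist (\<theta> i) (- \<theta> j)) | i j.
            i \<in> {1..n} \<and> j \<in> {1..n} \<and> i \<noteq> j}"
  have "?S \<subseteq> ?f ` ({1..n} \<times> {1..n})" by auto
  then have "finite ?S" by (rule finite_subset) simp
  moreover have "min (geodesic_dist (\<theta> i) (\<theta> j)) (geodesic_dist (\<theta> i) (- \<theta> j)) \<in> ?S"
    using assms by blast
  ultimately have "antipodal_separation n \<theta> \<le> min (geodesic_dist (\<theta> i) (\<theta> j)) (geodesic_dist (\<theta> i) (- \<theta> j))"
    unfolding antipodal_separation_def by (rule Min_le)
  then show "antipodal_separation n \<theta> \<le> arccos (\<theta> i \<bullet> \<theta> j)"
    "antipodal_separation n \<theta> \<le> arccos (- (\<theta> i \<bullet> \<theta> j))"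
    by (simp_all add: geodesic_dist_def)
qed

locale antipodal_set =
  fixes n :: nat and \<theta> :: "nat \<Rightarrow> 'a::euclidean_space"
  assumes n2: "n \<ge> 2" and unit: "\<And>j. j \<in> {1..n} \<Longrightarrow> norm (\<theta> j) = 1"
    and sep: "antipodal_separation n \<theta> > 0"
begin

abbreviation "h \<equiv> antipodal_separation n \<theta>"

text \<open>The distances from one point to another and to its antipode add up to pi, so one of them
  is at most pi/2.\<close>

lemma h_le: "h \<le> pi / 2"
proof -
  have 12: "1 \<in> {1..n}" "2 \<in> {1..n}" "(1::nat) \<noteq> 2" using n2 by auto
  have "\<bar>\<theta> 1 \<bullet> \<theta> 2\<bar> \<le> 1" by (intro abs_inner_le_one unit 12)
  then have "arccos (- (\<theta> 1 \<bullet> \<theta> 2)) = pi - arccos (\<theta> 1 \<bullet> \<theta> 2)" by (intro arccos_minus) auto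
  then show ?thesis using antipodal_separation_le[OF 12, of \<theta>] by linarith
qed

lemma h_sq_le: "h\<^sup>2 \<le> 4"
proof -
  have "h \<le> 2" using h_le pi_half_less_two by linarith
  then have "h\<^sup>2 \<le> 2\<^sup>2" using sep by (intro power_mono) auto
  then show ?thesis by simp
qed

lemma abs_inner_le:
  assumes "i \<in> {1..n}" "j \<in> {1..n}" "i \<noteq> j"
  shows "\<bar>\<theta> i \<bullet> \<theta> j\<bar> \<le> 1 - h\<^sup>2 / 8"
proof -
  have b: "\<bar>\<theta> i \<bullet> \<theta> j\<bar> \<le> 1" by (intro abs_inner_le_one unit assms)
  have "cos (arccos c) \<le> cos h" if "h \<le> arccos c" "\<bar>c\<bar> \<le> 1" for c
    using that sep arccos_ubound[of c] by (intro cos_monotone_0_pi_le) auto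
  from this[OF antipodal_separation_le(1)[OF assms, of \<theta>]] this[OF antipodal_separation_le(2)[OF assms, of \<theta>]]
  have "\<bar>\<theta> i \<bullet> \<theta> j\<bar> \<le> cos h" using b by (simp add: abs_le_iff)
  also have "cos h \<le> 1 - h\<^sup>2 / 8" using sep h_le by (intro cos_le_quadratic) auto
  finally show ?thesis .
qed

end

lemma norm_diff_unit_sq:
  fixes x y :: "'a::real_inner"
  shows "norm x = 1 \<Longrightarrow> norm y = 1 \<Longrightarrow> (dist x y)\<^sup>2 = 2 - 2 * (x \<bullet> y)"
  by (simp add: dist_norm power2_norm_eq_inner inner_diff norm_eq_1 inner_commute)

text \<open>Chooses from the antipodal pair the point in the closed hemisphere around \<eta>. This
  turns absolute inner products with \<eta> into Euclidean distances, and antipodal separation into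
  ordinary separation.\<close>

definition align :: "'a::real_inner \<Rightarrow> 'a \<Rightarrow> 'a" where
  "align \<eta> x = (if \<eta> \<bullet> x \<ge> 0 then x else - x)"

lemma norm_align [simp]: "norm (align \<eta> x) = norm x"
  by (simp add: align_def)

lemma dist_align_sq:
  "norm \<eta> = 1 \<Longrightarrow> norm x = 1 \<Longrightarrow> (dist \<eta> (align \<eta> x))\<^sup>2 = 2 - 2 * \<bar>\<eta> \<bullet> x\<bar>"
  using norm_diff_unit_sq[of \<eta> "align \<eta> x"] by (simp add: align_def split: if_splits)

context antipodal_set
begin

lemma dist_align:
  assumes "i \<in> {1..n}" "j \<in> {1..n}" "i \<noteq> j"
  shows "h / 2 \<le> dist (align \<eta> (\<theta> i)) (align \<eta> (\<theta> j))"
proof (rule power2_le_imp_le)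
  have "align \<eta> (\<theta> i) \<bullet> align \<eta> (\<theta> j) \<le> \<bar>\<theta> i \<bullet> \<theta> j\<bar>" by (auto simp: align_def)
  also have "\<dots> \<le> 1 - h\<^sup>2 / 8" using assms by (rule abs_inner_le)
  finally show "(h / 2)\<^sup>2 \<le> (dist (align \<eta> (\<theta> i)) (align \<eta> (\<theta> j)))\<^sup>2"
    using norm_diff_unit_sq[of "align \<eta> (\<theta> i)" "align \<eta> (\<theta> j)"] unit assms by (simp add: power_divide)
qed simp

text \<open>For aligned unit vectors the absolute inner product is 1 - dist^2/2, so its l-th power
  is dominated by a Gaussian. The aligned points are h/2 separated, and the hypothesis on
  \<open>J\<close> says that they are at least h/4 away from \<eta>: the two distances that the
  packing bound wants for \<delta> = h/2.\<close>

lemma packing_power_sum: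
  assumes A: "A \<ge> 1" and l: "real l * h\<^sup>2 \<ge> 32 * A" and \<eta>: "norm \<eta> = 1" and J: "J \<subseteq> {1..n}"
    and far: "\<And>j. j \<in> J \<Longrightarrow> \<bar>\<eta> \<bullet> \<theta> j\<bar> \<le> 1 - h\<^sup>2 / 32"
  shows "(\<Sum>j\<in>J. \<bar>\<eta> \<bullet> \<theta> j\<bar> ^ l) \<le> packing_const DIM('a) * exp (- (A - 1))"
proof -
  define p where "p j = align \<eta> (\<theta> j)" for j
  have J': "j \<in> {1..n}" if "j \<in> J" for j using that J by auto
  have pd: "(dist \<eta> (p j))\<^sup>2 = 2 - 2 * \<bar>\<eta> \<bullet> \<theta> j\<bar>" if "j \<in> J" for j
    unfolding p_def by (rule dist_align_sq[OF \<eta> unit[OF J'[OF that]]])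
  have pp: "h / 2 \<le> dist (p i) (p j)" if "i \<in> J" "j \<in> J" "i \<noteq> j" for i j
    unfolding p_def using that J' by (intro dist_align) auto
  have inj: "inj_on p J"
  proof (rule inj_onI, rule ccontr)
    fix i j assume "i \<in> J" "j \<in> J" "p i = p j" "i \<noteq> j"
    then show False using pp[of i j] sep by simp
  qed
  have "(\<Sum>j\<in>J. \<bar>\<eta> \<bullet> \<theta> j\<bar> ^ l) \<le> (\<Sum>j\<in>J. exp (- (real l * (dist \<eta> (p j))\<^sup>2 / 2)))"
  proof (rule sum_mono)
    fix j assume j: "j \<in> J"
    have "\<bar>\<eta> \<bullet> \<theta> j\<bar> = 1 + - ((dist \<eta> (p j))\<^sup>2 / 2)" using pd[OF j] by linarith
    also have "\<dots> \<le> exp (- ((dist \<eta> (p j))\<^sup>2 / 2))" by (rule exp_ge_add_one_self)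
    finally have "\<bar>\<eta> \<bullet> \<theta> j\<bar> ^ l \<le> exp (- ((dist \<eta> (p j))\<^sup>2 / 2)) ^ l" by (intro power_mono) auto
    then show "\<bar>\<eta> \<bullet> \<theta> j\<bar> ^ l \<le> exp (- (real l * (dist \<eta> (p j))\<^sup>2 / 2))"
      by (simp add: exp_of_nat_mult[symmetric])
  qed
  also have "\<dots> = (\<Sum>x\<in>p ` J. exp (- (real l * (dist \<eta> x)\<^sup>2 / 2)))"
    by (simp add: sum.reindex[OF inj])
  also have "\<dots> \<le> packing_const DIM('a) * exp (- (A - 1))"
  proof (rule gaussian_packing_sum[where \<delta> = "h / 2"])
    show "8 * A \<le> real l * (h / 2)\<^sup>2" using l by (simp add: power_divide)
    show "h / 2 \<le> dist x y" if "x \<in> p ` J" "y \<in> p ` J" "x \<noteq> y" for x y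
      using that pp by auto
    show "h / 2 / 2 \<le> dist \<eta> x" if x: "x \<in> p ` J" for x
    proof (rule power2_le_imp_le)
      obtain j where j: "j \<in> J" "x = p j" using x by auto
      show "(h / 2 / 2)\<^sup>2 \<le> (dist \<eta> x)\<^sup>2"
        using far[OF j(1)] j(2) pd[OF j(1)] by (simp add: power_divide)
    qed simp
  qed (use finite_subset[OF J] sep A in auto)
  finally show ?thesis .
qed

lemma packing_gram:
  assumes "real l * h\<^sup>2 \<ge> 32 * (1 + 2 * packing_const DIM('a))" "i \<in> {1..n}"
  shows "(\<Sum>j\<in>{1..n} - {i}. \<bar>\<theta> i \<bullet> \<theta> j\<bar> ^ l) \<le> 1 / 2"
proof -
  define K where "K = packing_const DIM('a)"
  have K: "K > 0" by (simp add: K_def packing_const_pos)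
  \<comment> \<open>With A = 1 + 2K the bound is K exp (-2K), which is at most 1/2.\<close>
  have "(\<Sum>j\<in>{1..n} - {i}. \<bar>\<theta> i \<bullet> \<theta> j\<bar> ^ l) \<le> packing_const DIM('a) * exp (- ((1 + 2 * K) - 1))"
  proof (rule packing_power_sum)
    show "\<bar>\<theta> i \<bullet> \<theta> j\<bar> \<le> 1 - h\<^sup>2 / 32" if "j \<in> {1..n} - {i}" for j
      using abs_inner_le[of i j] that assms(2) zero_le_power2[of h] by fastforce
  qed (use assms K in \<open>auto simp: K_def intro: unit\<close>)
  also have "\<dots> \<le> 1 / 2"
  proof -
    have "2 * K \<le> exp (2 * K)" using exp_ge_add_one_self[of "2 * K"] by linarith
    then show ?thesis by (simp add: K_def[symmetric] exp_minus field_simps)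
  qed
  finally show ?thesis .
qed

end

text \<open>Averaging instead of cap volumes: for l of order h^(-2) the sum of the l-th powers is
  bounded at every point of the sphere, while its integral is n times a moment of order at least
  l^(-d/2), d being one less than the dimension.\<close>

lemma separation_card_bound:
  "\<exists>C>0. \<forall>n (\<theta> :: nat \<Rightarrow> 'a::euclidean_space). antipodal_set n \<theta> \<longrightarrow>
    real n \<le> C * antipodal_separation n \<theta> powr (- (real DIM('a) - 1))"
proof -
  define K where "K = packing_const DIM('a)"
  have K: "K > 0" by (simp add: K_def packing_const_pos)
  define s where "s = (real DIM('a) - 1) / 2"
  have s: "s \<ge> 0" using DIM_positive[where 'a='a] by (simp add: s_def Suc_leI)
  obtain c where c: "c > 0" "\<And>l. l \<ge> 1 \<Longrightarrow> c * real l powr (- s) \<le> sphere_moment TYPE('a) l"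
    using sphere_moment_lower[where 'a='a] unfolding s_def by blast
  define C where "C = (1 + K) / c * 36 powr s"
  have "C > 0" using K c by (simp add: C_def add_pos_pos)
  moreover have "real n \<le> C * antipodal_separation n \<theta> powr (- (real DIM('a) - 1))"
    if "antipodal_set n \<theta>" for n and \<theta> :: "nat \<Rightarrow> 'a"
  proof -
    interpret antipodal_set n \<theta> by fact
    \<comment> \<open>Meets the requirement of \<open>packing_power_sum\<close> for A = 1.\<close>
    define l where "l = nat \<lceil>32 / h\<^sup>2\<rceil>"
    have h2: "h\<^sup>2 > 0" using sep by simp
    have l1: "32 / h\<^sup>2 \<le> real l" unfolding l_def by linarith
    have l2: "real l \<le> 32 / h\<^sup>2 + 1"
      unfolding l_def using h2 by (simp add: of_nat_nat) 
    have "0 < 32 / h\<^sup>2" using h2 by simp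
    then have l_pos: "l \<ge> 1" using l1 by (cases l) auto
    have lh: "real l * h\<^sup>2 \<ge> 32 * 1" using l1 h2 by (simp add: field_simps)
    have bound: "(\<Sum>j\<in>{1..n}. \<bar>\<theta> j \<bullet> \<eta>\<bar> ^ l) \<le> 1 + K" if \<eta>: "norm \<eta> = 1" for \<eta>
    proof -
      define J where "J = {j \<in> {1..n}. \<bar>\<eta> \<bullet> \<theta> j\<bar> \<le> 1 - h\<^sup>2 / 32}"
      define N where "N = {1..n} - J"
      have "card N \<le> 1"
      proof (rule ccontr)
        \<comment> \<open>Two exceptional points would both align within h/4 of \<eta>, against
          their separation h/2.\<close>
        assume "\<not> card N \<le> 1"
        then obtain i j where ij: "i \<in> N" "j \<in> N" "i \<noteq> j"
          using card_le_Suc0_iff_eq[of N] by (auto simp: N_def)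
        have close: "dist \<eta> (align \<eta> (\<theta> j)) < h / 4" if "j \<in> N" for j
        proof -
          have j: "j \<in> {1..n}" "\<bar>\<eta> \<bullet> \<theta> j\<bar> > 1 - h\<^sup>2 / 32" using that by (auto simp: N_def J_def)
          then have "(dist \<eta> (align \<eta> (\<theta> j)))\<^sup>2 < (h / 4)\<^sup>2"
            using dist_align_sq[OF \<eta> unit[OF j(1)]] by (simp add: power_divide)
          then show ?thesis by (rule power2_less_imp_less) (use sep in simp)
        qed
        have "dist (align \<eta> (\<theta> i)) (align \<eta> (\<theta> j)) < h / 2"
          using close[OF ij(1)] close[OF ij(2)]
            dist_triangle2[of "align \<eta> (\<theta> i)" "align \<eta> (\<theta> j)" \<eta>] by (simp add: dist_commute)
        moreover have "h / 2 \<le> dist (align \<eta> (\<theta> i)) (align \<eta> (\<theta> j))"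
          using ij by (intro dist_align) (auto simp: N_def)
        ultimately show False by simp
      qed
      have "(\<Sum>j\<in>{1..n}. \<bar>\<theta> j \<bullet> \<eta>\<bar> ^ l) = (\<Sum>j\<in>J. \<bar>\<eta> \<bullet> \<theta> j\<bar> ^ l) + (\<Sum>j\<in>N. \<bar>\<eta> \<bullet> \<theta> j\<bar> ^ l)"
      proof -
        have "J \<subseteq> {1..n}" by (auto simp: J_def)
        then show ?thesis
          unfolding N_def using sum.subset_diff[of J "{1..n}" "\<lambda>j. \<bar>\<eta> \<bullet> \<theta> j\<bar> ^ l"]
          by (simp add: inner_commute)
      qed
      also have "(\<Sum>j\<in>J. \<bar>\<eta> \<bullet> \<theta> j\<bar> ^ l) \<le> K * exp (- (1 - 1))"
        unfolding K_def by (rule packing_power_sum) (use lh \<eta> in \<open>auto simp: J_def\<close>)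
      also have "(\<Sum>j\<in>N. \<bar>\<eta> \<bullet> \<theta> j\<bar> ^ l) \<le> (\<Sum>j\<in>N. 1)"
        by (intro sum_mono power_le_one abs_inner_le_one \<eta> unit) (auto simp: N_def)
      also have "(\<Sum>j\<in>N. 1) \<le> (1::real)" using \<open>card N \<le> 1\<close> by simp
      finally show ?thesis by simp
    qed
    have "real n * sphere_moment TYPE('a) l = (\<Sum>j\<in>{1..n}. LINT \<eta>|sphere_measure. \<bar>\<theta> j \<bullet> \<eta>\<bar> ^ l)"
    proof -
      have "(LINT \<eta>|sphere_measure. \<bar>\<theta> j \<bullet> \<eta>\<bar> ^ l) = sphere_moment TYPE('a) l" if "j \<in> {1..n}" for j
      proof -
        have "\<theta> j \<noteq> 0" using unit[OF that] by auto
        then show ?thesis using integral_sphere_abs_power[of "\<theta> j" l] unit[OF that] by simp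
      qed
      then show ?thesis by simp
    qed
    also have "\<dots> = (LINT \<eta>|sphere_measure. (\<Sum>j\<in>{1..n}. \<bar>\<theta> j \<bullet> \<eta>\<bar> ^ l))"
      by (rule Bochner_Integration.integral_sum[symmetric])
        (intro integrable_sphere_continuous continuous_intros)
    also have "\<dots> \<le> (LINT \<eta>|(sphere_measure :: 'a measure). 1 + K)"
      by (rule integral_mono) (use bound in \<open>auto intro!: integrable_sphere_continuous continuous_intros\<close>)
    finally have "real n * sphere_moment TYPE('a) l \<le> 1 + K" by simp
    moreover have "real n * (c * real l powr (- s)) \<le> real n * sphere_moment TYPE('a) l"
      using c(2)[OF l_pos] by (intro mult_left_mono) auto
    ultimately have "real n * (c * real l powr (- s)) \<le> 1 + K" by linarith
    then have "real n \<le> (1 + K) / c * real l powr s"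
      using c(1) l_pos by (simp add: powr_minus field_simps)
    also have "\<dots> \<le> (1 + K) / c * (36 / h\<^sup>2) powr s"
    proof (intro mult_left_mono powr_mono2)
      \<comment> \<open>The 1 lost in rounding \<open>l\<close> up is paid by h^2 \<le> 4, hence 36
        = 32 + 4.\<close>
      have "1 \<le> 4 / h\<^sup>2" using h_sq_le h2 by (simp add: field_simps)
      then show "real l \<le> 36 / h\<^sup>2" using l2 by (simp add: field_simps)
    qed (use s K c in auto)
    also have "(36 / h\<^sup>2) powr s = 36 powr s * h powr (- (real DIM('a) - 1))"
    proof -
      have "(h\<^sup>2) powr s = (h powr 2) powr s" using sep by (subst powr_numeral) auto
      also have "\<dots> = h powr (2 * s)" by (simp only: powr_powr)
      also have "2 * s = real DIM('a) - 1" by (simp add: s_def)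
      finally have "(h\<^sup>2) powr s = h powr (real DIM('a) - 1)" .
      moreover have "(36 / h\<^sup>2) powr s = 36 powr s / (h\<^sup>2) powr s"
        by (rule powr_divide)
      ultimately show ?thesis
        using powr_minus[of h "real DIM('a) - 1"] by (simp add: divide_inverse)
    qed
    finally show ?thesis by (simp add: C_def mult.assoc)
  qed
  ultimately show ?thesis by blast
qed

lemma fill_distance_witness:
  fixes \<theta> :: "nat \<Rightarrow> 'a::euclidean_space"
  assumes n: "n \<ge> 1" and unit: "\<And>j. j \<in> {1..n} \<Longrightarrow> norm (\<theta> j) = 1" and \<eta>: "norm \<eta> = 1"
  shows "\<exists>j\<in>{1..n}. arccos (\<eta> \<bullet> \<theta> j) \<le> fill_distance n \<theta>"
proof -
  let ?m = "\<lambda>\<eta>. Min ((\<lambda>j. geodesic_dist \<eta> (\<theta> j)) ` {1..n})"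
  have ne: "(\<lambda>j. geodesic_dist x (\<theta> j)) ` {1..n} \<noteq> {}" for x using n by simp
  have "?m \<eta> \<le> fill_distance n \<theta>"
    unfolding fill_distance_def
  proof (rule cSUP_upper)
    show "bdd_above (?m ` sphere 0 1)"
    proof (rule bdd_aboveI2)
      fix x :: 'a assume "x \<in> sphere 0 1"
      then have "\<bar>x \<bullet> \<theta> 1\<bar> \<le> 1" using n by (intro abs_inner_le_one unit) auto
      then have "geodesic_dist x (\<theta> 1) \<le> pi"
        unfolding geodesic_dist_def by (intro arccos_ubound) auto
      moreover have "?m x \<le> geodesic_dist x (\<theta> 1)" using n by (intro Min_le) auto
      ultimately show "?m x \<le> pi" by linarith
    qed
  qed (use \<eta> in simp)
  moreover have "?m \<eta> \<in> (\<lambda>j. geodesic_dist \<eta> (\<theta> j)) ` {1..n}"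
    by (rule Min_in[OF _ ne]) simp
  ultimately show ?thesis by (auto simp: geodesic_dist_def)
qed

text \<open>The averaging argument in the other direction. If the points covered too finely, then at
  every \<eta> one of the l-th powers would be at least 1/2, for l of order n^(2/d); integrating, n
  times the moment would be at least 1/2, but \<open>l\<close> is chosen to make it at most
  1/4.\<close>

lemma fill_distance_lower:
  assumes D: "DIM('a::euclidean_space) = d + 1" and d: "d \<ge> 1"
  shows "\<exists>c>0. \<forall>n\<ge>1. \<forall>\<theta> :: nat \<Rightarrow> 'a. (\<forall>j\<in>{1..n}. norm (\<theta> j) = 1) \<longrightarrow>
    c * real n powr (- (1 / real d)) \<le> fill_distance n \<theta>"
proof -
  obtain C where C: "C > 0" "\<And>l. l \<ge> 1 \<Longrightarrow> sphere_moment TYPE('a) l \<le> C * real l powr (- (real d / 2))"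
    using sphere_moment_upper[where 'a='a] D by auto
  \<comment> \<open>Solves n C (B N)^(-d/2) = 1/4 for N = n^(2/d).\<close>
  define B where "B = (4 * C) powr (2 / real d)"
  have B: "B > 0" using C by (simp add: B_def)
  \<comment> \<open>As l \<le> B N + 1 \<le> (B + 1) N, this c gives l H^2 \<le> 1.\<close>
  define c where "c = 1 / sqrt (B + 1)"
  have c: "c > 0" "c \<le> 1" "c\<^sup>2 = 1 / (B + 1)" using B by (auto simp: c_def power_divide)
  have "c * real n powr (- (1 / real d)) \<le> fill_distance n \<theta>"
    if n: "n \<ge> 1" and unit: "\<forall>j\<in>{1..n}. norm (\<theta> j) = 1" for n and \<theta> :: "nat \<Rightarrow> 'a"
  proof (rule ccontr)
    assume less: "\<not> ?thesis"
    define H where "H = fill_distance n \<theta>"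
    have H: "H < c * real n powr (- (1 / real d))" using less by (simp add: H_def)
    define N where "N = real n powr (2 / real d)"
    have N: "N \<ge> 1" using n d by (simp add: N_def ge_one_powr_ge_zero)
    define l where "l = nat \<lceil>B * N\<rceil>"
    have l1: "B * N \<le> real l" unfolding l_def by linarith
    have l2: "real l \<le> B * N + 1" unfolding l_def using B N by (simp add: of_nat_nat)
    have l_pos: "l \<ge> 1" using l1 B N by (cases l) (auto simp: mult_le_0_iff)
    have witness: "\<exists>j\<in>{1..n}. arccos (\<eta> \<bullet> \<theta> j) \<le> H" if "norm \<eta> = 1" for \<eta>
      unfolding H_def using n unit that by (intro fill_distance_witness) auto
    have H0: "H \<ge> 0"
    proof -
      have t1: "norm (\<theta> 1) = 1" using unit n by auto
      obtain j where j: "j \<in> {1..n}" "arccos (\<theta> 1 \<bullet> \<theta> j) \<le> H" using witness[OF t1] by auto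
      have "\<bar>\<theta> 1 \<bullet> \<theta> j\<bar> \<le> 1" using t1 unit j by (intro abs_inner_le_one) auto
      then show ?thesis using j(2) arccos_lbound[of "\<theta> 1 \<bullet> \<theta> j"] by linarith
    qed
    have cN: "(c * real n powr (- (1 / real d)))\<^sup>2 = 1 / (B + 1) / N"
    proof -
      have "(real n powr (- (1 / real d)))\<^sup>2 = (real n powr (- (1 / real d))) powr 2"
        using n by (subst powr_numeral) auto
      also have "\<dots> = inverse N" by (simp add: powr_powr N_def powr_minus[symmetric])
      finally show ?thesis using c(3) by (simp add: power_mult_distrib divide_inverse)
    qed
    have H2: "H\<^sup>2 \<le> 1 / (B + 1) / N"
      using H H0 power_mono[of H "c * real n powr (- (1 / real d))" 2] cN by simp
    have lH: "real l * H\<^sup>2 \<le> 1"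
    proof -
      have "real l * H\<^sup>2 \<le> ((B + 1) * N) * (1 / (B + 1) / N)"
        using l2 N H2 by (intro mult_mono) (auto simp: algebra_simps)
      also have "\<dots> = 1" using B N by simp
      finally show ?thesis .
    qed
    have H1: "H \<le> 1"
    proof -
      have "0 \<le> B * N" using B N by simp
      then have "1 \<le> (B + 1) * N" using N by (simp only: distrib_right)
      then have "1 / ((B + 1) * N) \<le> 1" by (subst divide_le_eq_1_pos) linarith+
      then have "1 / (B + 1) / N \<le> 1" by simp
      then have "H\<^sup>2 \<le> 1\<^sup>2" using H2 by simp
      then show ?thesis by (rule power2_le_imp_le) simp
    qed
    have ge: "1 / 2 \<le> (\<Sum>j\<in>{1..n}. \<bar>\<theta> j \<bullet> \<eta>\<bar> ^ l)" if \<eta>: "norm \<eta> = 1" for \<eta>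
    proof -
      obtain j where j: "j \<in> {1..n}" "arccos (\<eta> \<bullet> \<theta> j) \<le> H" using witness[OF \<eta>] by auto
      have b: "\<bar>\<eta> \<bullet> \<theta> j\<bar> \<le> 1" using \<eta> unit j by (intro abs_inner_le_one) auto
      have "1 - H\<^sup>2 / 2 \<le> cos H" by (rule cos_ge_quadratic)
      also have "\<dots> \<le> cos (arccos (\<eta> \<bullet> \<theta> j))"
        using j(2) b H1 pi_ge_two by (intro cos_monotone_0_pi_le) (auto intro: arccos_lbound)
      also have "\<dots> = \<eta> \<bullet> \<theta> j" using b by (intro cos_arccos) auto
      finally have c1: "1 - H\<^sup>2 / 2 \<le> \<eta> \<bullet> \<theta> j" .
      have H21: "H\<^sup>2 \<le> 1" using H1 H0 by (simp add: power_le_one)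
      have "1 / 2 \<le> 1 + real l * (- (H\<^sup>2 / 2))" using lH by simp
      also have "\<dots> \<le> (1 + - (H\<^sup>2 / 2)) ^ l" using H21 by (intro Bernoulli_inequality) auto
      also have "\<dots> \<le> \<bar>\<theta> j \<bullet> \<eta>\<bar> ^ l" using c1 H21 by (intro power_mono) (auto simp: inner_commute)
      also have "\<dots> \<le> (\<Sum>j\<in>{1..n}. \<bar>\<theta> j \<bullet> \<eta>\<bar> ^ l)" using j(1) by (intro member_le_sum) auto
      finally show ?thesis .
    qed
    have "(LINT \<eta>|(sphere_measure :: 'a measure). 1 / 2) \<le> (LINT \<eta>|sphere_measure. (\<Sum>j\<in>{1..n}. \<bar>\<theta> j \<bullet> \<eta>\<bar> ^ l))"
      by (rule integral_mono) (use ge in \<open>auto intro!: integrable_sphere_continuous continuous_intros\<close>)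
    also have "\<dots> = (\<Sum>j\<in>{1..n}. LINT \<eta>|sphere_measure. \<bar>\<theta> j \<bullet> \<eta>\<bar> ^ l)"
      by (rule Bochner_Integration.integral_sum) (intro integrable_sphere_continuous continuous_intros)
    also have "\<dots> = real n * sphere_moment TYPE('a) l"
    proof -
      have "(LINT \<eta>|sphere_measure. \<bar>\<theta> j \<bullet> \<eta>\<bar> ^ l) = sphere_moment TYPE('a) l" if "j \<in> {1..n}" for j
      proof -
        have n1: "norm (\<theta> j) = 1" using unit that by blast
        then have "\<theta> j \<noteq> 0" by auto
        with n1 show ?thesis using integral_sphere_abs_power[of "\<theta> j" l] by simp
      qed
      then show ?thesis by simp
    qed
    also have "\<dots> \<le> real n * (C * real l powr (- (real d / 2)))"
      using C(2)[OF l_pos] by (intro mult_left_mono) auto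
    also have "\<dots> \<le> real n * (C * (B * N) powr (- (real d / 2)))"
      using C(1) l1 B N by (intro mult_left_mono powr_mono2') auto
    also have "(B * N) powr (- (real d / 2)) = 1 / (4 * C * real n)"
    proof -
      have "(B * N) powr (real d / 2) = B powr (real d / 2) * N powr (real d / 2)"
        by (rule powr_mult)
      also have "B powr (real d / 2) = 4 * C"
        unfolding B_def powr_powr using C(1) d by simp
      also have "N powr (real d / 2) = real n"
        unfolding N_def powr_powr using d by simp
      finally have "(B * N) powr (real d / 2) = 4 * C * real n" .
      then show ?thesis by (simp only: powr_minus divide_inverse mult_1_left)
    qed
    also have "real n * (C * (1 / (4 * C * real n))) = 1 / 4"
      using C(1) n by simp
    finally show False by simp
  qed
  with c(1) show ?thesis by blast
qed

section \<open>The test function\<close>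

lemma homogeneous_harmonic_polynomial_cmult:
  assumes "homogeneous_harmonic_polynomial m p"
  shows "homogeneous_harmonic_polynomial m (\<lambda>x. c * p x)"
  using assms unfolding homogeneous_harmonic_polynomial_def
  by (auto simp: laplacian_cmult intro!: real_polynomial_function.intros(2,4))

lemma homogeneous_harmonic_polynomial_sum:
  fixes F :: "'i \<Rightarrow> 'a::euclidean_space \<Rightarrow> real"
  assumes "finite I" "\<And>i. i \<in> I \<Longrightarrow> homogeneous_harmonic_polynomial m (F i)"
  shows "homogeneous_harmonic_polynomial m (\<lambda>x. \<Sum>i\<in>I. F i x)"
  using assms unfolding homogeneous_harmonic_polynomial_def
  by (auto simp: laplacian_sum sum_distrib_left intro!: real_polynomial_function_sum)

lemma homogeneous_harmonic_polynomial_L2: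
  "homogeneous_harmonic_polynomial m p \<Longrightarrow> p \<in> L2_sphere"
  by (intro continuous_L2_sphere)
    (auto simp: homogeneous_harmonic_polynomial_def intro: continuous_real_polynomial_function)

text \<open>\<open>zonal_inversion\<close> is applied to the powers of \<theta> i \<bullet> \<eta>;
  since its weights depend on neither i nor \<eta>, the components are genuine harmonic
  polynomials.\<close>

lemma power_harmonic_decomposition:
  fixes \<theta> :: "'i \<Rightarrow> 'a::euclidean_space"
  assumes "finite I" "\<And>i. i \<in> I \<Longrightarrow> norm (\<theta> i) = 1"
  shows "\<exists>u. (\<forall>m. homogeneous_harmonic_polynomial m (u m)) \<and>
    (\<forall>\<eta>. norm \<eta> = 1 \<longrightarrow> (\<Sum>m | m \<le> l \<and> even (l + m). u m \<eta>) = (\<Sum>i\<in>I. a i * (\<theta> i \<bullet> \<eta>) ^ l))"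
proof -
  obtain w where w: "\<And>F :: nat \<Rightarrow> real. F l = (\<Sum>m | m \<le> l \<and> even (l + m). w m *
      (\<Sum>j\<le>m div 2. zonal_coeff DIM('a) m j * F (m - 2 * j)))"
    using zonal_inversion[of l "DIM('a)"] by blast
  define u where "u m x = (\<Sum>i\<in>I. (a i * w m) * zonal m (\<lambda>e x. (\<theta> i \<bullet> x) ^ e) x)" for m x
  have "homogeneous_harmonic_polynomial m (u m)" for m
    unfolding u_def using assms
    by (intro homogeneous_harmonic_polynomial_sum homogeneous_harmonic_polynomial_cmult
      homogeneous_harmonic_polynomial_zonal inner_power_family) auto
  moreover have "(\<Sum>m | m \<le> l \<and> even (l + m). u m \<eta>) = (\<Sum>i\<in>I. a i * (\<theta> i \<bullet> \<eta>) ^ l)"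
    if "norm \<eta> = 1" for \<eta>
  proof -
    have "(\<Sum>m | m \<le> l \<and> even (l + m). u m \<eta>) =
        (\<Sum>i\<in>I. a i * (\<Sum>m | m \<le> l \<and> even (l + m). w m * zonal m (\<lambda>e x. (\<theta> i \<bullet> x) ^ e) \<eta>))"
      unfolding u_def by (subst sum.swap) (simp add: sum_distrib_left mult.assoc)
    also have "\<dots> = (\<Sum>i\<in>I. a i * (\<theta> i \<bullet> \<eta>) ^ l)"
      unfolding zonal_sphere[OF that] by (simp only: w[of "\<lambda>e. (\<theta> i \<bullet> \<eta>) ^ e" for i, symmetric])
    finally show ?thesis .
  qed
  ultimately show ?thesis by blast
qed

text \<open>The test function \<open>\<phi>\<close> is the preimage of \<open>\<Sum>i. a i * (\<theta> i \<bullet> \<eta>) ^ l\<close> under the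
  convolution with \<open>relu_pow k\<close>, computed degree by degree with the Funk-Hecke multipliers.\<close>

lemma test_function:
  fixes \<theta> :: "'i \<Rightarrow> 'a::euclidean_space" and k l :: nat
  defines "\<mu> \<equiv> (\<lambda>m. funk_hecke_coeff (\<lambda>k. sphere_moment TYPE('a) k / 2) m k)"
    and "\<nu> \<equiv> (\<lambda>m. funk_hecke_coeff (power_coeff TYPE('a)) m l)"
    and "S \<equiv> {m. m \<le> l \<and> even (l + m)}"
  assumes fin_I: "finite I" and unit_I: "\<forall>i\<in>I. norm (\<theta> i) = 1"
    and k: "k \<ge> 1" and l: "l \<ge> 1" and kl: "odd (k + l)"
  shows "\<exists>\<phi> u s. \<phi> \<in> L2_sphere \<and>
    (\<forall>i\<in>I. L2_inner (\<lambda>\<eta>. relu_pow k (\<theta> i \<bullet> \<eta>)) \<phi> = (\<Sum>j\<in>I. a j * (\<theta> i \<bullet> \<theta> j) ^ l)) \<and>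
    (L2_norm \<phi>)\<^sup>2 = (\<Sum>m\<in>S. \<nu> m * s m / (\<mu> m)\<^sup>2) \<and>
    (\<forall>f\<in>L2_sphere. L2_inner f \<phi> = (\<Sum>m\<in>S. L2_inner (harmonic_projection m f) (u m) / \<mu> m)) \<and>
    (\<forall>m\<in>S. (L2_norm (u m))\<^sup>2 = \<nu> m * s m) \<and> (\<forall>m. u m \<in> L2_sphere) \<and> (\<forall>m\<in>S. 0 \<le> s m) \<and>
    (\<Sum>m\<in>S. s m) = (\<Sum>i\<in>I. \<Sum>j\<in>I. a i * a j * (\<theta> i \<bullet> \<theta> j) ^ l)"
proof -
  have I: "finite I" "\<And>i. i \<in> I \<Longrightarrow> norm (\<theta> i) = 1" using fin_I unit_I by auto
  obtain u where u: "\<And>m. homogeneous_harmonic_polynomial m (u m)"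
    and usum: "\<And>\<eta>. norm \<eta> = 1 \<Longrightarrow> (\<Sum>m\<in>S. u m \<eta>) = (\<Sum>i\<in>I. a i * (\<theta> i \<bullet> \<eta>) ^ l)"
    using power_harmonic_decomposition[where I=I and \<theta>=\<theta> and l=l and a=a, OF I] unfolding S_def by blast
  have fin: "finite S" by (simp add: S_def)
  have solid: "solid_harmonic m (u m)" for m by (rule homogeneous_harmonic_polynomial_solid[OF u])
  have cu: "continuous_on A (u m)" for m A by (rule solid_harmonic_continuous[OF solid])
  have uL2: "u m \<in> L2_sphere" for m by (rule homogeneous_harmonic_polynomial_L2[OF u])
  have c_uL2: "(\<lambda>\<eta>. c * u m \<eta>) \<in> L2_sphere" for c m by (rule L2_sphere_cmult[OF uL2])
  \<comment> \<open>The share of degree \<open>m\<close> in the Gram form. It is nonnegative, since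
    \<nu>_m times it is a squared norm, so bounds on the multipliers, degree by degree, pass to the
    whole form.\<close>
  define s where "s m = (\<Sum>i\<in>I. a i * u m (\<theta> i))" for m
  define \<phi> where "\<phi> \<eta> = (\<Sum>m\<in>S. inverse (\<mu> m) * u m \<eta>)" for \<eta>
  have \<nu>: "\<nu> m > 0" if "m \<in> S" for m
    using that l unfolding \<nu>_def S_def by (intro power_coeff_bounds(1)) auto
  have \<mu>: "\<mu> m \<noteq> 0" if "m \<in> S" for m
  proof -
    have "odd (k + m)" using that kl by (auto simp: S_def)
    then show ?thesis unfolding \<mu>_def by (intro relu_coeff_nonzero k)
  qed
  have orth: "L2_inner (u m) (u m') = (if m = m' then (L2_norm (u m))\<^sup>2 else 0)" for m m'
    using solid_harmonic_orthogonal[OF solid solid, of m m'] by (simp add: L2_norm_sq)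
  \<comment> \<open>Orthogonality lets the full power sum stand in for one factor
    \<open>u m\<close>; Funk-Hecke then evaluates the other at the points.\<close>
  have norm_u: "(L2_norm (u m))\<^sup>2 = \<nu> m * s m" if "m \<in> S" for m
  proof -
    have "L2_inner (\<lambda>\<eta>. \<Sum>m'\<in>S. u m' \<eta>) (u m) = (\<Sum>m'\<in>S. L2_inner (u m') (u m))"
      by (rule L2_inner_sum_left) (auto simp: uL2)
    also have "\<dots> = (L2_norm (u m))\<^sup>2" using that fin by (simp add: orth)
    finally have "(L2_norm (u m))\<^sup>2 = L2_inner (\<lambda>\<eta>. \<Sum>m'\<in>S. u m' \<eta>) (u m)" by simp
    also have "\<dots> = L2_inner (\<lambda>\<eta>. \<Sum>i\<in>I. a i * (\<theta> i \<bullet> \<eta>) ^ l) (u m)"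
      by (rule L2_inner_cong_sphere) (auto simp: usum)
    also have "\<dots> = (\<Sum>i\<in>I. L2_inner (\<lambda>\<eta>. a i * (\<theta> i \<bullet> \<eta>) ^ l) (u m))"
      by (rule L2_inner_sum_left) (auto intro!: uL2 continuous_L2_sphere continuous_intros)
    also have "\<dots> = (\<Sum>i\<in>I. a i * (\<nu> m * u m (\<theta> i)))"
    proof (rule sum.cong[OF refl])
      fix i assume "i \<in> I"
      have "L2_inner (\<lambda>\<eta>. a i * (\<theta> i \<bullet> \<eta>) ^ l) (u m) = a i * power_transform (u m) l (\<theta> i)"
        unfolding L2_inner_cmult_left by (simp add: L2_inner_def power_transform_def mult.commute)
      then show "L2_inner (\<lambda>\<eta>. a i * (\<theta> i \<bullet> \<eta>) ^ l) (u m) = a i * (\<nu> m * u m (\<theta> i))"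
        using funk_hecke_power[OF solid I(2)[OF \<open>i \<in> I\<close>]] by (simp add: \<nu>_def)
    qed
    finally show ?thesis by (simp add: s_def sum_distrib_left mult_ac)
  qed
  have \<phi>L2: "\<phi> \<in> L2_sphere"
    unfolding \<phi>_def by (rule L2_sphere_sum) (rule c_uL2)
  have \<phi>_inner: "L2_inner f \<phi> = (\<Sum>m\<in>S. inverse (\<mu> m) * L2_inner f (u m))" if "f \<in> L2_sphere" for f
  proof -
    have "L2_inner \<phi> f = (\<Sum>m\<in>S. L2_inner (\<lambda>\<eta>. inverse (\<mu> m) * u m \<eta>) f)"
      unfolding \<phi>_def by (rule L2_inner_sum_left) (auto simp: c_uL2 that)
    then show ?thesis
      by (simp add: L2_inner_cmult_left L2_inner_commute[of f])
  qed
  show ?thesis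
  proof (intro exI[of _ \<phi>] exI[of _ u] exI[of _ s] conjI ballI allI)
    show "L2_inner (\<lambda>\<eta>. relu_pow k (\<theta> i \<bullet> \<eta>)) \<phi> = (\<Sum>j\<in>I. a j * (\<theta> i \<bullet> \<theta> j) ^ l)" if "i \<in> I" for i
    proof -
      have n: "norm (\<theta> i) = 1" "\<theta> i \<noteq> 0" using I(2)[OF that] by auto
      have "L2_inner (\<lambda>\<eta>. relu_pow k (\<theta> i \<bullet> \<eta>)) (u m) = \<mu> m * u m (\<theta> i)" for m
        using ridge_family.funk_hecke[OF ridge_family_relu solid k n(2), of m]
        by (simp add: L2_inner_def \<mu>_def n)
      then have "L2_inner (\<lambda>\<eta>. relu_pow k (\<theta> i \<bullet> \<eta>)) \<phi> = (\<Sum>m\<in>S. u m (\<theta> i))"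
        using \<mu> by (simp add: \<phi>_inner relu_ridge_L2_sphere flip: mult.assoc)
      then show ?thesis by (simp add: usum[OF n(1)] inner_commute)
    qed
    show "(L2_norm \<phi>)\<^sup>2 = (\<Sum>m\<in>S. \<nu> m * s m / (\<mu> m)\<^sup>2)"
    proof -
      have inner_u: "L2_inner \<phi> (u m) = inverse (\<mu> m) * (\<nu> m * s m)" if "m \<in> S" for m
      proof -
        have "L2_inner \<phi> (u m) = (\<Sum>m'\<in>S. inverse (\<mu> m') * L2_inner (u m) (u m'))"
          unfolding L2_inner_commute[of \<phi>] by (rule \<phi>_inner[OF uL2])
        also have "\<dots> = (\<Sum>m'\<in>S. if m' = m then inverse (\<mu> m) * (L2_norm (u m))\<^sup>2 else 0)"
          by (rule sum.cong) (auto simp: orth)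
        finally show ?thesis using that fin by (simp add: norm_u)
      qed
      have "(L2_norm \<phi>)\<^sup>2 = (\<Sum>m\<in>S. inverse (\<mu> m) * L2_inner \<phi> (u m))"
        unfolding L2_norm_sq by (rule \<phi>_inner[OF \<phi>L2])
      also have "\<dots> = (\<Sum>m\<in>S. \<nu> m * s m / (\<mu> m)\<^sup>2)"
        by (rule sum.cong[OF refl]) (simp add: inner_u power2_eq_square divide_inverse mult_ac)
      finally show ?thesis .
    qed
    show "L2_inner f \<phi> = (\<Sum>m\<in>S. L2_inner (harmonic_projection m f) (u m) / \<mu> m)" if "f \<in> L2_sphere" for f
      unfolding \<phi>_inner[OF that] harmonic_projection(2)[OF that u, symmetric]
      by (simp add: divide_inverse mult.commute)
    show "0 \<le> s m" if "m \<in> S" for m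
    proof -
      have "0 \<le> \<nu> m * s m" using norm_u[OF that] zero_le_power2[of "L2_norm (u m)"] by simp
      then show ?thesis using \<nu>[OF that] by (simp add: zero_le_mult_iff)
    qed
    have "(\<Sum>m\<in>S. s m) = (\<Sum>i\<in>I. a i * (\<Sum>m\<in>S. u m (\<theta> i)))"
      unfolding s_def sum_distrib_left by (rule sum.swap)
    also have "\<dots> = (\<Sum>i\<in>I. a i * (\<Sum>j\<in>I. a j * (\<theta> j \<bullet> \<theta> i) ^ l))"
      by (rule sum.cong[OF refl]) (simp add: usum I)
    finally show "(\<Sum>m\<in>S. s m) = (\<Sum>i\<in>I. \<Sum>j\<in>I. a i * a j * (\<theta> i \<bullet> \<theta> j) ^ l)"
      by (simp add: sum_distrib_left inner_commute mult_ac)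
  qed (use \<phi>L2 uL2 norm_u in auto)
qed

text \<open>Diagonal dominance in the manner of Schur's test: \<bar>a i a j\<bar> is at most half
  the sum of the squares, and by symmetry the row sums control both halves.\<close>

lemma gram_bounds:
  fixes c :: "'i \<Rightarrow> 'i \<Rightarrow> real"
  assumes I: "finite I" and diag: "\<And>i. i \<in> I \<Longrightarrow> c i i = 1" and sym: "\<And>i j. c i j = c j i"
    and off: "\<And>i. i \<in> I \<Longrightarrow> (\<Sum>j\<in>I - {i}. \<bar>c i j\<bar>) \<le> 1 / 2"
  shows "\<bar>(\<Sum>i\<in>I. \<Sum>j\<in>I. a i * a j * c i j) - (\<Sum>i\<in>I. (a i)\<^sup>2)\<bar> \<le> (\<Sum>i\<in>I. (a i)\<^sup>2) / 2"
proof -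
  define e where "e i j = (if j = i then 0 else \<bar>c i j\<bar>)" for i j
  have e0: "e i j \<ge> 0" for i j by (simp add: e_def)
  have esym: "e i j = e j i" for i j using sym[of i j] by (simp add: e_def)
  have esum: "(\<Sum>j\<in>I. e i j) \<le> 1 / 2" if "i \<in> I" for i
  proof -
    have "(\<Sum>j\<in>I. e i j) = e i i + (\<Sum>j\<in>I - {i}. e i j)" by (rule sum.remove[OF I that])
    also have "(\<Sum>j\<in>I - {i}. e i j) = (\<Sum>j\<in>I - {i}. \<bar>c i j\<bar>)"
      by (rule sum.cong) (auto simp: e_def)
    finally show ?thesis using off[OF that] by (simp add: e_def)
  qed
  have row: "(\<Sum>j\<in>I. a i * a j * c i j) - (a i)\<^sup>2 = (\<Sum>j\<in>I - {i}. a i * a j * c i j)" if "i \<in> I" for i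
    using sum.remove[OF I that, of "\<lambda>j. a i * a j * c i j"] diag[OF that] by (simp add: power2_eq_square)
  have "\<bar>(\<Sum>i\<in>I. \<Sum>j\<in>I. a i * a j * c i j) - (\<Sum>i\<in>I. (a i)\<^sup>2)\<bar> = \<bar>\<Sum>i\<in>I. \<Sum>j\<in>I - {i}. a i * a j * c i j\<bar>"
    by (simp add: sum_subtractf[symmetric] row)
  also have "\<dots> \<le> (\<Sum>i\<in>I. \<Sum>j\<in>I - {i}. \<bar>a i * a j * c i j\<bar>)"
    by (rule order_trans[OF sum_abs]) (intro sum_mono sum_abs)
  also have "\<dots> \<le> (\<Sum>i\<in>I. \<Sum>j\<in>I. ((a i)\<^sup>2 / 2 + (a j)\<^sup>2 / 2) * e i j)"
  proof (rule sum_mono)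
    fix i assume i: "i \<in> I"
    have "(\<Sum>j\<in>I - {i}. \<bar>a i * a j * c i j\<bar>) \<le> (\<Sum>j\<in>I - {i}. ((a i)\<^sup>2 / 2 + (a j)\<^sup>2 / 2) * e i j)"
    proof (rule sum_mono)
      fix j assume j: "j \<in> I - {i}"
      have "\<bar>a i * a j\<bar> \<le> (a i)\<^sup>2 / 2 + (a j)\<^sup>2 / 2"
        using sum_squares_bound[of "\<bar>a i\<bar>" "\<bar>a j\<bar>"] by (simp add: abs_mult)
      then show "\<bar>a i * a j * c i j\<bar> \<le> ((a i)\<^sup>2 / 2 + (a j)\<^sup>2 / 2) * e i j"
        using j unfolding abs_mult[of "a i * a j"] by (auto simp: e_def intro!: mult_right_mono)
    qed
    also have "\<dots> \<le> (\<Sum>j\<in>I. ((a i)\<^sup>2 / 2 + (a j)\<^sup>2 / 2) * e i j)"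
      using I e0 by (intro sum_mono2) auto
    finally show "(\<Sum>j\<in>I - {i}. \<bar>a i * a j * c i j\<bar>) \<le> (\<Sum>j\<in>I. ((a i)\<^sup>2 / 2 + (a j)\<^sup>2 / 2) * e i j)" .
  qed
  also have "\<dots> = (\<Sum>i\<in>I. \<Sum>j\<in>I. (a i)\<^sup>2 / 2 * e i j) + (\<Sum>i\<in>I. \<Sum>j\<in>I. (a j)\<^sup>2 / 2 * e i j)"
    by (simp add: distrib_right sum.distrib)
  also have "(\<Sum>i\<in>I. \<Sum>j\<in>I. (a j)\<^sup>2 / 2 * e i j) = (\<Sum>i\<in>I. \<Sum>j\<in>I. (a i)\<^sup>2 / 2 * e i j)"
    by (subst sum.swap) (simp only: esym mult.commute)
  also have "(\<Sum>i\<in>I. \<Sum>j\<in>I. (a i)\<^sup>2 / 2 * e i j) + (\<Sum>i\<in>I. \<Sum>j\<in>I. (a i)\<^sup>2 / 2 * e i j) =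
      (\<Sum>i\<in>I. (a i)\<^sup>2 * (\<Sum>j\<in>I. e i j))"
    by (simp add: sum.distrib[symmetric] sum_distrib_left) (simp add: mult.commute)
  also have "\<dots> \<le> (\<Sum>i\<in>I. (a i)\<^sup>2 * (1 / 2))"
    by (intro sum_mono mult_left_mono esum) auto
  finally show ?thesis by (simp add: sum_divide_distrib)
qed

text \<open>Degree 0 has no weighted term of its own in \<open>sobolev_norm_sq\<close>, so its
  projection is added to the bound separately.\<close>

lemma sobolev_sum_bound:
  assumes "f \<in> sobolev_sphere r"
  shows "\<exists>B\<ge>0. \<forall>l. (\<Sum>m\<le>l. real (max 1 m) powr (2 * r) * (L2_norm (harmonic_projection m f))\<^sup>2) \<le> B"
proof -
  define g where "g m = real (Suc m) powr (2 * r) * (L2_norm (harmonic_projection (Suc m) f))\<^sup>2" for m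
  have g0: "g m \<ge> 0" for m by (simp add: g_def)
  have "(\<Sum>m. ennreal (g m)) < \<infinity>"
    using assms unfolding sobolev_sphere_def sobolev_norm_sq_def g_def by (simp add: less_top)
  then obtain b where b: "b \<ge> 0" "(\<Sum>m. ennreal (g m)) = ennreal b"
    by (cases "\<Sum>m. ennreal (g m)") auto
  have part: "(\<Sum>m<l. g m) \<le> b" for l
  proof -
    have "ennreal (\<Sum>m<l. g m) = (\<Sum>m<l. ennreal (g m))" using g0 by (intro sum_ennreal[symmetric]) auto
    also have "\<dots> \<le> ennreal b" unfolding b(2)[symmetric] by (intro sum_le_suminf) auto
    finally show ?thesis using b(1) by simp
  qed
  define B where "B = (L2_norm (harmonic_projection 0 f))\<^sup>2 + b"
  have "(\<Sum>m\<le>l. real (max 1 m) powr (2 * r) * (L2_norm (harmonic_projection m f))\<^sup>2) \<le> B" for l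
  proof -
    have "(\<Sum>m\<le>l. real (max 1 m) powr (2 * r) * (L2_norm (harmonic_projection m f))\<^sup>2) =
        (L2_norm (harmonic_projection 0 f))\<^sup>2 + (\<Sum>m<l. g m)"
      unfolding lessThan_Suc_atMost[symmetric] by (subst sum.lessThan_Suc_shift) (simp add: g_def)
    then show ?thesis using part[of l] by (simp add: B_def)
  qed
  moreover have "B \<ge> 0" using b by (simp add: B_def)
  ultimately show ?thesis by blast
qed

lemma weighted_Cauchy_Schwarz:
  fixes x y w :: "'i \<Rightarrow> real"
  assumes "finite S" "\<And>m. m \<in> S \<Longrightarrow> w m > 0"
  shows "(\<Sum>m\<in>S. x m * y m)\<^sup>2 \<le> (\<Sum>m\<in>S. w m * (x m)\<^sup>2) * (\<Sum>m\<in>S. (y m)\<^sup>2 / w m)"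
proof -
  have "(\<Sum>m\<in>S. x m * y m) = (\<Sum>m\<in>S. (sqrt (w m) * x m) * (y m / sqrt (w m)))"
    using assms(2) by (intro sum.cong) (auto simp: less_imp_neq[symmetric])
  then have "(\<Sum>m\<in>S. x m * y m)\<^sup>2 \<le> (\<Sum>m\<in>S. (sqrt (w m) * x m)\<^sup>2) * (\<Sum>m\<in>S. (y m / sqrt (w m))\<^sup>2)"
    using Cauchy_Schwarz_ineq_sum[of "\<lambda>m. sqrt (w m) * x m" "\<lambda>m. y m / sqrt (w m)" S] by simp
  also have "(\<Sum>m\<in>S. (sqrt (w m) * x m)\<^sup>2) = (\<Sum>m\<in>S. w m * (x m)\<^sup>2)"
    using assms(2) by (intro sum.cong) (auto simp: power_mult_distrib less_imp_le)
  also have "(\<Sum>m\<in>S. (y m / sqrt (w m))\<^sup>2) = (\<Sum>m\<in>S. (y m)\<^sup>2 / w m)"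
    using assms(2) by (intro sum.cong) (auto simp: power_divide less_imp_le)
  finally show ?thesis .
qed

text \<open>\<open>E\<close> and \<open>A\<close> precede the points, the degree and the
  coefficients, so the later choice of l may depend on the separation without touching the
  constants.\<close>

lemma test_function_bounds:
  fixes f :: "'a::euclidean_space \<Rightarrow> real"
  assumes k: "k \<ge> 1" and D: "DIM('a) = d + 1" and r: "r > (real d + 2 * real k + 1) / 2"
    and f: "f \<in> sobolev_sphere r"
  shows "\<exists>E>0. \<exists>A>0. \<forall>n (\<theta> :: nat \<Rightarrow> 'a) l a. antipodal_set n \<theta> \<longrightarrow> l \<ge> 1 \<longrightarrow> odd (k + l) \<longrightarrow>
     real l * (antipodal_separation n \<theta>)\<^sup>2 \<ge> A \<longrightarrow>
     (\<exists>\<phi>\<in>L2_sphere. L2_inner (\<lambda>\<eta>. \<Sum>j=1..n. a j * relu_pow k (\<theta> j \<bullet> \<eta>)) \<phi> \<ge> (\<Sum>j=1..n. (a j)\<^sup>2) / 2 \<and>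
       (L2_norm \<phi>)\<^sup>2 \<le> E * real l powr (real k + 1 / 2) * (\<Sum>j=1..n. (a j)\<^sup>2) \<and>
       (L2_inner f \<phi>)\<^sup>2 \<le> E * real l powr (- (real d / 2)) * (\<Sum>j=1..n. (a j)\<^sup>2))"
proof -
  define \<mu> where "\<mu> = (\<lambda>m. funk_hecke_coeff (\<lambda>k. sphere_moment TYPE('a) k / 2) m k)"
  define q where "q = 2 * k + DIM('a)"
  have fL2: "f \<in> L2_sphere" using f by (simp add: sobolev_sphere_def)
  obtain c where c: "c > 0" "\<And>m. odd (k + m) \<Longrightarrow> c * real (max 1 m) powr (- (real q / 2)) \<le> \<bar>\<mu> m\<bar>"
    using relu_coeff_lower[OF k, where 'a='a] unfolding \<mu>_def q_def by blast
  obtain C where C: "C > 0"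
    and C1: "\<And>l m. l \<ge> 1 \<Longrightarrow> m \<le> l \<Longrightarrow> even (l + m) \<Longrightarrow>
      funk_hecke_coeff (power_coeff TYPE('a)) m l \<le> C * real l powr (- (real d / 2))"
    and C2: "\<And>l m. l \<ge> 1 \<Longrightarrow> m \<le> l \<Longrightarrow> even (l + m) \<Longrightarrow>
      funk_hecke_coeff (power_coeff TYPE('a)) m l * real (max 1 m) ^ q \<le> C * real l powr (real k + 1 / 2)"
    using power_coeff_asymp[of k, where 'a='a] D unfolding q_def by auto
  obtain B where B: "B \<ge> 0"
    "\<And>l. (\<Sum>m\<le>l. real (max 1 m) powr (2 * r) * (L2_norm (harmonic_projection m f))\<^sup>2) \<le> B"
    using sobolev_sum_bound[OF f] by blast
  define A where "A = 32 * (1 + 2 * packing_const DIM('a))"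
  have A: "A > 0" using packing_const_pos[of "DIM('a)"] by (simp add: A_def)
  have inv: "1 / (\<mu> m)\<^sup>2 \<le> real (max 1 m) ^ q / c\<^sup>2" if "odd (k + m)" for m
  proof -
    define x where "x = real (max 1 m)"
    have x: "x \<ge> 1" by (simp add: x_def)
    have "(c * x powr (- (real q / 2)))\<^sup>2 \<le> \<bar>\<mu> m\<bar>\<^sup>2"
      using c that x by (intro power_mono) (auto simp: x_def)
    moreover have "(x powr (- (real q / 2)))\<^sup>2 = 1 / x ^ q"
    proof -
      have "(x powr (- (real q / 2)))\<^sup>2 = x powr (- (real q / 2) + - (real q / 2))"
        unfolding powr_add power2_eq_square ..
      also have "- (real q / 2) + - (real q / 2) = - real q" by simp
      also have "x powr (- real q) = 1 / x powr real q" by (simp only: powr_minus_divide)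
      also have "x powr real q = x ^ q" using x by (intro powr_realpow) simp
      finally show ?thesis .
    qed
    ultimately have le: "c\<^sup>2 / x ^ q \<le> (\<mu> m)\<^sup>2" by (simp add: power_mult_distrib)
    have "0 < c\<^sup>2 / x ^ q" using c x by simp
    then have "1 / (\<mu> m)\<^sup>2 \<le> 1 / (c\<^sup>2 / x ^ q)" using le by (intro frac_le) auto
    then show ?thesis by (simp add: x_def)
  qed
  \<comment> \<open>3/2 is the upper Gram bound; B + 1 in place of B keeps \<open>E\<close> positive
    and lets it serve the estimate of the norm as well.\<close>
  define E where "E = (B + 1) * (3 / 2 * (C / c\<^sup>2))"
  have E: "E > 0" using B C c by (simp add: E_def)
  have Ec: "3 / 2 * (C / c\<^sup>2) \<le> E"
  proof -
    have "1 * (3 / 2 * (C / c\<^sup>2)) \<le> (B + 1) * (3 / 2 * (C / c\<^sup>2))"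
      using B(1) C c(1) by (intro mult_right_mono) auto
    then show ?thesis by (simp add: E_def)
  qed
  have main: "\<exists>\<phi>\<in>L2_sphere. L2_inner (\<lambda>\<eta>. \<Sum>j=1..n. a j * relu_pow k (\<theta> j \<bullet> \<eta>)) \<phi> \<ge> (\<Sum>j=1..n. (a j)\<^sup>2) / 2 \<and>
       (L2_norm \<phi>)\<^sup>2 \<le> E * real l powr (real k + 1 / 2) * (\<Sum>j=1..n. (a j)\<^sup>2) \<and>
       (L2_inner f \<phi>)\<^sup>2 \<le> E * real l powr (- (real d / 2)) * (\<Sum>j=1..n. (a j)\<^sup>2)"
    if \<theta>: "antipodal_set n \<theta>" and l: "l \<ge> 1" and kl: "odd (k + l)"
      and lA: "real l * (antipodal_separation n \<theta>)\<^sup>2 \<ge> A" for n l a and \<theta> :: "nat \<Rightarrow> 'a"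
  proof -
    interpret antipodal_set n \<theta> by fact
    define \<nu> where "\<nu> = (\<lambda>m. funk_hecke_coeff (power_coeff TYPE('a)) m l)"
    define S where "S = {m. m \<le> l \<and> even (l + m)}"
    define Q where "Q = (\<Sum>j=1..n. (a j)\<^sup>2)"
    have fin: "finite S" by (simp add: S_def)
    have Q: "Q \<ge> 0" by (simp add: Q_def sum_nonneg)
    have unit_ball: "\<forall>i\<in>{1..n}. norm (\<theta> i) = 1" using unit by blast
    obtain \<phi> u s where \<phi>: "\<phi> \<in> L2_sphere" and relu_\<phi>:
      "\<forall>i\<in>{1..n}. L2_inner (\<lambda>\<eta>. relu_pow k (\<theta> i \<bullet> \<eta>)) \<phi> = (\<Sum>j=1..n. a j * (\<theta> i \<bullet> \<theta> j) ^ l)"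
      and norm_\<phi>: "(L2_norm \<phi>)\<^sup>2 = (\<Sum>m\<in>S. \<nu> m * s m / (\<mu> m)\<^sup>2)" and f_\<phi>:
      "\<forall>f\<in>L2_sphere. L2_inner f \<phi> = (\<Sum>m\<in>S. L2_inner (harmonic_projection m f) (u m) / \<mu> m)"
      and norm_u: "\<forall>m\<in>S. (L2_norm (u m))\<^sup>2 = \<nu> m * s m" and uL2: "\<forall>m. u m \<in> L2_sphere"
      and s0: "\<forall>m\<in>S. 0 \<le> s m"
      and ssum: "(\<Sum>m\<in>S. s m) = (\<Sum>i=1..n. \<Sum>j=1..n. a i * a j * (\<theta> i \<bullet> \<theta> j) ^ l)"
      using test_function[where I="{1..n}" and \<theta>=\<theta> and a=a, OF finite_atLeastAtMost unit_ball k l kl]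
      unfolding \<mu>_def \<nu>_def S_def by (elim exE conjE)
    have "\<bar>(\<Sum>m\<in>S. s m) - Q\<bar> \<le> Q / 2"
      unfolding ssum Q_def
    proof (rule gram_bounds)
      show "(\<theta> i \<bullet> \<theta> i) ^ l = 1" if "i \<in> {1..n}" for i using unit[OF that] by (simp add: norm_eq_1)
      show "(\<Sum>j\<in>{1..n} - {i}. \<bar>(\<theta> i \<bullet> \<theta> j) ^ l\<bar>) \<le> 1 / 2" if "i \<in> {1..n}" for i
        using packing_gram[OF lA[unfolded A_def] that] by (simp add: power_abs)
    qed (simp_all add: inner_commute)
    then have sQ: "Q / 2 \<le> (\<Sum>m\<in>S. s m)" "(\<Sum>m\<in>S. s m) \<le> 3 / 2 * Q" by linarith+
    have "L2_inner (\<lambda>\<eta>. \<Sum>j=1..n. a j * relu_pow k (\<theta> j \<bullet> \<eta>)) \<phi> =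
        (\<Sum>j=1..n. L2_inner (\<lambda>\<eta>. a j * relu_pow k (\<theta> j \<bullet> \<eta>)) \<phi>)"
      by (rule L2_inner_sum_left) (auto intro: L2_sphere_cmult relu_ridge_L2_sphere \<phi>)
    also have "\<dots> = (\<Sum>i=1..n. \<Sum>j=1..n. a i * a j * (\<theta> i \<bullet> \<theta> j) ^ l)"
      by (simp add: L2_inner_cmult_left relu_\<phi> sum_distrib_left mult.assoc)
    finally have 1: "L2_inner (\<lambda>\<eta>. \<Sum>j=1..n. a j * relu_pow k (\<theta> j \<bullet> \<eta>)) \<phi> \<ge> Q / 2"
      using sQ(1) ssum by simp
    have oddm: "odd (k + m)" if "m \<in> S" for m using that kl by (auto simp: S_def)
    have \<nu>0: "\<nu> m \<ge> 0" if "m \<in> S" for m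
      using that l power_coeff_bounds(1)[of l m, where 'a='a] by (auto simp: \<nu>_def S_def)
    have 2: "(L2_norm \<phi>)\<^sup>2 \<le> E * real l powr (real k + 1 / 2) * Q"
    proof -
      have "\<nu> m * s m / (\<mu> m)\<^sup>2 \<le> (C / c\<^sup>2 * real l powr (real k + 1 / 2)) * s m" if m: "m \<in> S" for m
      proof -
        have "\<nu> m * s m * (1 / (\<mu> m)\<^sup>2) \<le> \<nu> m * s m * (real (max 1 m) ^ q / c\<^sup>2)"
          using \<nu>0[OF m] s0[rule_format, OF m] by (intro mult_left_mono inv oddm m) auto
        also have "\<dots> = (\<nu> m * real (max 1 m) ^ q) * (s m / c\<^sup>2)" by simp
        also have "\<dots> \<le> (C * real l powr (real k + 1 / 2)) * (s m / c\<^sup>2)"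
          using C2[of l m] l m s0[rule_format, OF m] by (intro mult_right_mono) (auto simp: \<nu>_def S_def)
        finally show ?thesis by (simp add: mult_ac)
      qed
      then have "(L2_norm \<phi>)\<^sup>2 \<le> (\<Sum>m\<in>S. (C / c\<^sup>2 * real l powr (real k + 1 / 2)) * s m)"
        unfolding norm_\<phi> by (rule sum_mono)
      also have "\<dots> = (C / c\<^sup>2 * real l powr (real k + 1 / 2)) * (\<Sum>m\<in>S. s m)"
        by (simp add: sum_distrib_left)
      also have "\<dots> \<le> (C / c\<^sup>2 * real l powr (real k + 1 / 2)) * (3 / 2 * Q)"
        using sQ C by (intro mult_left_mono) auto
      also have "\<dots> = (3 / 2 * (C / c\<^sup>2)) * (real l powr (real k + 1 / 2) * Q)" by simp
      also have "\<dots> \<le> E * (real l powr (real k + 1 / 2) * Q)"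
        using Ec Q by (intro mult_right_mono) auto
      finally show ?thesis by (simp add: mult_ac)
    qed
    have 3: "(L2_inner f \<phi>)\<^sup>2 \<le> E * real l powr (- (real d / 2)) * Q"
    proof -
      \<comment> \<open>The Sobolev weight. Because 2r exceeds q = 2k + d + 1 it dominates the
        growth of \<mu>_m^(-2), and only the uniform bound on \<nu>_m is left.\<close>
      define w where "w m = real (max 1 m) powr (2 * r)" for m
      have w: "w m > 0" for m by (simp add: w_def)
      have wq: "real (max 1 m) ^ q \<le> w m" for m
      proof -
        have "real (max 1 m) ^ q = real (max 1 m) powr real q" by (simp add: powr_realpow)
        also have "\<dots> \<le> w m" unfolding w_def using r D by (intro powr_mono) (auto simp: q_def)
        finally show ?thesis .
      qed
      have "\<bar>L2_inner f \<phi>\<bar> \<le> (\<Sum>m\<in>S. L2_norm (harmonic_projection m f) * (L2_norm (u m) / \<bar>\<mu> m\<bar>))"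
        unfolding f_\<phi>[rule_format, OF fL2]
      proof (rule order_trans[OF sum_abs sum_mono])
        fix m assume "m \<in> S"
        show "\<bar>L2_inner (harmonic_projection m f) (u m) / \<mu> m\<bar> \<le>
            L2_norm (harmonic_projection m f) * (L2_norm (u m) / \<bar>\<mu> m\<bar>)"
          using L2_Cauchy_Schwarz[OF harmonic_projection(1)[OF fL2] uL2[rule_format], of m m]
          by (simp add: abs_divide divide_right_mono)
      qed
      then have "(L2_inner f \<phi>)\<^sup>2 \<le> (\<Sum>m\<in>S. L2_norm (harmonic_projection m f) * (L2_norm (u m) / \<bar>\<mu> m\<bar>))\<^sup>2"
        using power_mono[of "\<bar>L2_inner f \<phi>\<bar>" _ 2] by simp
      also have "\<dots> \<le> (\<Sum>m\<in>S. w m * (L2_norm (harmonic_projection m f))\<^sup>2) *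
          (\<Sum>m\<in>S. (L2_norm (u m) / \<bar>\<mu> m\<bar>)\<^sup>2 / w m)"
        by (rule weighted_Cauchy_Schwarz[OF fin w])
      also have "\<dots> \<le> B * (\<Sum>m\<in>S. (C / c\<^sup>2 * real l powr (- (real d / 2))) * s m)"
      proof (rule mult_mono)
        have "(\<Sum>m\<in>S. w m * (L2_norm (harmonic_projection m f))\<^sup>2) \<le>
            (\<Sum>m\<le>l. w m * (L2_norm (harmonic_projection m f))\<^sup>2)"
          using w by (intro sum_mono2) (auto simp: S_def less_imp_le)
        also have "\<dots> \<le> B" using B(2)[of l] by (simp add: w_def)
        finally show "(\<Sum>m\<in>S. w m * (L2_norm (harmonic_projection m f))\<^sup>2) \<le> B" .
        show "(\<Sum>m\<in>S. (L2_norm (u m) / \<bar>\<mu> m\<bar>)\<^sup>2 / w m) \<le> (\<Sum>m\<in>S. (C / c\<^sup>2 * real l powr (- (real d / 2))) * s m)"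
        proof (rule sum_mono)
          fix m assume m: "m \<in> S"
          have "(L2_norm (u m) / \<bar>\<mu> m\<bar>)\<^sup>2 / w m = (\<nu> m * s m / w m) * (1 / (\<mu> m)\<^sup>2)"
            by (simp add: power_divide norm_u[rule_format, OF m])
          also have "\<dots> \<le> (\<nu> m * s m / w m) * (real (max 1 m) ^ q / c\<^sup>2)"
            using \<nu>0[OF m] s0[rule_format, OF m] w[of m] by (intro mult_left_mono inv oddm m) auto
          also have "\<dots> = (\<nu> m * s m / c\<^sup>2) * (real (max 1 m) ^ q / w m)" by simp
          also have "\<dots> \<le> (\<nu> m * s m / c\<^sup>2) * 1"
            using \<nu>0[OF m] s0[rule_format, OF m] w[of m] wq[of m] by (intro mult_left_mono) auto
          also have "\<dots> = \<nu> m * (s m / c\<^sup>2)" by simp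
          also have "\<dots> \<le> (C * real l powr (- (real d / 2))) * (s m / c\<^sup>2)"
            using C1[of l m] l m s0[rule_format, OF m] by (intro mult_right_mono) (auto simp: \<nu>_def S_def)
          finally show "(L2_norm (u m) / \<bar>\<mu> m\<bar>)\<^sup>2 / w m \<le> (C / c\<^sup>2 * real l powr (- (real d / 2))) * s m"
            by (simp add: mult_ac)
        qed
        show "0 \<le> (\<Sum>m\<in>S. (L2_norm (u m) / \<bar>\<mu> m\<bar>)\<^sup>2 / w m)"
          using w by (intro sum_nonneg divide_nonneg_nonneg) (auto simp: less_imp_le)
      qed (use B in auto)
      also have "(\<Sum>m\<in>S. (C / c\<^sup>2 * real l powr (- (real d / 2))) * s m) =
          (C / c\<^sup>2 * real l powr (- (real d / 2))) * (\<Sum>m\<in>S. s m)"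
        by (simp add: sum_distrib_left)
      also have "B * \<dots> \<le> (B + 1) * ((C / c\<^sup>2 * real l powr (- (real d / 2))) * (3 / 2 * Q))"
        using sQ C B Q s0 by (intro mult_mono mult_left_mono mult_nonneg_nonneg sum_nonneg) auto
      also have "\<dots> = E * real l powr (- (real d / 2)) * Q"
        by (simp add: E_def)
      finally show ?thesis .
    qed
    from 1 2 3 \<phi> show ?thesis unfolding Q_def by blast
  qed
  show ?thesis
    by (intro exI[of _ E] exI[of _ A] conjI allI impI, rule E, rule A, rule main)
qed

section \<open>From the test function to the lower bound\<close>

lemma antipodal_setI:
  fixes \<theta> :: "nat \<Rightarrow> 'a::euclidean_space"
  assumes "n \<ge> 2" "\<forall>j\<in>{1..n}. \<theta> j \<in> sphere 0 1" "antipodal_separation n \<theta> > 0"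
  shows "antipodal_set n \<theta>"
  using assms by unfold_locales auto

lemma L2_norm_relu_le_one:
  fixes \<theta> :: "'a::euclidean_space"
  assumes "norm \<theta> = 1"
  shows "L2_norm (\<lambda>\<eta>. relu_pow k (\<theta> \<bullet> \<eta>)) \<le> 1"
proof -
  have "(LINT \<eta>|sphere_measure. (relu_pow k (\<theta> \<bullet> \<eta>))\<^sup>2) \<le> (LINT \<eta>|(sphere_measure :: 'a measure). 1)"
  proof (rule integral_mono)
    fix \<eta> :: 'a assume "\<eta> \<in> space sphere_measure"
    then have "\<bar>\<theta> \<bullet> \<eta>\<bar> \<le> 1" using assms by (intro abs_inner_le_one) auto
    then have "0 \<le> relu_pow k (\<theta> \<bullet> \<eta>)" "relu_pow k (\<theta> \<bullet> \<eta>) \<le> 1"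
      unfolding relu_pow_def by (auto intro!: power_le_one)
    then show "(relu_pow k (\<theta> \<bullet> \<eta>))\<^sup>2 \<le> 1" by (rule power_le_one)
  qed (intro integrable_sphere_continuous continuous_intros continuous_relu_ridge)+
  then show ?thesis by (simp add: L2_norm_def)
qed

lemma sum_abs_le_sqrt:
  fixes a :: "'i \<Rightarrow> real"
  shows "(\<Sum>i\<in>I. \<bar>a i\<bar>) \<le> sqrt (real (card I)) * sqrt (\<Sum>i\<in>I. (a i)\<^sup>2)"
proof -
  have "(\<Sum>i\<in>I. 1 * \<bar>a i\<bar>)\<^sup>2 \<le> (\<Sum>i\<in>I. 1\<^sup>2) * (\<Sum>i\<in>I. \<bar>a i\<bar>\<^sup>2)"
    by (rule Cauchy_Schwarz_ineq_sum)
  then have "(\<Sum>i\<in>I. \<bar>a i\<bar>)\<^sup>2 \<le> real (card I) * (\<Sum>i\<in>I. (a i)\<^sup>2)" by simp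
  then have "\<bar>\<Sum>i\<in>I. \<bar>a i\<bar>\<bar> \<le> sqrt (real (card I) * (\<Sum>i\<in>I. (a i)\<^sup>2))"
    by (intro real_le_rsqrt) simp
  then show ?thesis by (simp add: real_sqrt_mult)
qed

text \<open>Stated for each choice of coefficients, with the constant fixed beforehand; the infimum
  is taken at the very end. The positive norm of \<open>f\<close> enters the size of
  \<open>A\<close> through a division.\<close>

lemma approximation_lower_bound:
  fixes f :: "'a::euclidean_space \<Rightarrow> real"
  assumes d: "d \<ge> 1" and k: "k \<ge> 1" and D: "DIM('a) = d + 1"
    and r: "r > (real d + 2 * real k + 1) / 2" and f: "f \<in> sobolev_sphere r"
    and F: "L2_norm f > 0"
  shows "\<exists>C>0. \<forall>n (\<theta> :: nat \<Rightarrow> 'a) a. antipodal_set n \<theta> \<longrightarrow>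
    C * real n powr (- (1 / 2)) * antipodal_separation n \<theta> powr (real k + 1 / 2) * L2_norm f \<le>
      L2_norm (\<lambda>\<eta>. f \<eta> - (\<Sum>j=1..n. a j * relu_pow k (\<theta> j \<bullet> \<eta>)))"
proof -
  define F where "F = L2_norm f"
  have F0: "F > 0" using F by (simp add: F_def)
  have fL2: "f \<in> L2_sphere" using f by (simp add: sobolev_sphere_def)
  obtain E A0 where E: "E > 0" and A0: "A0 > 0"
    and test: "\<forall>n (\<theta> :: nat \<Rightarrow> 'a) l a. antipodal_set n \<theta> \<longrightarrow> l \<ge> 1 \<longrightarrow> odd (k + l) \<longrightarrow>
     real l * (antipodal_separation n \<theta>)\<^sup>2 \<ge> A0 \<longrightarrow>
     (\<exists>\<phi>\<in>L2_sphere. L2_inner (\<lambda>\<eta>. \<Sum>j=1..n. a j * relu_pow k (\<theta> j \<bullet> \<eta>)) \<phi> \<ge> (\<Sum>j=1..n. (a j)\<^sup>2) / 2 \<and>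
       (L2_norm \<phi>)\<^sup>2 \<le> E * real l powr (real k + 1 / 2) * (\<Sum>j=1..n. (a j)\<^sup>2) \<and>
       (L2_inner f \<phi>)\<^sup>2 \<le> E * real l powr (- (real d / 2)) * (\<Sum>j=1..n. (a j)\<^sup>2))"
    using test_function_bounds[OF k D r f] by (elim exE conjE)
  obtain N where N: "N > 0" and card: "\<forall>n (\<theta> :: nat \<Rightarrow> 'a). antipodal_set n \<theta> \<longrightarrow>
    real n \<le> N * antipodal_separation n \<theta> powr (- (real DIM('a) - 1))"
    using separation_card_bound[where 'a='a] by (elim exE conjE)
  text \<open>\<open>A\<close> is so large that the contribution of \<open>f\<close> is at most half of that of the network.\<close>
  define A where "A = max A0 ((64 * E * N / F\<^sup>2) powr (2 / real d))"
  have A: "A > 0" "A \<ge> A0" using A0 by (auto simp: A_def)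
  have AF: "E * A powr (- (real d / 2)) * N \<le> F\<^sup>2 / 64"
  proof -
    have "64 * E * N / F\<^sup>2 = ((64 * E * N / F\<^sup>2) powr (2 / real d)) powr (real d / 2)"
      using d E N F0 by (simp add: powr_powr)
    also have "\<dots> \<le> A powr (real d / 2)" by (intro powr_mono2) (auto simp: A_def)
    finally have "64 * E * N / F\<^sup>2 \<le> A powr (real d / 2)" .
    then show ?thesis
      unfolding powr_minus_divide using A F0 by (simp add: divide_le_eq le_divide_eq mult.commute mult.left_commute)
  qed
  define s where "s = real k + 1 / 2"
  have s: "s > 0" by (simp add: s_def)
  define G where "G = E * (A + 8) powr s"
  have G: "G > 0" using E A by (simp add: G_def)
  \<comment> \<open>One entry per case of the proof: a useless approximation, where only h \<le> 2
    is needed, and the test function estimate.\<close>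
  define C where "C = min (1 / (2 * 2 powr s)) (1 / (8 * sqrt G))"
  have C: "C > 0" using G by (simp add: C_def)
  have main: "C * real n powr (- (1 / 2)) * antipodal_separation n \<theta> powr (real k + 1 / 2) * L2_norm f \<le>
      L2_norm (\<lambda>\<eta>. f \<eta> - (\<Sum>j=1..n. a j * relu_pow k (\<theta> j \<bullet> \<eta>)))"
    if \<theta>: "antipodal_set n \<theta>" for n a and \<theta> :: "nat \<Rightarrow> 'a"
  proof -
    interpret antipodal_set n \<theta> by fact
    define g where "g \<eta> = (\<Sum>j=1..n. a j * relu_pow k (\<theta> j \<bullet> \<eta>))" for \<eta>
    define \<delta> where "\<delta> = L2_norm (\<lambda>\<eta>. f \<eta> - g \<eta>)"
    have n: "real n \<ge> 2" using n2 by simp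
    have npowr: "real n powr (- (1 / 2)) = 1 / sqrt (real n)"
      unfolding powr_minus_divide by (simp add: powr_half_sqrt)
    have term_L2: "(\<lambda>\<eta>. a j * relu_pow k (\<theta> j \<bullet> \<eta>)) \<in> L2_sphere" for j
      by (rule L2_sphere_cmult[OF relu_ridge_L2_sphere])
    have gL2: "g \<in> L2_sphere" unfolding g_def by (rule L2_sphere_sum) (rule term_L2)
    have fg: "(\<lambda>\<eta>. f \<eta> - g \<eta>) \<in> L2_sphere" by (rule L2_sphere_diff[OF fL2 gL2])
    have "C * (1 / sqrt (real n)) * h powr s * F \<le> \<delta>"
    proof (cases "\<delta> \<ge> F / 2")
      case True
      have "h \<le> 2" using h_le pi_half_less_two by linarith
      then have "h powr s \<le> 2 powr s" using sep s by (intro powr_mono2) auto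
      moreover have "1 / sqrt (real n) \<le> 1" using n by simp
      moreover have "C \<le> 1 / (2 * 2 powr s)" by (simp add: C_def)
      ultimately have "C * (1 / sqrt (real n)) * h powr s * F \<le> 1 / (2 * 2 powr s) * 1 * 2 powr s * F"
        using C F0 by (intro mult_right_mono mult_mono) auto
      also have "\<dots> = F / 2" by simp
      finally show ?thesis using True by linarith
    next
      case False
      define Q where "Q = (\<Sum>j=1..n. (a j)\<^sup>2)"
      define q where "q = sqrt Q"
      have Q: "Q \<ge> 0" by (simp add: Q_def sum_nonneg)
      have qQ: "q\<^sup>2 = Q" "q \<ge> 0" using Q by (auto simp: q_def)
      have "L2_norm g \<le> (\<Sum>j=1..n. L2_norm (\<lambda>\<eta>. a j * relu_pow k (\<theta> j \<bullet> \<eta>)))"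
        unfolding g_def by (rule L2_norm_sum_le) (auto intro: term_L2)
      also have "\<dots> \<le> (\<Sum>j=1..n. \<bar>a j\<bar>)"
      proof (rule sum_mono)
        fix j assume "j \<in> {1..n}"
        then have "\<bar>a j\<bar> * L2_norm (\<lambda>\<eta>. relu_pow k (\<theta> j \<bullet> \<eta>)) \<le> \<bar>a j\<bar> * 1"
          by (intro mult_left_mono L2_norm_relu_le_one unit) auto
        then show "L2_norm (\<lambda>\<eta>. a j * relu_pow k (\<theta> j \<bullet> \<eta>)) \<le> \<bar>a j\<bar>" by (simp add: L2_norm_cmult)
      qed
      also have "\<dots> \<le> sqrt (real n) * q"
        using sum_abs_le_sqrt[of a "{1..n}"] by (simp add: q_def Q_def)
      finally have g_le: "L2_norm g \<le> sqrt (real n) * q" .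
      have "F \<le> \<delta> + L2_norm g"
        using L2_norm_triangle[OF fg gL2] by (simp add: F_def \<delta>_def)
      then have Fq: "F / 2 \<le> sqrt (real n) * q" using False g_le by linarith
      then have q_ge: "F / (2 * sqrt (real n)) \<le> q" using n by (simp add: field_simps)
      have q0: "q > 0"
      proof -
        have "0 < F / (2 * sqrt (real n))" using F0 n by simp
        then show ?thesis using q_ge by linarith
      qed
      define l0 where "l0 = nat \<lceil>A / h\<^sup>2\<rceil>"
      \<comment> \<open>A shift by one corrects the parity; it costs at most 1 more than the
        rounding.\<close>
      define l where "l = (if odd (k + l0) then l0 else l0 + 1)"
      have h2: "h\<^sup>2 > 0" using sep by simp
      have Ah: "A / h\<^sup>2 > 0" using A h2 by simp
      have l0: "A / h\<^sup>2 \<le> real l0" "real l0 \<le> A / h\<^sup>2 + 1"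
        unfolding l0_def using Ah by (linarith, simp add: of_nat_nat)
      have l_ge: "A / h\<^sup>2 \<le> real l" and l_le: "real l \<le> A / h\<^sup>2 + 2" and kl: "odd (k + l)"
        using l0 by (auto simp: l_def)
      have l1: "l \<ge> 1" using l_ge Ah by (cases l) auto
      have l_le': "real l \<le> (A + 8) / h\<^sup>2"
      proof -
        have "1 \<le> 4 / h\<^sup>2" using h_sq_le h2 by (simp add: field_simps)
        then show ?thesis using l_le by (simp add: add_divide_distrib)
      qed
      have lA: "real l * h\<^sup>2 \<ge> A0"
      proof -
        have "A \<le> real l * h\<^sup>2" using l_ge h2 by (simp add: pos_divide_le_eq)
        then show ?thesis using A by linarith
      qed
      obtain \<phi> where \<phi>: "\<phi> \<in> L2_sphere" and 1: "L2_inner g \<phi> \<ge> Q / 2"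
        and 2: "(L2_norm \<phi>)\<^sup>2 \<le> E * real l powr s * Q"
        and 3: "(L2_inner f \<phi>)\<^sup>2 \<le> E * real l powr (- (real d / 2)) * Q"
        using test[rule_format, OF \<theta> l1 kl lA, of a] unfolding g_def[abs_def] s_def Q_def by blast
      have "E * real l powr (- (real d / 2)) \<le> F\<^sup>2 / 64 / real n"
      proof -
        have "real l powr (- (real d / 2)) \<le> (A / h\<^sup>2) powr (- (real d / 2))"
          using l_ge Ah by (intro powr_mono2') auto
        also have "\<dots> = A powr (- (real d / 2)) * (h\<^sup>2) powr (real d / 2)"
          unfolding powr_divide powr_minus_divide by simp
        also have "(h\<^sup>2) powr (real d / 2) = h powr real d"
        proof -
          have "(h\<^sup>2) powr (real d / 2) = (h powr 2) powr (real d / 2)" using sep by (subst powr_numeral) auto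
          then show ?thesis by (simp only: powr_powr) simp
        qed
        finally have "real l powr (- (real d / 2)) \<le> A powr (- (real d / 2)) * h powr real d" .
        moreover have "h powr real d \<le> N / real n"
        proof -
          have "real n \<le> N * h powr (- real d)" using card[rule_format, OF \<theta>] D by simp
          then have "real n \<le> N / h powr real d" unfolding powr_minus_divide by simp
          then show ?thesis using n sep by (simp add: pos_le_divide_eq mult.commute)
        qed
        moreover have "A powr (- (real d / 2)) * h powr real d \<le> A powr (- (real d / 2)) * (N / real n)"
          using calculation(2) by (rule mult_left_mono) simp
        ultimately have "real l powr (- (real d / 2)) \<le> A powr (- (real d / 2)) * (N / real n)" by linarith
        then have "E * real l powr (- (real d / 2)) \<le> E * (A powr (- (real d / 2)) * (N / real n))"
          using E by (intro mult_left_mono) auto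
        also have "\<dots> = E * A powr (- (real d / 2)) * N / real n" by simp
        also have "\<dots> \<le> F\<^sup>2 / 64 / real n" using AF n by (intro divide_right_mono) auto
        finally show ?thesis .
      qed
      \<comment> \<open>64 = (2 * 4)^2: the 2 comes from the lower bound F/(2 sqrt n) for q, and the
        4 leaves half of the guaranteed Q/2.\<close>
      then have "(L2_inner f \<phi>)\<^sup>2 \<le> F\<^sup>2 / 64 / real n * Q"
        using 3 Q by (meson mult_right_mono order_trans)
      also have "\<dots> = (F / (2 * sqrt (real n)) * q / 4)\<^sup>2"
        using n by (simp add: power_divide power_mult_distrib qQ)
      finally have "\<bar>L2_inner f \<phi>\<bar> \<le> \<bar>F / (2 * sqrt (real n)) * q / 4\<bar>"
        by (simp only: abs_le_square_iff)
      also have "\<dots> = F / (2 * sqrt (real n)) * q / 4"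
        using F0 q0 by (intro abs_of_nonneg) auto
      also have "\<dots> \<le> q * q / 4" using q_ge q0 by (intro divide_right_mono mult_right_mono) auto
      finally have f\<phi>: "\<bar>L2_inner f \<phi>\<bar> \<le> Q / 4" using qQ by (simp add: power2_eq_square)
      have "Q / 4 \<le> L2_inner g \<phi> - L2_inner f \<phi>" using 1 f\<phi> by linarith
      also have "\<dots> = - L2_inner (\<lambda>\<eta>. f \<eta> - g \<eta>) \<phi>"
        using L2_inner_diff_left[OF fL2 gL2 \<phi>] by simp
      also have "\<dots> \<le> \<delta> * L2_norm \<phi>"
        using L2_Cauchy_Schwarz[OF fg \<phi>] by (simp add: \<delta>_def)
      also have "\<dots> \<le> \<delta> * (sqrt G * (1 / h powr s) * q)"
      proof (rule mult_left_mono)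
        have "real l powr s \<le> ((A + 8) / h\<^sup>2) powr s"
          using l_le' s by (intro powr_mono2) auto
        also have "\<dots> = (A + 8) powr s / (h powr s)\<^sup>2"
        proof -
          have "(h\<^sup>2) powr s = (h powr 2) powr s" using sep by (subst powr_numeral) auto
          also have "\<dots> = h powr (s + s)" by (simp only: powr_powr) simp
          also have "\<dots> = (h powr s)\<^sup>2" by (simp only: powr_add power2_eq_square)
          finally show ?thesis by (simp only: powr_divide)
        qed
        finally have "E * real l powr s * Q \<le> E * ((A + 8) powr s / (h powr s)\<^sup>2) * Q"
          using E Q by (intro mult_right_mono mult_left_mono) auto
        then have "(L2_norm \<phi>)\<^sup>2 \<le> E * ((A + 8) powr s / (h powr s)\<^sup>2) * Q" using 2 by linarith
        also have "\<dots> = (sqrt G * (1 / h powr s) * q)\<^sup>2"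
        proof -
          have "(sqrt G)\<^sup>2 = E * (A + 8) powr s" using G by (simp add: G_def)
          then show ?thesis unfolding power_mult_distrib power_divide qQ by simp
        qed
        finally show "L2_norm \<phi> \<le> sqrt G * (1 / h powr s) * q"
          by (rule power2_le_imp_le) (use G q0 in simp)
      qed (simp add: \<delta>_def)
      finally have "q * q / 4 \<le> \<delta> * (sqrt G * (1 / h powr s)) * q"
        using qQ by (simp add: power2_eq_square mult.assoc)
      then have "q / 4 * q \<le> (\<delta> * (sqrt G * (1 / h powr s))) * q" by simp
      then have "q / 4 \<le> \<delta> * (sqrt G * (1 / h powr s))"
        using q0 by (rule mult_right_le_imp_le)
      then have "q / (4 * sqrt G) * h powr s \<le> \<delta>"
        using G sep by (simp add: field_simps)
      moreover have "C * (1 / sqrt (real n)) * h powr s * F \<le> q / (4 * sqrt G) * h powr s"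
      proof -
        have "C * (1 / sqrt (real n)) * F \<le> 1 / (8 * sqrt G) * (1 / sqrt (real n)) * F"
          using F0 n by (intro mult_right_mono) (auto simp: C_def)
        also have "\<dots> = F / (2 * sqrt (real n)) / (4 * sqrt G)" by simp
        also have "\<dots> \<le> q / (4 * sqrt G)" using q_ge G by (intro divide_right_mono) auto
        finally have "C * (1 / sqrt (real n)) * F * h powr s \<le> q / (4 * sqrt G) * h powr s"
          by (intro mult_right_mono) auto
        then show ?thesis by (simp only: mult_ac)
      qed
      ultimately show ?thesis by linarith
    qed
    then show ?thesis by (simp only: npowr F_def \<delta>_def g_def s_def)
  qed
  show ?thesis
    by (intro exI[of _ C] conjI allI impI, rule C, rule main)
qed

theorem theorem3p1:
  fixes d k :: nat and r :: real and f :: "'a::euclidean_space \<Rightarrow> real"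
  assumes "d \<ge> 1" and "k \<ge> 1"
    and "DIM('a) = d + 1"
    and "r > (real d + 2 * real k + 1) / 2"
    and "f \<in> sobolev_sphere r"
  shows
    "(\<exists>C>0. \<forall>n\<ge>2. \<forall>\<theta> :: nat \<Rightarrow> 'a.
        (\<forall>j\<in>{1..n}. \<theta> j \<in> sphere 0 1) \<longrightarrow> antipodal_separation n \<theta> > 0 \<longrightarrow>
        (INF g\<in>shallow_space k n \<theta>. L2_norm (\<lambda>\<eta>. f \<eta> - g \<eta>))
          \<ge> C * real n powr (- (1 / 2)) * antipodal_separation n \<theta> powr (real k + 1 / 2) * L2_norm f)
   \<and> (\<forall>C0>0. \<exists>C'>0. \<forall>n\<ge>2. \<forall>\<theta> :: nat \<Rightarrow> 'a.
        (\<forall>j\<in>{1..n}. \<theta> j \<in> sphere 0 1) \<longrightarrow> antipodal_separation n \<theta> > 0 \<longrightarrow>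
        fill_distance n \<theta> \<le> C0 * antipodal_separation n \<theta> \<longrightarrow>
        (INF g\<in>shallow_space k n \<theta>. L2_norm (\<lambda>\<eta>. f \<eta> - g \<eta>))
          \<ge> C' * real n powr (- ((real d + 2 * real k + 1) / (2 * real d))) * L2_norm f)"
proof -
  define s where "s = real k + 1 / 2"
  have s: "s > 0" by (simp add: s_def)
  have "\<exists>C>0. \<forall>n (\<theta> :: nat \<Rightarrow> 'a) a. antipodal_set n \<theta> \<longrightarrow>
    C * real n powr (- (1 / 2)) * antipodal_separation n \<theta> powr s * L2_norm f \<le>
      L2_norm (\<lambda>\<eta>. f \<eta> - (\<Sum>j=1..n. a j * relu_pow k (\<theta> j \<bullet> \<eta>)))"
  \<comment> \<open>For zero norm the right-hand factor vanishes and any positive constant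
    works.\<close>
  proof (cases "L2_norm f > 0")
    case True
    show ?thesis unfolding s_def by (rule approximation_lower_bound[OF assms True])
  next
    case False
    then have "L2_norm f = 0" using L2_norm_nonneg[of f] by linarith
    then show ?thesis by (intro exI[of _ 1]) simp
  qed
  then obtain C where C: "C > 0" and bound: "\<forall>n (\<theta> :: nat \<Rightarrow> 'a) a. antipodal_set n \<theta> \<longrightarrow>
    C * real n powr (- (1 / 2)) * antipodal_separation n \<theta> powr s * L2_norm f \<le>
      L2_norm (\<lambda>\<eta>. f \<eta> - (\<Sum>j=1..n. a j * relu_pow k (\<theta> j \<bullet> \<eta>)))"
    by (elim exE conjE)
  have INF: "C * real n powr (- (1 / 2)) * antipodal_separation n \<theta> powr s * L2_norm f \<le>
      (INF g\<in>shallow_space k n \<theta>. L2_norm (\<lambda>\<eta>. f \<eta> - g \<eta>))"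
    if "antipodal_set n \<theta>" for n and \<theta> :: "nat \<Rightarrow> 'a"
  proof (rule cINF_greatest)
    show "shallow_space k n \<theta> \<noteq> {}" by (auto simp: shallow_space_def)
    fix g assume "g \<in> shallow_space k n \<theta>"
    then obtain a where "g = (\<lambda>\<eta>. \<Sum>j=1..n. a j * relu_pow k (\<theta> j \<bullet> \<eta>))"
      by (auto simp: shallow_space_def)
    then show "C * real n powr (- (1 / 2)) * antipodal_separation n \<theta> powr s * L2_norm f \<le>
        L2_norm (\<lambda>\<eta>. f \<eta> - g \<eta>)"
      using bound[rule_format, OF that, of a] by simp
  qed
  obtain c where c: "c > 0" and fill: "\<forall>n\<ge>1. \<forall>\<theta> :: nat \<Rightarrow> 'a. (\<forall>j\<in>{1..n}. norm (\<theta> j) = 1) \<longrightarrow>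
    c * real n powr (- (1 / real d)) \<le> fill_distance n \<theta>"
    using fill_distance_lower[OF assms(3,1)] by (elim exE conjE)
  \<comment> \<open>Quasi-uniformity bounds the separation below by the fill distance, which for any
    n points is at least of order n^(-1/d).\<close>
  have quasi_uniform: "C * (c / C0) powr s * real n powr (- ((real d + 2 * real k + 1) / (2 * real d))) * L2_norm f \<le>
      (INF g\<in>shallow_space k n \<theta>. L2_norm (\<lambda>\<eta>. f \<eta> - g \<eta>))"
    if C0: "C0 > 0" and n: "n \<ge> 2" and unit: "\<forall>j\<in>{1..n}. \<theta> j \<in> sphere 0 1"
      and sep: "antipodal_separation n \<theta> > 0" and qu: "fill_distance n \<theta> \<le> C0 * antipodal_separation n \<theta>"
    for C0 n and \<theta> :: "nat \<Rightarrow> 'a"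
  proof -
    have "c * real n powr (- (1 / real d)) \<le> C0 * antipodal_separation n \<theta>"
      using fill[rule_format, of n \<theta>] n unit qu by (force intro: order_trans)
    then have "c / C0 * real n powr (- (1 / real d)) \<le> antipodal_separation n \<theta>"
      using C0 by (simp add: field_simps)
    then have "(c / C0 * real n powr (- (1 / real d))) powr s \<le> antipodal_separation n \<theta> powr s"
      using c C0 s by (intro powr_mono2) auto
    moreover have "(c / C0 * real n powr (- (1 / real d))) powr s = (c / C0) powr s * real n powr (- (1 / real d) * s)"
      by (simp only: powr_mult powr_powr)
    ultimately have sep_ge: "(c / C0) powr s * real n powr (- (1 / real d) * s) \<le> antipodal_separation n \<theta> powr s"
      by simp
    have "- ((real d + 2 * real k + 1) / (2 * real d)) = - (1 / 2) + - (1 / real d) * s"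
      using assms(1) by (simp add: s_def field_simps)
    then have "C * (c / C0) powr s * real n powr (- ((real d + 2 * real k + 1) / (2 * real d))) * L2_norm f =
        C * real n powr (- (1 / 2)) * ((c / C0) powr s * real n powr (- (1 / real d) * s)) * L2_norm f"
      by (simp only: powr_add mult_ac)
    also have "\<dots> \<le> C * real n powr (- (1 / 2)) * antipodal_separation n \<theta> powr s * L2_norm f"
      using C sep_ge by (intro mult_right_mono mult_left_mono) auto
    also have "\<dots> \<le> (INF g\<in>shallow_space k n \<theta>. L2_norm (\<lambda>\<eta>. f \<eta> - g \<eta>))"
      by (rule INF[OF antipodal_setI[OF n unit sep]])
    finally show ?thesis .
  qed
  show ?thesis
  proof (intro conjI allI impI)
    show "\<exists>C>0. \<forall>n\<ge>2. \<forall>\<theta> :: nat \<Rightarrow> 'a.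
        (\<forall>j\<in>{1..n}. \<theta> j \<in> sphere 0 1) \<longrightarrow> antipodal_separation n \<theta> > 0 \<longrightarrow>
        (INF g\<in>shallow_space k n \<theta>. L2_norm (\<lambda>\<eta>. f \<eta> - g \<eta>))
          \<ge> C * real n powr (- (1 / 2)) * antipodal_separation n \<theta> powr (real k + 1 / 2) * L2_norm f"
      using C INF[OF antipodal_setI] unfolding s_def by (intro exI[of _ C] conjI allI impI)
    fix C0 :: real assume "C0 > 0"
    then show "\<exists>C'>0. \<forall>n\<ge>2. \<forall>\<theta> :: nat \<Rightarrow> 'a.
        (\<forall>j\<in>{1..n}. \<theta> j \<in> sphere 0 1) \<longrightarrow> antipodal_separation n \<theta> > 0 \<longrightarrow>
        fill_distance n \<theta> \<le> C0 * antipodal_separation n \<theta> \<longrightarrow>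
        (INF g\<in>shallow_space k n \<theta>. L2_norm (\<lambda>\<eta>. f \<eta> - g \<eta>))
          \<ge> C' * real n powr (- ((real d + 2 * real k + 1) / (2 * real d))) * L2_norm f"
      using C c quasi_uniform by (intro exI[of _ "C * (c / C0) powr s"] conjI allI impI) auto
  qed
qed

end
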